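(* Let $\Omega\subset\mathbb{R}^2$ be a bounded domain and let $h\in C(\mathbb{R})$ be strictly increasing on $\mathbb{R}$ with $h(0)=0$ and $h(1)=1$. Let $\mu>0$ and let $u,v\colon\bar\Omega\to\mathbb{R}^2$ be Lipschitz solutions of the problem $$h(\det Du)\,Du=Dv\ \text{ a.e. in }\Omega,\qquad u(x)|_{\partial\Omega}=x,\qquad v(x)|_{\partial\Omega}=\mu x,$$ such that $\det Du\ge0$ a.e. in $\Omega$. Then $\det Du=1$ a.e. on $\Omega$; thus, $\mu=1$ and $u=v$ on $\bar\Omega$.
   Context: $Du$ denotes the Jacobian matrix, $(Du)^i_j=\partial u^i/\partial x_j$. *)

theory Defs
  imports "HOL-Analysis.Analysis"
begin

text \<open>Row \<open>i\<close>, column \<open>j\<close> is the partial derivative of the \<open>i\<close>-th component in the \<open>j\<close>-th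
  coordinate direction. Only values of \<open>u\<close> near \<open>x\<close> matter. As with \<open>deriv\<close>, the entries are
  meaningless where the partial derivatives do not exist; for a Lipschitz map this happens only on
  a null set. Unlike the library's \<open>jacobian\<close>, which is the matrix of the Frechet derivative,
  this does not presuppose total differentiability; the two agree wherever \<open>u\<close> is differentiable.\<close>

definition jac :: "(real ^ 'n \<Rightarrow> real ^ 'm) \<Rightarrow> real ^ 'n \<Rightarrow> real ^ 'n ^ 'm" where
  "jac u x = (\<chi> i j. deriv (\<lambda>t. u (x + t *\<^sub>R axis j 1) $ i) 0)"

end

theory Submission
  imports Defs
begin

text \<open>
  Write \<open>d = det Du\<close> and extend \<open>u\<close> and \<open>F = v / \<mu>\<close> by the identity to Lipschitz maps of the whole
  plane. By the equation, \<open>w = F - u\<close> has \<open>det Dw = (h d / \<mu> - 1)\<^sup>2 * d \<ge> 0\<close>. Jacobians of pairs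
  are null Lagrangians (\<open>integral_jacobian_eq_0\<close>) and \<open>w\<close> vanishes outside \<open>\<Omega>\<close>, so
  \<open>det Dw = 0\<close> almost everywhere: at almost every point either \<open>d = 0\<close>, and then \<open>DF = 0\<close>, or
  \<open>h d = \<mu>\<close>, and then \<open>d\<close> is the one number \<open>c\<close> with \<open>h c = \<mu>\<close> and \<open>DF = Du\<close>. Once the first
  alternative is excluded up to a null set, \<open>Dw = 0\<close> almost everywhere, hence \<open>w = 0\<close>; moreover
  \<open>det Du - 1\<close> integrates to \<open>0\<close> over \<open>\<Omega>\<close>, which forces \<open>c = 1\<close>, and \<open>\<mu> = h 1 = 1\<close>.

  The heart of the matter is therefore that the critical set of \<open>F\<close> is null
  (\<open>lipschitz_map_no_critical_set\<close>). Since \<open>F\<close> is Lipschitz with Jacobian either vanishing together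
  with \<open>DF\<close> or bounded below, it is quasiregular, and the claim is an instance of Reshetnyak's
  theorem on nonconstant quasiregular maps. Here it has a direct proof, because \<open>F\<close> has degree one
  and \<open>\<bar>DF\<bar>\<close> is bounded by a multiple of \<open>det DF\<close>. Pull a bump concentrated near \<open>y\<close> back
  by \<open>F\<close>, weighted with the Jacobian, and take the mean of the coordinates against this density. The
  total mass does not depend on \<open>y\<close> (\<open>integral_dens\<close>). Moving \<open>y\<close> changes the density by a divergence,
  and integration by parts bounds the change of the mean by a constant times the
  displacement, up to the size of the bump (\<open>mean_lipschitz\<close>). If \<open>F\<close> is totally differentiable at \<open>x\<close>
  with positive Jacobian, a neighbourhood of \<open>x\<close> already carries the full mass when \<open>y = F x\<close>, so the
  mean tends to \<open>x\<close> (\<open>mean_at_regular\<close>). Together these bound \<open>dist x x'\<close> by a multiple of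
  \<open>dist (F x) (F x')\<close> on the regular points. Their image is dense, so the inverse
  extends to a Lipschitz map of the plane, which is onto by Brouwer's theorem, and the bound spreads to
  all points (\<open>lower_lipschitz_of_dense\<close>). It is incompatible with \<open>DF = 0\<close> at any point.

  The differentiability of Lipschitz functions along lines and Rademacher's theorem in the
  plane are derived from the Vitali covering theorem.
\<close>

section \<open>Lipschitz functions are differentiable along lines almost everywhere\<close>

text \<open>One half of the differentiation theory of measures: a bound on a fine cover by balls passes to
  the set, because Vitali's theorem selects disjoint balls that exhaust it up to a null set, inside an
  open set that is only slightly larger.\<close>
lemma emeasure_le_of_small_cballs:
  fixes S :: "'a::euclidean_space set"
  assumes sets_nu: "sets \<nu> = sets borel"
    and abs_cont: "\<And>N. N \<in> null_sets lborel \<Longrightarrow> N \<in> null_sets \<nu>"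
    and S: "S \<in> sets borel"
    and small: "\<And>x d. x \<in> S \<Longrightarrow> 0 < d \<Longrightarrow>
      \<exists>a r. 0 < r \<and> r < d \<and> x \<in> cball a r \<and> emeasure \<nu> (cball a r) \<le> ennreal c * emeasure lborel (cball a r)"
  shows "emeasure \<nu> S \<le> ennreal c * emeasure lborel S"
proof -
  \<comment> \<open>Compare first with open supersets, in which the covering balls are confined.\<close>
  have open_bound: "emeasure \<nu> S \<le> ennreal c * emeasure lborel U" if U: "open U" "S \<subseteq> U" for U
  proof -
    define K where "K = {p. 0 < snd p \<and> cball (fst p) (snd p) \<subseteq> U \<and>
      emeasure \<nu> (cball (fst p) (snd p)) \<le> ennreal c * emeasure lborel (cball (fst p) (snd p :: real))}"
    have cover: "\<exists>p. p \<in> K \<and> x \<in> cball (fst p) (snd p) \<and> snd p < d" if xd: "x \<in> S" "0 < d" for x d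
    proof -
      obtain e where e: "e > 0" "ball x e \<subseteq> U"
        using U xd by (meson open_contains_ball subsetD)
      then obtain a r where ar: "0 < r" "r < min d (e/2)" "x \<in> cball a r"
        "emeasure \<nu> (cball a r) \<le> ennreal c * emeasure lborel (cball a r)"
        using small[OF xd(1), of "min d (e/2)"] xd(2) by force
      have "cball a r \<subseteq> ball x e"
      proof
        fix z assume "z \<in> cball a r"
        then show "z \<in> ball x e"
          using ar dist_triangle[of x z a] by (simp add: dist_commute)
      qed
      with ar e show ?thesis
        by (intro exI[of _ "(a, r)"]) (auto simp: K_def)
    qed
    have rpos: "0 < snd p" if "p \<in> K" for p
      using that by (simp add: K_def)
    obtain C where C: "countable C" "C \<subseteq> K"
      and disj: "pairwise (\<lambda>i j. disjnt (cball (fst i) (snd i)) (cball (fst j) (snd j))) C"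
      and neg: "negligible (S - (\<Union>i\<in>C. cball (fst i) (snd i)))"
      by (rule Vitali_covering_theorem_cballs[OF rpos cover])
    let ?W = "\<Union>i\<in>C. cball (fst i) (snd i)"
    have W: "?W \<in> sets borel" using C(1) by auto
    have dis: "disjoint_family_on (\<lambda>i. cball (fst i) (snd i)) C"
      using disj by (auto simp: disjoint_family_on_def pairwise_def disjnt_def)
    have "S - ?W \<in> null_sets lborel"
      using neg S W by (auto simp: negligible_iff_null_sets null_sets_completion_iff)
    then have 0: "emeasure \<nu> (S - ?W) = 0" using abs_cont by auto
    have "emeasure \<nu> S \<le> emeasure \<nu> (?W \<union> (S - ?W))"
      using S W sets_nu by (intro emeasure_mono) (auto simp del: Un_Diff_cancel)
    also have "\<dots> \<le> emeasure \<nu> ?W + emeasure \<nu> (S - ?W)"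
      using S W sets_nu by (intro emeasure_subadditive) auto
    also have "\<dots> = (\<integral>\<^sup>+i. emeasure \<nu> (cball (fst i) (snd i)) \<partial>count_space C)"
      using 0 C dis sets_nu by (simp add: emeasure_UN_countable)
    also have "\<dots> \<le> (\<integral>\<^sup>+i. ennreal c * emeasure lborel (cball (fst i) (snd i)) \<partial>count_space C)"
      using C(2) by (intro nn_integral_mono) (auto simp: K_def)
    also have "\<dots> = ennreal c * emeasure lborel ?W"
      using C dis by (simp add: emeasure_UN_countable nn_integral_cmult)
    also have "\<dots> \<le> ennreal c * emeasure lborel U"
      using C(2) U by (intro mult_left_mono emeasure_mono) (auto simp: K_def)
    finally show ?thesis .
  qed
  show ?thesis
  proof (rule ennreal_le_epsilon)
    fix e :: real assume e: "0 < e"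
    define e' where "e' = e / (\<bar>c\<bar> + 1)"
    have "e' > 0" using e by (simp add: e'_def)
    then obtain U where U: "open U" "S \<subseteq> U" "emeasure lborel (U - S) < e'"
      using outer_regular_lborel[OF S] by blast
    have "emeasure lborel U \<le> emeasure lborel S + emeasure lborel (U - S)"
      using emeasure_subadditive[of S lborel "U - S"] S U by (simp add: Un_absorb1)
    also have "\<dots> \<le> emeasure lborel S + ennreal e'"
      using U by (intro add_left_mono) auto
    finally have "ennreal c * emeasure lborel U \<le> ennreal c * (emeasure lborel S + ennreal e')"
      by (rule mult_left_mono) auto
    also have "\<dots> = ennreal c * emeasure lborel S + ennreal c * ennreal e'"
      by (simp add: distrib_left)
    also have "ennreal c * ennreal e' \<le> ennreal e"
    proof -
      have "ennreal c * ennreal e' \<le> ennreal (\<bar>c\<bar> + 1) * ennreal e'"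
        by (intro mult_right_mono ennreal_leI) auto
      also have "\<dots> = ennreal e"
        using \<open>e' > 0\<close> by (subst ennreal_mult[symmetric]) (auto simp: e'_def)
      finally show ?thesis .
    qed
    finally show "emeasure \<nu> S \<le> ennreal c * emeasure lborel S + ennreal e"
      using open_bound[OF U(1,2)] by (meson add_left_mono order_trans)
  qed
qed

text \<open>The image of \<open>S\<close> under an increasing homeomorphism \<open>g\<close> with inverse \<open>k\<close> is \<open>k -` S\<close>; if \<open>g\<close> has
  arbitrarily short secants of slope at most \<open>c\<close> at every point of \<open>S\<close>, it stretches \<open>S\<close> at most by \<open>c\<close>.
  Interchanging \<open>g\<close> and \<open>k\<close> turns this into a bound from below in the presence of steep secants.\<close>
lemma emeasure_homeo_preimage_le:
  fixes g k :: "real \<Rightarrow> real"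
  assumes g: "strict_mono g" "continuous_on UNIV g" and gk: "\<And>x. g (k x) = x" "\<And>x. k (g x) = x"
    and lip: "\<And>x y. \<bar>g x - g y\<bar> \<le> M * \<bar>x - y\<bar>"
    and k: "continuous_on UNIV k"
    and S: "S \<in> sets borel"
    and small: "\<And>x d. x \<in> S \<Longrightarrow> 0 < d \<Longrightarrow> \<exists>y. y \<noteq> x \<and> \<bar>y - x\<bar> < d \<and> \<bar>g y - g x\<bar> \<le> c * \<bar>y - x\<bar>"
  shows "emeasure lborel (k -` S) \<le> ennreal c * emeasure lborel S"
proof -
  have [measurable]: "k \<in> borel_measurable borel"
    using k by (rule borel_measurable_continuous_onI)
  define \<nu> where "\<nu> = distr lborel borel k"
  have pre: "k -` A = g ` A" for A
    using gk by (auto intro!: image_eqI[where x="k _"])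
  have nu: "emeasure \<nu> A = emeasure lborel (g ` A)" if "A \<in> sets borel" for A
    using that by (simp add: \<nu>_def emeasure_distr pre)
  have null: "N \<in> null_sets \<nu>" if N: "N \<in> null_sets lborel" for N
  proof -
    have "negligible N"
      using N by (simp add: negligible_iff_null_sets null_sets_completionI)
    then have "negligible (g ` N)"
    proof (rule negligible_locally_Lipschitz_image[rotated])
      fix x assume "x \<in> N"
      show "\<exists>T B. open T \<and> x \<in> T \<and> (\<forall>y\<in>N \<inter> T. norm (g y - g x) \<le> B * norm (y - x))"
        using lip by (intro exI[of _ UNIV] exI[of _ M]) auto
    qed simp
    moreover have "g ` N \<in> sets borel"
      using N measurable_sets[of k borel borel N] by (auto simp: pre)
    ultimately have "g ` N \<in> null_sets lborel"
      by (simp add: negligible_iff_null_sets null_sets_completion_iff)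
    then show ?thesis
      using N by (auto simp: null_sets_def nu \<nu>_def[THEN arg_cong[where f=sets]])
  qed
  have "emeasure \<nu> S \<le> ennreal c * emeasure lborel S"
  proof (rule emeasure_le_of_small_cballs[OF _ null S])
    show "sets \<nu> = sets borel" by (simp add: \<nu>_def)
    fix x d :: real assume xd: "x \<in> S" "0 < d"
    obtain y where y: "y \<noteq> x" "\<bar>y - x\<bar> < d" "\<bar>g y - g x\<bar> \<le> c * \<bar>y - x\<bar>"
      using small[OF xd] by blast
    define a b where "a = min x y" and "b = max x y"
    have ab: "a < b" "b - a < d" using y by (auto simp: a_def b_def)
    have ball: "cball ((a+b)/2) ((b-a)/2) = {a..b}"
      by (auto simp: cball_def dist_real_def abs_if field_simps)
    have mono: "x \<le> y \<longleftrightarrow> g x \<le> g y" for x y using g(1) by (simp add: strict_mono_less_eq)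
    have "g ` {a..b} = {g a..g b}"
    proof (intro subset_antisym subsetI)
      fix z assume "z \<in> {g a..g b}"
      then have "g (k z) = z" "k z \<in> {a..b}"
        using gk(1)[of z] mono[of a "k z"] mono[of "k z" b] by auto
      then show "z \<in> g ` {a..b}" by (metis imageI)
    qed (use mono in auto)
    moreover have "g a \<le> g b" using ab mono[of a b] by simp
    moreover have "g b - g a \<le> c * (b - a)"
      using y ab mono[of x y] mono[of y x] by (auto simp: a_def b_def min_def max_def abs_if split: if_splits)
    ultimately have "emeasure \<nu> {a..b} \<le> ennreal (c * (b - a))"
      by (simp add: nu ennreal_leI)
    also have "\<dots> = ennreal c * emeasure lborel {a..b}"
      using ab by (simp add: ennreal_mult'')
    finally show "\<exists>a r. 0 < r \<and> r < d \<and> x \<in> cball a r \<and> emeasure \<nu> (cball a r) \<le> ennreal c * emeasure lborel (cball a r)"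
      using ab ball by (intro exI[of _ "(a+b)/2"] exI[of _ "(b-a)/2"]) (auto simp: a_def b_def)
  qed
  then show ?thesis
    using S by (simp add: nu pre)
qed

definition slopes_oscillate :: "(real \<Rightarrow> real) \<Rightarrow> real \<Rightarrow> real \<Rightarrow> bool" where
  "slopes_oscillate q \<alpha> \<beta> \<longleftrightarrow>
     (\<forall>d>0. \<exists>t. t \<noteq> 0 \<and> \<bar>t\<bar> < d \<and> q t < \<alpha>) \<and> (\<forall>d>0. \<exists>t. t \<noteq> 0 \<and> \<bar>t\<bar> < d \<and> \<beta> < q t)"

text \<open>Nonconvergence witnessed by countably many conditions, which makes the set of points of
  differentiability measurable and allows its complement to be handled one pair of rationals at
  a time.\<close>
lemma tendsto_iff_not_slopes_oscillate:
  assumes bdd: "\<And>t. \<bar>q t\<bar> \<le> L"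
  shows "(\<exists>l. (q \<longlongrightarrow> l) (at 0)) \<longleftrightarrow> \<not> (\<exists>\<alpha>\<in>\<rat>. \<exists>\<beta>\<in>\<rat>. \<alpha> < \<beta> \<and> slopes_oscillate q \<alpha> \<beta>)"
    (is "?L \<longleftrightarrow> ?R")
proof
  assume ?L
  then obtain l where l: "(q \<longlongrightarrow> l) (at 0)" ..
  show ?R
  proof clarify
    fix \<alpha> \<beta> :: real assume ab: "\<alpha> < \<beta>" and osc: "slopes_oscillate q \<alpha> \<beta>"
    show False
    proof (cases "l < \<beta>")
      case True
      then have "eventually (\<lambda>t. q t < \<beta>) (at 0)" using l by (simp add: order_tendstoD)
      then obtain d where "d > 0" "\<And>t. t \<noteq> 0 \<Longrightarrow> \<bar>t\<bar> < d \<Longrightarrow> q t < \<beta>"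
        unfolding eventually_at by auto
      with osc show False unfolding slopes_oscillate_def by (meson less_asym)
    next
      case False
      then have "eventually (\<lambda>t. \<alpha> < q t) (at 0)" using l ab by (simp add: order_tendstoD)
      then obtain d where "d > 0" "\<And>t. t \<noteq> 0 \<Longrightarrow> \<bar>t\<bar> < d \<Longrightarrow> \<alpha> < q t"
        unfolding eventually_at by auto
      with osc show False unfolding slopes_oscillate_def by (meson less_asym)
    qed
  qed
next
  assume R: ?R
  let ?q = "\<lambda>t. ereal (q t)"
  have eq: "Liminf (at 0) ?q = Limsup (at 0) ?q"
  proof (rule ccontr)
    assume "Liminf (at 0) ?q \<noteq> Limsup (at 0) ?q"
    then have "Liminf (at 0) ?q < Limsup (at 0) ?q"
      using Liminf_le_Limsup[of "at (0::real)" ?q] by auto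
    then obtain \<beta>' where b: "Liminf (at 0) ?q < ereal (of_rat \<beta>')" "ereal (of_rat \<beta>') < Limsup (at 0) ?q"
      using ereal_dense3 by blast
    then obtain \<alpha>' where a: "Liminf (at 0) ?q < ereal (of_rat \<alpha>')" "ereal (of_rat \<alpha>') < ereal (of_rat \<beta>')"
      using ereal_dense3 by blast
    define \<alpha> \<beta> :: real where "\<alpha> = of_rat \<alpha>'" and "\<beta> = of_rat \<beta>'"
    have "slopes_oscillate q \<alpha> \<beta>"
      unfolding slopes_oscillate_def
    proof (intro conjI allI impI)
      fix d :: real assume d: "0 < d"
      show "\<exists>t. t \<noteq> 0 \<and> \<bar>t\<bar> < d \<and> q t < \<alpha>"
      proof (rule ccontr)
        assume "\<not> ?thesis"
        then have "eventually (\<lambda>t. ereal \<alpha> \<le> ?q t) (at 0)"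
          unfolding eventually_at using d by (intro exI[of _ d]) (auto simp: not_less)
        then have "ereal \<alpha> \<le> Liminf (at 0) ?q" by (rule Liminf_bounded)
        then show False using a by (simp add: \<alpha>_def)
      qed
      show "\<exists>t. t \<noteq> 0 \<and> \<bar>t\<bar> < d \<and> \<beta> < q t"
      proof (rule ccontr)
        assume "\<not> ?thesis"
        then have "eventually (\<lambda>t. ?q t \<le> ereal \<beta>) (at 0)"
          unfolding eventually_at using d by (intro exI[of _ d]) (auto simp: not_less)
        then have "Limsup (at 0) ?q \<le> ereal \<beta>" by (rule Limsup_bounded)
        then show False using b by (simp add: \<beta>_def)
      qed
    qed
    moreover have "\<alpha> < \<beta>" "\<alpha> \<in> \<rat>" "\<beta> \<in> \<rat>" using a by (auto simp: \<alpha>_def \<beta>_def)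
    ultimately show False using R by blast
  qed
  have "ereal (- L) \<le> Liminf (at 0) ?q"
    using bdd by (intro Liminf_bounded always_eventually) (simp add: abs_le_iff minus_le_iff)
  moreover have "Limsup (at 0) ?q \<le> ereal L"
    using bdd by (intro Limsup_bounded always_eventually) (simp add: abs_le_iff)
  ultimately obtain l where "Liminf (at 0) ?q = ereal l"
    unfolding eq by (cases "Limsup (at 0) ?q") auto
  then have "(?q \<longlongrightarrow> ereal l) (at 0)"
    using eq by (intro Liminf_eq_Limsup) auto
  then show ?L by auto
qed

abbreviation slope_along :: "('a::real_vector \<Rightarrow> real) \<Rightarrow> 'a \<Rightarrow> 'a \<Rightarrow> real \<Rightarrow> real" where
  "slope_along \<phi> e x \<equiv> \<lambda>t. (\<phi> (x + t *\<^sub>R e) - \<phi> x) / t"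

definition diff_along :: "('a::real_vector \<Rightarrow> real) \<Rightarrow> 'a \<Rightarrow> 'a \<Rightarrow> bool" where
  "diff_along \<phi> e x \<longleftrightarrow> (\<lambda>t. \<phi> (x + t *\<^sub>R e)) differentiable (at 0)"

lemma diff_along_iff_slope: "diff_along \<phi> e x \<longleftrightarrow> (\<exists>l. (slope_along \<phi> e x \<longlongrightarrow> l) (at 0))"
  by (simp add: diff_along_def real_differentiable_def DERIV_def)

lemma diff_along_iff:
  fixes \<phi> :: "'a::real_normed_vector \<Rightarrow> real"
  assumes lip: "L-lipschitz_on UNIV \<phi>"
  shows "diff_along \<phi> e x \<longleftrightarrow>
    \<not> (\<exists>\<alpha>\<in>\<rat>. \<exists>\<beta>\<in>\<rat>. \<alpha> < \<beta> \<and> slopes_oscillate (slope_along \<phi> e x) \<alpha> \<beta>)"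
  unfolding diff_along_iff_slope
proof (rule tendsto_iff_not_slopes_oscillate[of _ "L * norm e"])
  fix t :: real
  have "\<bar>\<phi> (x + t *\<^sub>R e) - \<phi> x\<bar> \<le> L * norm (t *\<^sub>R e)"
    using lipschitz_on_normD[OF lip, of "x + t *\<^sub>R e" x] by simp
  then show "\<bar>slope_along \<phi> e x t\<bar> \<le> L * norm e"
    using lipschitz_on_nonneg[OF lip]
    by (cases "t = 0") (auto simp: divide_le_eq mult_ac)
qed

text \<open>For a fixed increment the slope is a continuous function of the base point, so each of the
  countably many conditions defines an open set, although the increment ranges over an uncountable set.\<close>
lemma sets_slopes_oscillate:
  fixes \<phi> :: "'a::euclidean_space \<Rightarrow> real"
  assumes cont: "continuous_on UNIV \<phi>"
  shows "{x. slopes_oscillate (slope_along \<phi> e x) \<alpha> \<beta>} \<in> sets borel"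
proof -
  let ?T = "\<lambda>n::nat. {t::real. t \<noteq> 0 \<and> \<bar>t\<bar> < inverse (real (Suc n))}"
  have small: "(\<forall>d>0. \<exists>t. t \<noteq> 0 \<and> \<bar>t\<bar> < d \<and> P t) \<longleftrightarrow> (\<forall>n. \<exists>t\<in>?T n. P t)" for P :: "real \<Rightarrow> bool"
  proof
    assume R: "\<forall>n. \<exists>t\<in>?T n. P t"
    show "\<forall>d>0. \<exists>t. t \<noteq> 0 \<and> \<bar>t\<bar> < d \<and> P t"
    proof (intro allI impI)
      fix d :: real assume "0 < d"
      then obtain n where "inverse (real (Suc n)) < d" using reals_Archimedean by blast
      with R[rule_format, of n] show "\<exists>t. t \<noteq> 0 \<and> \<bar>t\<bar> < d \<and> P t" by force
    qed
  qed auto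
  have cont_slope: "continuous_on UNIV (\<lambda>x. slope_along \<phi> e x t)" if "t \<noteq> 0" for t
    using that by (intro continuous_intros continuous_on_compose2[OF cont]) auto
  have "{x. slopes_oscillate (slope_along \<phi> e x) \<alpha> \<beta>} =
     (\<Inter>n. (\<Union>t\<in>?T n. {x. slope_along \<phi> e x t < \<alpha>}) \<inter> (\<Union>t\<in>?T n. {x. \<beta> < slope_along \<phi> e x t}))"
    unfolding slopes_oscillate_def small by auto
  also have "\<dots> \<in> sets borel"
  proof (intro sets.countable_INT image_subsetI)
    fix n
    have "open (\<Union>t\<in>?T n. {x. slope_along \<phi> e x t < \<alpha>})" "open (\<Union>t\<in>?T n. {x. \<beta> < slope_along \<phi> e x t})"
      using cont_slope by (intro open_UN ballI open_Collect_less continuous_on_const; simp)+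
    then show "(\<Union>t\<in>?T n. {x. slope_along \<phi> e x t < \<alpha>}) \<inter> (\<Union>t\<in>?T n. {x. \<beta> < slope_along \<phi> e x t}) \<in> sets borel"
      by (intro sets.Int borel_open)
  qed auto
  finally show ?thesis .
qed

text \<open>Lebesgue's theorem for Lipschitz functions. Adding a multiple of the identity makes the function
  a bi-Lipschitz homeomorphism \<open>g\<close>. On the set where the slopes oscillate between
  \<open>\<alpha> < \<beta>\<close>, the flat secants give \<open>\<bar>g S\<bar> \<le> \<alpha> \<bar>S\<bar>\<close> and the steep ones, read for the inverse,
  give \<open>\<beta> \<bar>S\<bar> \<le> \<bar>g S\<bar>\<close> (both slopes shifted), so \<open>S\<close> is null.\<close>
lemma lipschitz_differentiable_AE_real:
  fixes \<psi> :: "real \<Rightarrow> real"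
  assumes lip: "L-lipschitz_on UNIV \<psi>"
  shows "AE x in lborel. diff_along \<psi> 1 x"
proof -
  have L: "0 \<le> L" by (rule lipschitz_on_nonneg[OF lip])
  have lipD: "\<bar>\<psi> x - \<psi> y\<bar> \<le> L * \<bar>x - y\<bar>" for x y
    using lipschitz_on_normD[OF lip, of x y] by simp
  define g where "g x = (L + 1) * x + \<psi> x" for x
  have g_up: "x - y \<le> g x - g y" if "y \<le> x" for x y
    using lipD[of x y] that L by (simp add: g_def algebra_simps abs_le_iff)
  have g_lip: "\<bar>g x - g y\<bar> \<le> (2 * L + 1) * \<bar>x - y\<bar>" for x y
  proof -
    have "g x - g y = (L + 1) * (x - y) + (\<psi> x - \<psi> y)"
      by (simp add: g_def algebra_simps)
    then have "\<bar>g x - g y\<bar> \<le> \<bar>(L + 1) * (x - y)\<bar> + \<bar>\<psi> x - \<psi> y\<bar>"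
      by linarith
    also have "\<dots> \<le> (L + 1) * \<bar>x - y\<bar> + L * \<bar>x - y\<bar>"
      using lipD[of x y] L by (simp add: abs_mult)
    finally show ?thesis by (simp add: algebra_simps)
  qed
  have mono: "strict_mono g"
    by (rule strict_monoI) (use g_up in \<open>smt (verit)\<close>)
  have cont: "continuous_on UNIV g"
    unfolding g_def using lipschitz_on_continuous_on[OF lip] by (intro continuous_intros)
  have "\<exists>x. g x = y" for y
  proof -
    have "g (- \<bar>y - g 0\<bar>) \<le> y" "y \<le> g \<bar>y - g 0\<bar>"
      using g_up[of "- \<bar>y - g 0\<bar>" 0] g_up[of 0 "\<bar>y - g 0\<bar>"] by linarith+
    then show ?thesis
      using IVT'[of g "- \<bar>y - g 0\<bar>" y "\<bar>y - g 0\<bar>"] continuous_on_subset[OF cont] by auto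
  qed
  then have "surj g" by (metis surjI)
  define k where "k = inv g"
  have gk: "g (k x) = x" "k (g x) = x" for x
    using \<open>surj g\<close> strict_mono_imp_inj_on[OF mono] by (auto simp: k_def surj_f_inv_f inv_f_f)
  have k_lip: "\<bar>k x - k y\<bar> \<le> 1 * \<bar>x - y\<bar>" for x y
    using g_up[of "k x" "k y"] g_up[of "k y" "k x"] by (auto simp: gk abs_if)
  have k_mono: "strict_mono k"
    by (rule strict_monoI) (metis gk(1) mono strict_mono_less)
  have k_cont: "continuous_on UNIV k"
    by (rule lipschitz_on_continuous_on[of 1]) (use k_lip in \<open>auto simp: lipschitz_on_def dist_real_def\<close>)
  have null: "{x. slopes_oscillate (slope_along \<psi> 1 x) \<alpha> \<beta>} \<in> null_sets lborel" (is "?S \<in> _")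
    if ab: "\<alpha> < \<beta>" for \<alpha> \<beta>
  proof (cases "?S = {}")
    case False
    \<comment> \<open>The slope bounds for \<open>g\<close>. They are positive because all slopes of \<open>g\<close> are at least \<open>1\<close>.\<close>
    define \<alpha>' \<beta>' where "\<alpha>' = \<alpha> + L + 1" and "\<beta>' = \<beta> + L + 1"
    have slope: "slope_along \<psi> 1 x t = (g (x + t) - g x) / t - (L + 1)" if "t \<noteq> 0" for x t
      using that by (simp add: g_def field_simps)
    have slope_ge: "1 \<le> (g (x + t) - g x) / t" if "t \<noteq> 0" for x t
      using that g_up[of x "x + t"] g_up[of "x + t" x] by (cases "0 < t") (auto simp: field_simps)
    have abs_slope: "\<bar>g (x + t) - g x\<bar> = (g (x + t) - g x) / t * \<bar>t\<bar>" if "t \<noteq> 0" for x t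
    proof -
      have "\<bar>(g (x + t) - g x) / t\<bar> = (g (x + t) - g x) / t"
        using slope_ge[OF that, of x] by linarith
      then show ?thesis using that by (simp add: abs_divide field_simps)
    qed
    obtain x t where "t \<noteq> 0" "slope_along \<psi> 1 x t < \<alpha>"
      using False by (auto simp: slopes_oscillate_def dest: spec[of _ "1::real"])
    then have pos: "0 < \<alpha>'" "0 < \<beta>'"
      using slope[of t x] slope_ge[of t x] ab unfolding \<alpha>'_def \<beta>'_def by linarith+
    have S: "?S \<in> sets borel"
      by (rule sets_slopes_oscillate[OF lipschitz_on_continuous_on[OF lip]])
    have "?S \<inter> ball 0 (real n) \<in> null_sets lborel" for n
    proof -
      let ?A = "?S \<inter> ball 0 (real n)"
      have A: "?A \<in> sets borel" using S by auto
      have lo: "\<exists>y. y \<noteq> x \<and> \<bar>y - x\<bar> < d \<and> \<bar>g y - g x\<bar> \<le> \<alpha>' * \<bar>y - x\<bar>" if x: "x \<in> ?A" and d: "0 < d" for x d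
      proof -
        obtain t where t: "t \<noteq> 0" "\<bar>t\<bar> < d" "slope_along \<psi> 1 x t < \<alpha>"
          using x d by (auto simp: slopes_oscillate_def)
        then have "(g (x + t) - g x) / t < \<alpha>'" using slope[of t x] by (simp add: \<alpha>'_def)
        moreover have "\<bar>g (x + t) - g x\<bar> = (g (x + t) - g x) / t * \<bar>t\<bar>"
          using t by (intro abs_slope) auto
        ultimately have "\<bar>g (x + t) - g x\<bar> \<le> \<alpha>' * \<bar>t\<bar>"
          by (metis abs_ge_zero less_imp_le mult_right_mono)
        then show ?thesis
          using t by (intro exI[of _ "x + t"]) auto
      qed
      have hi: "\<exists>z. z \<noteq> y \<and> \<bar>z - y\<bar> < d \<and> \<bar>k z - k y\<bar> \<le> inverse \<beta>' * \<bar>z - y\<bar>"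
        if y: "y \<in> k -` ?A" and d: "0 < d" for y d
      proof -
        define x where "x = k y"
        have y_eq: "y = g x" by (simp add: x_def gk)
        have osc: "slopes_oscillate (slope_along \<psi> 1 x) \<alpha> \<beta>"
          using y by (simp add: x_def)
        have dL: "0 < d / (2 * L + 1)" using d L by simp
        obtain t where t: "t \<noteq> 0" "\<bar>t\<bar> < d / (2 * L + 1)" "\<beta> < slope_along \<psi> 1 x t"
          using osc[unfolded slopes_oscillate_def, THEN conjunct2, rule_format, OF dL] by blast
        have "\<bar>g (x + t) - g x\<bar> \<le> (2 * L + 1) * \<bar>t\<bar>" using g_lip[of "x + t" x] by simp
        also have "\<dots> < d" using t(2) L by (simp add: field_simps)
        finally have near: "\<bar>g (x + t) - y\<bar> < d" by (simp add: y_eq)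
        have "\<beta>' < (g (x + t) - g x) / t" using slope[of t x] t by (simp add: \<beta>'_def)
        then have "\<beta>' * \<bar>t\<bar> \<le> (g (x + t) - g x) / t * \<bar>t\<bar>"
          by (intro mult_right_mono) auto
        then have "\<beta>' * \<bar>t\<bar> \<le> \<bar>g (x + t) - g x\<bar>"
          using abs_slope[OF t(1), of x] by simp
        then have "\<bar>t\<bar> \<le> inverse \<beta>' * \<bar>g (x + t) - y\<bar>"
          using pos unfolding y_eq by (simp add: field_simps)
        moreover have "\<bar>k (g (x + t)) - k y\<bar> = \<bar>t\<bar>"
          by (simp add: gk(2) x_def[symmetric])
        moreover have "g (x + t) \<noteq> y"
        proof
          assume "g (x + t) = y"
          then have "k (g (x + t)) = x" by (simp add: x_def)
          then show False using t(1) by (simp add: gk(2))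
        qed
        ultimately show ?thesis
          using near by (intro exI[of _ "g (x + t)"]) simp
      qed
      have kA: "k -` ?A \<in> sets borel"
        using measurable_sets[OF borel_measurable_continuous_onI[OF k_cont], of ?A] A by simp
      have "emeasure lborel (g -` (k -` ?A)) \<le> ennreal (inverse \<beta>') * emeasure lborel (k -` ?A)"
        by (rule emeasure_homeo_preimage_le[OF k_mono k_cont gk(2) gk(1) k_lip cont kA hi])
      moreover have "g -` (k -` ?A) = ?A" by (auto simp: gk)
      ultimately have "emeasure lborel ?A \<le> ennreal (inverse \<beta>') * emeasure lborel (k -` ?A)"
        by (simp only:)
      also have "\<dots> \<le> ennreal (inverse \<beta>') * (ennreal \<alpha>' * emeasure lborel ?A)"
        by (rule mult_left_mono[OF emeasure_homeo_preimage_le[OF mono cont gk(1) gk(2) g_lip k_cont A lo]]) auto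
      finally have le: "emeasure lborel ?A \<le> ennreal (inverse \<beta>') * (ennreal \<alpha>' * emeasure lborel ?A)" .
      have "emeasure lborel ?A < \<infinity>"
        by (intro emeasure_bounded_finite) auto
      then obtain m where m: "emeasure lborel ?A = ennreal m" "0 \<le> m"
        by (cases "emeasure lborel ?A") auto
      have "ennreal m \<le> ennreal (inverse \<beta>' * (\<alpha>' * m))"
        using le pos m(2) unfolding m(1) by (simp add: ennreal_mult)
      then have "m \<le> inverse \<beta>' * (\<alpha>' * m)"
        using pos m by (subst (asm) ennreal_le_iff) auto
      then have "\<beta>' * m \<le> \<alpha>' * m" using pos by (simp add: field_simps)
      then have "m = 0" using ab m by (auto simp: \<alpha>'_def \<beta>'_def mult_le_cancel_right)
      then show ?thesis using m A by (auto simp: null_sets_def)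
    qed
    then have "(\<Union>n. ?S \<inter> ball 0 (real n)) \<in> null_sets lborel" by (rule null_sets_UN)
    moreover have "(\<Union>n. ?S \<inter> ball 0 (real n)) = ?S"
      by (auto simp: real_arch_simple reals_Archimedean2)
    ultimately show ?thesis by simp
  qed simp
  have "AE x in lborel. \<forall>\<alpha>\<in>\<rat>. \<forall>\<beta>\<in>\<rat>. \<alpha> < \<beta> \<longrightarrow> \<not> slopes_oscillate (slope_along \<psi> 1 x) \<alpha> \<beta>"
  proof (subst AE_ball_countable, rule countable_rat, intro ballI, subst AE_ball_countable, rule countable_rat, intro ballI)
    fix \<alpha> \<beta> :: real
    show "AE x in lborel. \<alpha> < \<beta> \<longrightarrow> \<not> slopes_oscillate (slope_along \<psi> 1 x) \<alpha> \<beta>"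
      using AE_not_in[OF null[of \<alpha> \<beta>]] by (cases "\<alpha> < \<beta>") auto
  qed
  then show ?thesis
    by eventually_elim (auto simp: diff_along_iff[OF lip])
qed

text \<open>Fubini's theorem for the lines of one direction, without choosing coordinates: by translation
  invariance, averaging the measure of the translates of \<open>N\<close> along \<open>e\<close> reproduces the measure of \<open>N\<close>,
  while exchanging the integrals leaves only integrals over lines.\<close>
lemma null_set_of_null_lines:
  fixes N :: "'a::euclidean_space set"
  assumes N: "N \<in> sets borel"
    and lines: "\<And>x. AE t in lborel. x + t *\<^sub>R e \<notin> N"
  shows "N \<in> null_sets lborel"
proof -
  have meas: "(\<lambda>(t, x). indicator N (x + t *\<^sub>R e) * indicator {0..1} t :: ennreal)
      \<in> borel_measurable (lborel \<Otimes>\<^sub>M lborel)" (is "case_prod ?F \<in> _")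
    using N by measurable
  have "emeasure lborel N = (\<integral>\<^sup>+t. emeasure lborel N * indicator {0..1} (t::real) \<partial>lborel)"
    by (simp add: nn_integral_cmult)
  also have "\<dots> = (\<integral>\<^sup>+t. \<integral>\<^sup>+x. ?F t x \<partial>lborel \<partial>lborel)"
  proof (rule nn_integral_cong)
    fix t :: real
    have "(\<integral>\<^sup>+x. indicator N (t *\<^sub>R e + x) \<partial>lborel) = (\<integral>\<^sup>+x. indicator N x \<partial>distr lborel borel ((+) (t *\<^sub>R e)))"
      using N by (subst nn_integral_distr) auto
    also have "\<dots> = emeasure lborel N" using N by (simp add: lborel_distr_plus)
    finally have "(\<integral>\<^sup>+x. indicator N (x + t *\<^sub>R e) \<partial>lborel) = emeasure lborel N"
      by (simp add: add.commute)
    then show "emeasure lborel N * indicator {0..1} t = (\<integral>\<^sup>+x. ?F t x \<partial>lborel)"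
      using N by (subst nn_integral_multc) auto
  qed
  also have "\<dots> = (\<integral>\<^sup>+x. \<integral>\<^sup>+t. ?F t x \<partial>lborel \<partial>lborel)"
    by (rule lborel_pair.Fubini'[symmetric]) (use meas in simp)
  also have "\<dots> = (\<integral>\<^sup>+(x::'a). 0 \<partial>lborel)"
  proof (rule nn_integral_cong)
    fix x
    have "(\<integral>\<^sup>+t. ?F t x \<partial>lborel) = (\<integral>\<^sup>+(t::real). 0 \<partial>lborel)"
      by (rule nn_integral_cong_AE) (use lines[of x] in eventually_elim, simp)
    then show "(\<integral>\<^sup>+t. ?F t x \<partial>lborel) = 0" by simp
  qed
  finally show ?thesis using N by (simp add: null_sets_def)
qed

lemma sets_diff_along:
  fixes \<phi> :: "'a::euclidean_space \<Rightarrow> real"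
  assumes lip: "L-lipschitz_on UNIV \<phi>"
  shows "{x. diff_along \<phi> e x} \<in> sets borel"
proof -
  have "{x. diff_along \<phi> e x} =
     - (\<Union>\<alpha>\<in>\<rat>. \<Union>\<beta>\<in>\<rat> \<inter> {\<alpha><..}. {x. slopes_oscillate (slope_along \<phi> e x) \<alpha> \<beta>})"
    by (auto simp: diff_along_iff[OF lip])
  also have "\<dots> \<in> sets borel"
    using sets_slopes_oscillate[OF lipschitz_on_continuous_on[OF lip]]
    by (intro borel_comp sets.countable_UN' countable_rat countable_Int1) (auto intro!: sets.countable_UN' countable_Int1 countable_rat)
  finally show ?thesis .
qed

lemma lipschitz_diff_along_AE:
  fixes \<phi> :: "'a::euclidean_space \<Rightarrow> real"
  assumes lip: "L-lipschitz_on UNIV \<phi>"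
  shows "AE x in lborel. diff_along \<phi> e x"
proof -
  have "{x. \<not> diff_along \<phi> e x} \<in> null_sets lborel"
  proof (rule null_set_of_null_lines)
    show "{x. \<not> diff_along \<phi> e x} \<in> sets borel"
      using borel_comp[OF sets_diff_along[OF lip, of e]] by (simp add: Collect_neg_eq)
    fix x
    let ?\<psi> = "\<lambda>t. \<phi> (x + t *\<^sub>R e)"
    have "(L * norm e)-lipschitz_on UNIV ?\<psi>"
    proof (rule lipschitz_onI)
      fix s t :: real
      have "dist (?\<psi> s) (?\<psi> t) \<le> L * dist (x + s *\<^sub>R e) (x + t *\<^sub>R e)"
        by (rule lipschitz_onD[OF lip]) auto
      also have "dist (x + s *\<^sub>R e) (x + t *\<^sub>R e) = norm e * dist s t"
        by (simp add: dist_norm scaleR_left_diff_distrib[symmetric] dist_real_def)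
      finally show "dist (?\<psi> s) (?\<psi> t) \<le> L * norm e * dist s t" by (simp add: mult_ac)
    qed (use lipschitz_on_nonneg[OF lip] in auto)
    from lipschitz_differentiable_AE_real[OF this]
    show "AE t in lborel. x + t *\<^sub>R e \<notin> {x. \<not> diff_along \<phi> e x}"
      by eventually_elim (simp add: diff_along_iff_slope scaleR_left_distrib add.assoc)
  qed
  then show ?thesis by (auto dest: AE_not_in)
qed

section \<open>Closed sets are thick at almost all of their points\<close>

text \<open>A form of the Lebesgue density theorem. At an exceptional point there are arbitrarily small
  balls that contain a hole of proportional size in \<open>K\<close>; the exceptional set fills only a
  fixed fraction \<open>c < 1\<close> of each, so its measure is at most \<open>c\<close> times itself.\<close>
lemma AE_closed_thick:
  fixes K :: "'a::euclidean_space set"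
  assumes K: "closed K"
  shows "AE x in lborel. x \<in> K \<longrightarrow>
    (\<forall>\<delta>>0. \<exists>r>0. \<forall>z. norm z < r \<longrightarrow> (\<exists>k\<in>K. dist (x + z) k \<le> \<delta> * norm z))"
proof (cases "K = {}")
  case False
  define hole where "hole \<delta> r = {x. \<exists>z. norm z < r \<and> \<delta> * norm z < infdist (x + z) K}" for \<delta> r
  have open_hole: "open (hole \<delta> r)" for \<delta> r
  proof -
    have "hole \<delta> r = (\<Union>z\<in>ball 0 r. {x. \<delta> * norm z < infdist (x + z) K})"
      by (auto simp: hole_def)
    then show ?thesis
      by (auto intro!: open_UN open_Collect_less continuous_intros)
  qed
  have null: "K \<inter> (\<Inter>n. hole \<delta> (inverse (real (Suc n)))) \<in> null_sets lborel" (is "?B \<in> _") if \<delta>: "0 < \<delta>" for \<delta>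
  proof -
    have B: "?B \<in> sets borel"
      using K open_hole by auto
    define \<nu> where "\<nu> = density lborel (indicator ?B)"
    have nu: "emeasure \<nu> A = emeasure lborel (?B \<inter> A)" if "A \<in> sets borel" for A
      using that B by (simp add: \<nu>_def emeasure_restricted)
    \<comment> \<open>The hole occupies the fraction \<open>(\<delta> / (1 + \<delta>)) ^ DIM('a)\<close> of the smallest ball around \<open>x\<close> that
      contains it.\<close>
    define c where "c = 1 - (\<delta> / (1 + \<delta>)) ^ DIM('a)"
    have c: "0 \<le> c" "c < 1"
      using \<delta> by (auto simp: c_def power_le_one)
    have "?B \<inter> ball 0 (real n) \<in> null_sets lborel" for n
    proof -
      let ?A = "?B \<inter> ball 0 (real n)"
      have A: "?A \<in> sets borel" using B by auto
      have "emeasure \<nu> ?A \<le> ennreal c * emeasure lborel ?A"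
      proof (rule emeasure_le_of_small_cballs[OF _ _ A])
        show "sets \<nu> = sets borel" by (simp add: \<nu>_def)
        show "N \<in> null_sets \<nu>" if N: "N \<in> null_sets lborel" for N
        proof -
          have "N \<in> sets borel" using N by auto
          then have "emeasure \<nu> N \<le> emeasure lborel N"
            by (simp add: nu emeasure_mono)
          then show ?thesis using N by (auto simp: null_sets_def \<nu>_def)
        qed
        fix x d assume x: "x \<in> ?A" and d: "(0::real) < d"
        obtain n where "inverse (real (Suc n)) < d / (1 + \<delta>)"
          using reals_Archimedean[of "d / (1 + \<delta>)"] d \<delta> by auto
        moreover have "x \<in> hole \<delta> (inverse (real (Suc n)))" using x by blast
        ultimately obtain z where z: "norm z < d / (1 + \<delta>)" "\<delta> * norm z < infdist (x + z) K"
          unfolding hole_def using less_trans by blast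
        have z0: "z \<noteq> 0"
          using z(2) x K False by auto
        define r where "r = (1 + \<delta>) * norm z"
        have r: "0 < r" "r < d" using z(1) z0 \<delta> by (auto simp: r_def pos_less_divide_eq mult.commute)
        let ?C = "cball (x + z) (\<delta> * norm z)"
        have "?C \<inter> K = {}"
          using z(2) infdist_le[of _ K "x + z"] by fastforce
        then have "?B \<inter> cball x r \<subseteq> cball x r - ?C" by auto
        then have "emeasure lborel (?B \<inter> cball x r) \<le> emeasure lborel (cball x r - ?C)"
          by (intro emeasure_mono) auto
        also have "\<dots> = emeasure lborel (cball x r) - emeasure lborel ?C"
        proof (rule emeasure_Diff)
          show "?C \<subseteq> cball x r"
          proof
            fix y assume "y \<in> ?C"
            then show "y \<in> cball x r"
              using dist_triangle[of x y "x + z"] by (simp add: r_def algebra_simps dist_norm)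
          qed
          show "emeasure lborel ?C \<noteq> \<infinity>"
            using emeasure_lborel_cball_finite[of "x + z" "\<delta> * norm z"] by simp
        qed auto
        also have "\<dots> = ennreal c * emeasure lborel (cball x r)"
        proof -
          let ?v = "unit_ball_vol (real DIM('a))"
          have "(\<delta> * norm z) = \<delta> / (1 + \<delta>) * r" using \<delta> by (simp add: r_def)
          then have "(\<delta> * norm z) ^ DIM('a) = (\<delta> / (1 + \<delta>)) ^ DIM('a) * r ^ DIM('a)"
            by (metis power_mult_distrib)
          then have "?v * r ^ DIM('a) - ?v * (\<delta> * norm z) ^ DIM('a) = c * (?v * r ^ DIM('a))"
            by (simp add: c_def algebra_simps)
          then show ?thesis
            using r \<delta> c by (simp add: emeasure_cball ennreal_minus ennreal_mult[symmetric])
        qed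
        finally have "emeasure \<nu> (cball x r) \<le> ennreal c * emeasure lborel (cball x r)"
          by (simp add: nu)
        then show "\<exists>a r. 0 < r \<and> r < d \<and> x \<in> cball a r \<and> emeasure \<nu> (cball a r) \<le> ennreal c * emeasure lborel (cball a r)"
          using r by (intro exI[of _ x] exI[of _ r]) auto
      qed
      then have le: "emeasure lborel ?A \<le> ennreal c * emeasure lborel ?A"
        using A by (simp add: nu Int_absorb1 Int_assoc[symmetric])
      have "emeasure lborel ?A < \<infinity>"
        by (intro emeasure_bounded_finite) auto
      then obtain m where m: "emeasure lborel ?A = ennreal m" "0 \<le> m"
        by (cases "emeasure lborel ?A") auto
      then have "m \<le> c * m" using le c by (simp add: ennreal_mult[symmetric])
      then have "(1 - c) * m \<le> 0" by (simp add: algebra_simps)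
      then have "m = 0" using c m by (simp add: mult_le_0_iff)
      then show ?thesis using m A by (auto simp: null_sets_def)
    qed
    then have "(\<Union>n. ?B \<inter> ball 0 (real n)) \<in> null_sets lborel" by (rule null_sets_UN)
    moreover have "(\<Union>n. ?B \<inter> ball 0 (real n)) = ?B"
      by (auto simp: reals_Archimedean2)
    ultimately show ?thesis by simp
  qed
  have "AE x in lborel. \<forall>m. x \<notin> K \<inter> (\<Inter>n. hole (inverse (real (Suc m))) (inverse (real (Suc n))))"
    by (subst AE_all_countable) (intro allI AE_not_in null, simp)
  then show ?thesis
  proof eventually_elim
    case (elim x)
    show ?case
    proof (intro impI allI)
      fix \<delta> :: real assume x: "x \<in> K" and "0 < \<delta>"
      then obtain m where m: "inverse (real (Suc m)) < \<delta>" using reals_Archimedean by blast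
      obtain n where n: "x \<notin> hole (inverse (real (Suc m))) (inverse (real (Suc n)))"
        using elim x by blast
      show "\<exists>r>0. \<forall>z. norm z < r \<longrightarrow> (\<exists>k\<in>K. dist (x + z) k \<le> \<delta> * norm z)"
      proof (intro exI[of _ "inverse (real (Suc n))"] conjI allI impI)
        fix z :: 'a assume "norm z < inverse (real (Suc n))"
        then have "infdist (x + z) K \<le> inverse (real (Suc m)) * norm z"
          using n by (force simp: hole_def)
        also have "\<dots> \<le> \<delta> * norm z" using m by (intro mult_right_mono) auto
        finally have "infdist (x + z) K \<le> \<delta> * norm z" .
        moreover obtain k where "k \<in> K" "infdist (x + z) K = dist (x + z) k"
          using infdist_attains_inf[OF K False] by blast
        ultimately show "\<exists>k\<in>K. dist (x + z) k \<le> \<delta> * norm z" by auto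
      qed simp
    qed
  qed
qed simp

section \<open>Directional derivatives\<close>

text \<open>The value \<open>0\<close> where the derivative does not exist makes this a Borel function on the whole
  space.\<close>
definition ddir :: "'a::real_vector \<Rightarrow> ('a \<Rightarrow> real) \<Rightarrow> 'a \<Rightarrow> real" where
  "ddir e \<phi> x = (if diff_along \<phi> e x then deriv (\<lambda>t. \<phi> (x + t *\<^sub>R e)) 0 else 0)"

lemma ddirI:
  assumes "((\<lambda>t. \<phi> (x + t *\<^sub>R e)) has_real_derivative D) (at 0)"
  shows "diff_along \<phi> e x" "ddir e \<phi> x = D"
  using assms DERIV_imp_deriv[OF assms]
  by (auto simp: ddir_def diff_along_def real_differentiable_def)

lemma has_derivative_ddir:
  assumes "diff_along \<phi> e x"
  shows "((\<lambda>t. \<phi> (x + t *\<^sub>R e)) has_real_derivative ddir e \<phi> x) (at 0)"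
  using assms ddirI(2) unfolding diff_along_def real_differentiable_def by blast

lemma slope_tendsto_ddir:
  assumes "diff_along \<phi> e x"
  shows "(slope_along \<phi> e x \<longlongrightarrow> ddir e \<phi> x) (at 0)"
  using has_derivative_ddir[OF assms] by (simp add: DERIV_def)

lemma ddir_cong:
  fixes \<phi> \<psi> :: "'a::real_normed_vector \<Rightarrow> real"
  assumes "open U" "x \<in> U" "\<And>y. y \<in> U \<Longrightarrow> \<phi> y = \<psi> y"
  shows "ddir e \<phi> x = ddir e \<psi> x" "diff_along \<phi> e x = diff_along \<psi> e x"
proof -
  have "open ((\<lambda>t. x + t *\<^sub>R e) -` U)"
    by (rule open_vimage[OF assms(1)]) (intro continuous_intros)
  then have ev: "eventually (\<lambda>t. \<phi> (x + t *\<^sub>R e) = \<psi> (x + t *\<^sub>R e)) (nhds 0)"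
    unfolding eventually_nhds using assms by (intro exI[of _ "(\<lambda>t. x + t *\<^sub>R e) -` U"]) auto
  have "((\<lambda>t. \<phi> (x + t *\<^sub>R e)) has_real_derivative D) (at 0) \<longleftrightarrow>
      ((\<lambda>t. \<psi> (x + t *\<^sub>R e)) has_real_derivative D) (at 0)" for D
    by (rule DERIV_cong_ev[OF refl ev refl])
  then show "diff_along \<phi> e x = diff_along \<psi> e x"
    by (simp add: diff_along_def real_differentiable_def)
  then show "ddir e \<phi> x = ddir e \<psi> x"
    by (simp add: ddir_def deriv_cong_ev[OF ev refl])
qed

lemma lipschitz_along:
  fixes \<phi> :: "'a::real_normed_vector \<Rightarrow> real"
  assumes "L-lipschitz_on UNIV \<phi>"
  shows "\<bar>\<phi> (x + t *\<^sub>R e) - \<phi> (x + s *\<^sub>R e)\<bar> \<le> L * norm e * \<bar>t - s\<bar>"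
  using lipschitz_on_normD[OF assms, of "x + t *\<^sub>R e" "x + s *\<^sub>R e"]
  by (simp add: scaleR_left_diff_distrib[symmetric] mult_ac)

lemma abs_ddir_le:
  fixes \<phi> :: "'a::real_normed_vector \<Rightarrow> real"
  assumes lip: "L-lipschitz_on UNIV \<phi>"
  shows "\<bar>ddir e \<phi> x\<bar> \<le> L * norm e"
proof (cases "diff_along \<phi> e x")
  case True
  have "((\<lambda>t. \<bar>slope_along \<phi> e x t\<bar>) \<longlongrightarrow> \<bar>ddir e \<phi> x\<bar>) (at 0)"
    by (intro tendsto_rabs slope_tendsto_ddir True)
  moreover have "eventually (\<lambda>t. \<bar>slope_along \<phi> e x t\<bar> \<le> L * norm e) (at 0)"
    unfolding eventually_at using lipschitz_along[OF lip, of x _ e 0]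
    by (intro exI[of _ 1]) (auto simp: divide_le_eq)
  ultimately show ?thesis
    by (rule tendsto_upperbound) simp
qed (use lipschitz_on_nonneg[OF lip] in \<open>auto simp: ddir_def\<close>)

lemma borel_measurable_ddir:
  fixes \<phi> :: "'a::euclidean_space \<Rightarrow> real"
  assumes lip: "L-lipschitz_on UNIV \<phi>"
  shows "ddir e \<phi> \<in> borel_measurable borel"
proof (rule borel_measurable_LIMSEQ_real)
  let ?f = "\<lambda>n x. indicator {x. diff_along \<phi> e x} x * slope_along \<phi> e x (inverse (real (Suc n)))"
  have [measurable]: "\<phi> \<in> borel_measurable borel"
    by (intro borel_measurable_continuous_onI lipschitz_on_continuous_on[OF lip])
  have [measurable]: "{x. diff_along \<phi> e x} \<in> sets borel" by (rule sets_diff_along[OF lip])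
  show "?f n \<in> borel_measurable borel" for n by measurable
  fix x
  have *: "filterlim (\<lambda>n. inverse (real (Suc n))) (at 0) sequentially"
    using LIMSEQ_inverse_real_of_nat by (auto simp: filterlim_at)
  show "(\<lambda>n. ?f n x) \<longlonglongrightarrow> ddir e \<phi> x"
  proof (cases "diff_along \<phi> e x")
    case True
    from filterlim_compose[OF slope_tendsto_ddir[OF True] *] True show ?thesis by simp
  qed (simp add: ddir_def)
qed

text \<open>At a thick point of the zero set every increment can be corrected to a nearby zero at
  a cost that is small compared with the increment, so the derivative vanishes. This settles the
  boundary of the domain, which may have positive measure.\<close>
lemma ddir_eq_0_on_zero_set_AE:
  fixes \<phi> :: "'a::euclidean_space \<Rightarrow> real"
  assumes lip: "L-lipschitz_on UNIV \<phi>"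
  shows "AE x in lborel. \<phi> x = 0 \<longrightarrow> diff_along \<phi> e x \<and> ddir e \<phi> x = 0"
proof -
  have "closed {x. \<phi> x = 0}"
    using lipschitz_on_continuous_on[OF lip] by (intro closed_Collect_eq continuous_on_const)
  from AE_closed_thick[OF this] show ?thesis
  proof eventually_elim
    case (elim x)
    have L: "0 \<le> L" by (rule lipschitz_on_nonneg[OF lip])
    show ?case
    proof
      assume x: "\<phi> x = 0"
      have "(slope_along \<phi> e x \<longlongrightarrow> 0) (at 0)"
      proof (rule tendstoI)
        fix \<epsilon> :: real assume \<epsilon>: "0 < \<epsilon>"
        define \<delta> where "\<delta> = \<epsilon> / (L * norm e + 1)"
        have Le: "0 \<le> L * norm e" using L by simp
        have \<delta>: "0 < \<delta>" "L * \<delta> * norm e < \<epsilon>"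
          using \<epsilon> Le by (auto simp: \<delta>_def field_simps add_nonneg_pos)
        obtain r where r: "0 < r" and thick: "\<And>z. norm z < r \<Longrightarrow> \<exists>k. \<phi> k = 0 \<and> dist (x + z) k \<le> \<delta> * norm z"
          using elim x \<delta>(1) by fastforce
        show "eventually (\<lambda>t. dist (slope_along \<phi> e x t) 0 < \<epsilon>) (at 0)"
          unfolding eventually_at
        proof (intro exI[of _ "r / (norm e + 1)"] conjI ballI impI)
          fix t :: real assume t: "t \<noteq> 0 \<and> dist t 0 < r / (norm e + 1)"
          then have "\<bar>t\<bar> * (norm e + 1) < r" by (simp add: pos_less_divide_eq add_nonneg_pos)
          then have "norm (t *\<^sub>R e) < r" by (simp add: algebra_simps)
          then obtain k where k: "\<phi> k = 0" "dist (x + t *\<^sub>R e) k \<le> \<delta> * norm (t *\<^sub>R e)"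
            using thick by blast
          have "\<bar>\<phi> (x + t *\<^sub>R e)\<bar> \<le> L * dist (x + t *\<^sub>R e) k"
            using lipschitz_onD[OF lip, of "x + t *\<^sub>R e" k] k by (simp add: dist_real_def)
          also have "\<dots> \<le> L * (\<delta> * norm (t *\<^sub>R e))" using k L by (intro mult_left_mono)
          also have "\<dots> = (L * \<delta> * norm e) * \<bar>t\<bar>" by simp
          also have "\<dots> < \<epsilon> * \<bar>t\<bar>" using \<delta> t by (intro mult_strict_right_mono) auto
          finally show "dist (slope_along \<phi> e x t) 0 < \<epsilon>"
            using t x by (simp add: field_simps dist_real_def)
        qed (use r in \<open>simp add: add_nonneg_pos\<close>)
      qed
      then show "diff_along \<phi> e x \<and> ddir e \<phi> x = 0"
        using ddirI[of \<phi> x e 0] by (simp add: DERIV_def)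
    qed
  qed
qed

abbreviation lip :: "('a::metric_space \<Rightarrow> real) \<Rightarrow> bool" where
  "lip \<phi> \<equiv> \<exists>L. L-lipschitz_on UNIV \<phi>"

lemma lip_continuous: "lip \<phi> \<Longrightarrow> continuous_on UNIV \<phi>"
  by (auto intro: lipschitz_on_continuous_on)

lemma lip_measurable [measurable_dest]: "lip \<phi> \<Longrightarrow> \<phi> \<in> borel_measurable borel"
  by (intro borel_measurable_continuous_onI lip_continuous)

lemma lip_const: "lip (\<lambda>x. c)"
  using lipschitz_on_constant by blast

lemma lip_add: "lip \<phi> \<Longrightarrow> lip \<psi> \<Longrightarrow> lip (\<lambda>x. \<phi> x + \<psi> x)"
  using lipschitz_on_add by blast

lemma lip_diff: "lip \<phi> \<Longrightarrow> lip \<psi> \<Longrightarrow> lip (\<lambda>x. \<phi> x - \<psi> x)"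
  using lipschitz_on_diff by blast

lemma lip_cmult: "lip \<phi> \<Longrightarrow> lip (\<lambda>x. c * \<phi> x)"
  using lipschitz_on_cmult_real by blast

lemma lip_coord: "lip (\<lambda>x :: real^'n. x $ i)"
proof
  show "1-lipschitz_on UNIV (\<lambda>x :: real^'n. x $ i)"
    using component_le_norm_cart[of "_ - _" i]
    by (intro lipschitz_onI) (auto simp: dist_norm)
qed

lemma lipschitz_component:
  fixes f :: "'a::metric_space \<Rightarrow> real^'n"
  assumes "L-lipschitz_on S f"
  shows "L-lipschitz_on S (\<lambda>x. f x $ i)"
proof (rule lipschitz_onI)
  fix x y assume "x \<in> S" "y \<in> S"
  then show "dist (f x $ i) (f y $ i) \<le> L * dist x y"
    using component_le_norm_cart[of "f x - f y" i] lipschitz_onD[OF assms, of x y]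
    by (simp add: dist_norm)
qed (rule lipschitz_on_nonneg[OF assms])

lemma lip_compose: "lip T \<Longrightarrow> lip \<phi> \<Longrightarrow> lip (\<lambda>x. T (\<phi> x))"
proof -
  assume "lip T" "lip \<phi>"
  then obtain C D where "C-lipschitz_on UNIV T" "D-lipschitz_on UNIV \<phi>" by blast
  then have "(C * D)-lipschitz_on UNIV (\<lambda>x. T (\<phi> x))"
    by (intro lipschitz_on_compose2) (auto intro: lipschitz_on_subset)
  then show ?thesis by blast
qed

lemma lip_mult_bounded:
  assumes p: "lip p" "\<And>x. \<bar>p x\<bar> \<le> P" and q: "lip q" "\<And>x. \<bar>q x\<bar> \<le> Q"
  shows "lip (\<lambda>x. p x * q x)"
proof -
  obtain Lp Lq where L: "Lp-lipschitz_on UNIV p" "Lq-lipschitz_on UNIV q" using p q by blast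
  have nn: "0 \<le> P" "0 \<le> Q" "0 \<le> Lp" "0 \<le> Lq"
    using p(2)[of undefined] q(2)[of undefined] L by (auto dest: lipschitz_on_nonneg)
  have "(P * Lq + Q * Lp)-lipschitz_on UNIV (\<lambda>x. p x * q x)"
  proof (rule lipschitz_onI)
    fix x y :: 'a
    have "p x * q x - p y * q y = p x * (q x - q y) + q y * (p x - p y)" by (simp add: algebra_simps)
    then have "dist (p x * q x) (p y * q y) \<le> \<bar>p x\<bar> * \<bar>q x - q y\<bar> + \<bar>q y\<bar> * \<bar>p x - p y\<bar>"
      unfolding dist_real_def by (metis abs_mult abs_triangle_ineq)
    also have "\<dots> \<le> P * (Lq * dist x y) + Q * (Lp * dist x y)"
      using p(2) q(2) lipschitz_onD[OF L(1), of x y] lipschitz_onD[OF L(2), of x y] nn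
      by (intro add_mono mult_mono) (auto simp: dist_real_def)
    finally show "dist (p x * q x) (p y * q y) \<le> (P * Lq + Q * Lp) * dist x y"
      by (simp add: algebra_simps)
  qed (use nn in simp)
  then show ?thesis by blast
qed

text \<open>On the support of \<open>p\<close> both factors are bounded, and of any two points at least one lies in it
  unless both products vanish.\<close>
lemma lip_mult_bounded_support:
  fixes p q :: "'a::euclidean_space \<Rightarrow> real"
  assumes p: "lip p" and supp: "\<And>x. R < norm x \<Longrightarrow> p x = 0" and q: "lip q"
  shows "lip (\<lambda>x. p x * q x)"
proof -
  obtain Lp Lq where L: "Lp-lipschitz_on UNIV p" "Lq-lipschitz_on UNIV q" using p q by blast
  have bdd: "\<exists>M. \<forall>x\<in>cball 0 R. \<bar>\<phi> x\<bar> \<le> M" if "lip \<phi>" for \<phi> :: "'a \<Rightarrow> real"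
  proof -
    have "compact (\<phi> ` cball 0 R)"
      by (intro compact_continuous_image continuous_on_subset[OF lip_continuous[OF that]]) auto
    then show ?thesis
      by (auto simp: bounded_iff dest!: compact_imp_bounded)
  qed
  obtain P where P: "\<forall>x\<in>cball 0 R. \<bar>p x\<bar> \<le> P" using bdd[OF p] ..
  obtain Q where Q: "\<forall>x\<in>cball 0 R. \<bar>q x\<bar> \<le> Q" using bdd[OF q] ..
  have P': "\<bar>p x\<bar> \<le> \<bar>P\<bar>" for x
    using P[rule_format, of x] supp[of x] by (cases "norm x \<le> R") auto
  have Q': "\<bar>q x\<bar> \<le> \<bar>Q\<bar>" if "norm x \<le> R" for x
    using Q[rule_format, of x] that by auto
  have nn: "0 \<le> Lp" "0 \<le> Lq" using L by (auto dest: lipschitz_on_nonneg)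
  have est: "\<bar>p x * q x - p y * q y\<bar> \<le> (\<bar>P\<bar> * Lq + \<bar>Q\<bar> * Lp) * dist x y" if x: "norm x \<le> R" for x y
  proof -
    have "p x * q x - p y * q y = p y * (q x - q y) + q x * (p x - p y)" by (simp add: algebra_simps)
    then have "\<bar>p x * q x - p y * q y\<bar> \<le> \<bar>p y\<bar> * \<bar>q x - q y\<bar> + \<bar>q x\<bar> * \<bar>p x - p y\<bar>"
      by (metis abs_mult abs_triangle_ineq)
    also have "\<dots> \<le> \<bar>P\<bar> * (Lq * dist x y) + \<bar>Q\<bar> * (Lp * dist x y)"
      using P' Q'[OF x] lipschitz_onD[OF L(1), of x y] lipschitz_onD[OF L(2), of x y] nn
      by (intro add_mono mult_mono) (auto simp: dist_real_def)
    finally show ?thesis by (simp add: algebra_simps)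
  qed
  have "(\<bar>P\<bar> * Lq + \<bar>Q\<bar> * Lp)-lipschitz_on UNIV (\<lambda>x. p x * q x)"
  proof (rule lipschitz_onI)
    fix x y :: 'a
    consider "norm x \<le> R" | "norm y \<le> R" | "R < norm x" "R < norm y" by linarith
    then show "dist (p x * q x) (p y * q y) \<le> (\<bar>P\<bar> * Lq + \<bar>Q\<bar> * Lp) * dist x y"
    proof cases
      case 1
      then show ?thesis using est by (simp add: dist_real_def)
    next
      case 2
      then show ?thesis using est[of y x] by (simp add: dist_real_def abs_minus_commute dist_commute)
    qed (use supp nn in simp)
  qed (use nn in simp)
  then show ?thesis by blast
qed

lemma lip_diff_along_AE:
  fixes \<phi> :: "'a::euclidean_space \<Rightarrow> real"
  shows "lip \<phi> \<Longrightarrow> AE x in lborel. diff_along \<phi> e x"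
  using lipschitz_diff_along_AE by blast

lemma lip_measurable_ddir [measurable_dest]:
  fixes \<phi> :: "'a::euclidean_space \<Rightarrow> real"
  shows "lip \<phi> \<Longrightarrow> ddir e \<phi> \<in> borel_measurable borel"
  using borel_measurable_ddir by blast

lemma ddir_diff:
  assumes "diff_along \<phi> e x" "diff_along \<psi> e x"
  shows "ddir e (\<lambda>x. \<phi> x - \<psi> x) x = ddir e \<phi> x - ddir e \<psi> x"
  by (rule ddirI) (intro DERIV_diff has_derivative_ddir assms)

lemma ddir_cmult:
  assumes "diff_along \<phi> e x"
  shows "ddir e (\<lambda>x. c * \<phi> x) x = c * ddir e \<phi> x"
  by (rule ddirI) (intro DERIV_cmult has_derivative_ddir assms)

lemma ddir_mult:
  assumes "diff_along \<phi> e x" "diff_along \<psi> e x"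
  shows "diff_along (\<lambda>x. \<phi> x * \<psi> x) e x"
    and "ddir e (\<lambda>x. \<phi> x * \<psi> x) x = ddir e \<phi> x * \<psi> x + ddir e \<psi> x * \<phi> x"
  using DERIV_mult[OF has_derivative_ddir[OF assms(1)] has_derivative_ddir[OF assms(2)]]
  by (auto dest: ddirI)

lemma ddir_compose:
  assumes "diff_along \<phi> e x" "(T has_real_derivative d) (at (\<phi> x))"
  shows "diff_along (\<lambda>x. T (\<phi> x)) e x" "ddir e (\<lambda>x. T (\<phi> x)) x = d * ddir e \<phi> x"
proof -
  have "((\<lambda>t. T (\<phi> (x + t *\<^sub>R e))) has_real_derivative d * ddir e \<phi> x) (at 0)"
    using has_derivative_ddir[OF assms(1)] assms(2)
    by (intro DERIV_chain2) auto
  then show "diff_along (\<lambda>x. T (\<phi> x)) e x" "ddir e (\<lambda>x. T (\<phi> x)) x = d * ddir e \<phi> x"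
    by (auto dest: ddirI)
qed

lemma ddir_coord: "ddir e (\<lambda>x :: real^'n. x $ i) x = e $ i" "diff_along (\<lambda>x :: real^'n. x $ i) e x"
proof -
  have "((\<lambda>t. (x + t *\<^sub>R e) $ i) has_real_derivative e $ i) (at 0)"
    by (auto intro!: derivative_eq_intros)
  then show "ddir e (\<lambda>x :: real^'n. x $ i) x = e $ i" "diff_along (\<lambda>x :: real^'n. x $ i) e x"
    by (rule ddirI(2), rule ddirI(1))
qed

section \<open>Jacobians of Lipschitz pairs integrate to zero\<close>

lemma not_AE_not_in_open:
  fixes \<Omega> :: "'a::euclidean_space set"
  assumes "open \<Omega>" "\<Omega> \<noteq> {}"
  shows "\<not> (AE x in lborel. x \<notin> \<Omega>)"
proof
  assume null: "AE x in lborel. x \<notin> \<Omega>"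
  obtain x r where xr: "0 < r" "ball x r \<subseteq> \<Omega>"
    using assms by (meson all_not_in_conv open_contains_ball)
  have "AE y in lborel. y \<notin> ball x r"
    using null by eventually_elim (use xr(2) in auto)
  then have "emeasure lborel (ball x r) = 0"
    by (subst (asm) AE_iff_measurable[OF _ refl]) (auto simp: ball_def)
  then show False
    using xr(1) unit_ball_vol_pos[of "real DIM('a)"] by (simp add: emeasure_ball)
qed

lemma AE_zero_continuous:
  fixes g :: "'a::euclidean_space \<Rightarrow> real"
  assumes "continuous_on UNIV g" "AE x in lborel. g x = 0"
  shows "g x = 0"
proof (rule ccontr)
  assume "g x \<noteq> 0"
  then have "{x. g x \<noteq> 0} \<noteq> {}" by blast
  moreover have "open {x. g x \<noteq> 0}"
    by (intro open_Collect_neq assms continuous_on_const)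
  ultimately show False
    using not_AE_not_in_open[of "{x. g x \<noteq> 0}"] assms(2) by simp
qed

lemma integral_lborel_translate:
  fixes f :: "'a::euclidean_space \<Rightarrow> real"
  assumes [measurable]: "f \<in> borel_measurable borel"
  shows "(\<integral>x. f (x + c) \<partial>lborel) = (\<integral>x. f x \<partial>lborel)"
proof -
  have "(\<integral>x. f x \<partial>lborel) = (\<integral>x. f x \<partial>distr lborel borel ((+) c))"
    by (simp add: lborel_distr_plus)
  also have "\<dots> = (\<integral>x. f (c + x) \<partial>lborel)"
    by (intro integral_distr) auto
  finally show ?thesis by (simp add: add.commute)
qed

lemma integrable_continuous_bounded_support:
  fixes f :: "'a::euclidean_space \<Rightarrow> real"
  assumes "continuous_on UNIV f" "\<And>x. R < norm x \<Longrightarrow> f x = 0"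
  shows "integrable lborel f"
proof -
  have "integrable lborel (\<lambda>x. indicator (cball 0 R) x *\<^sub>R f x)"
    by (rule borel_integrable_compact) (use continuous_on_subset[OF assms(1)] in auto)
  also have "(\<lambda>x. indicator (cball 0 R) x *\<^sub>R f x) = f"
  proof
    fix x show "indicator (cball 0 R) x *\<^sub>R f x = f x"
      using assms(2)[of x] by (cases "R < norm x") auto
  qed
  finally show ?thesis .
qed

lemma symmetric_slope_tendsto_ddir:
  assumes d: "diff_along \<phi> e x" and h: "filterlim h (at 0) F"
  shows "((\<lambda>n. (\<phi> (x + h n *\<^sub>R e) - \<phi> (x - h n *\<^sub>R e)) / (2 * h n)) \<longlongrightarrow> ddir e \<phi> x) F"
proof -
  have h': "filterlim (\<lambda>n. - h n) (at 0) F"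
    using h tendsto_minus[of h 0 F] by (simp add: filterlim_at)
  have "((\<lambda>n. (slope_along \<phi> e x (h n) + slope_along \<phi> e x (- h n)) / 2) \<longlongrightarrow> (ddir e \<phi> x + ddir e \<phi> x) / 2) F"
    by (intro tendsto_intros filterlim_compose[OF slope_tendsto_ddir[OF d]] h h') simp
  moreover have "eventually (\<lambda>n. (slope_along \<phi> e x (h n) + slope_along \<phi> e x (- h n)) / 2 =
     (\<phi> (x + h n *\<^sub>R e) - \<phi> (x - h n *\<^sub>R e)) / (2 * h n)) F"
    using h unfolding filterlim_at
    by (elim conjE eventually_mono) (auto simp: field_simps)
  ultimately have "((\<lambda>n. (\<phi> (x + h n *\<^sub>R e) - \<phi> (x - h n *\<^sub>R e)) / (2 * h n)) \<longlongrightarrow> (ddir e \<phi> x + ddir e \<phi> x) / 2) F"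
    by (rule Lim_transform_eventually)
  then show ?thesis by simp
qed

text \<open>The discrete null Lagrangian. Symmetric differences commute and are skew-adjoint, so after
  translating each product such that \<open>p\<close> is evaluated at \<open>x\<close>, the eight terms cancel in
  pairs.\<close>
lemma integral_jacobian_difference_quotient:
  fixes p q :: "'a::euclidean_space \<Rightarrow> real"
  assumes p: "continuous_on UNIV p" and q: "continuous_on UNIV q"
    and supp: "\<And>x. R < norm x \<Longrightarrow> p x = 0"
  shows "(\<integral>x. (p (x + a) - p (x - a)) * (q (x + b) - q (x - b)) -
     (p (x + b) - p (x - b)) * (q (x + a) - q (x - a)) \<partial>lborel) = 0"
proof -
  define K where "K d = (\<integral>x. p x * q (x + d) \<partial>lborel)" for d :: 'a
  have cont: "continuous_on UNIV (\<lambda>x. p (x + c) * q (x + d))" for c d :: 'a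
    by (intro continuous_intros continuous_on_compose2[OF p] continuous_on_compose2[OF q]) auto
  have int: "integrable lborel (\<lambda>x. p (x + c) * q (x + d))" for c d :: 'a
  proof (rule integrable_continuous_bounded_support[OF cont])
    fix x :: 'a assume "R + norm c < norm x"
    then have "R < norm (x + c)" using norm_triangle_ineq4[of "x + c" c] by simp
    then show "p (x + c) * q (x + d) = 0" by (simp add: supp)
  qed
  have val: "(\<integral>x. p (x + c) * q (x + d) \<partial>lborel) = K (d - c)" for c d :: 'a
  proof -
    have "(\<lambda>x. p x * q (x + (d - c))) \<in> borel_measurable borel"
      using cont[of 0 "d - c"] by (intro borel_measurable_continuous_onI) simp
    from integral_lborel_translate[OF this, of c] show ?thesis
      by (simp add: K_def algebra_simps)
  qed
  have HB: "has_bochner_integral lborel (\<lambda>x. p (x + c) * q (x + d)) (K (d - c))" for c d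
    using int val by (simp add: has_bochner_integral_iff)
  have "(\<integral>x. (p (x + a) - p (x - a)) * (q (x + b) - q (x - b)) -
     (p (x + b) - p (x - b)) * (q (x + a) - q (x - a)) \<partial>lborel) =
    (\<integral>x. (p (x + a) * q (x + b) - p (x + a) * q (x + - b) - p (x + - a) * q (x + b) + p (x + - a) * q (x + - b))
      - (p (x + b) * q (x + a) - p (x + b) * q (x + - a) - p (x + - b) * q (x + a) + p (x + - b) * q (x + - a)) \<partial>lborel)"
    by (simp add: algebra_simps)
  also have "\<dots> = (K (b - a) - K (- b - a) - K (b - - a) + K (- b - - a))
     - (K (a - b) - K (- a - b) - K (a - - b) + K (- a - - b))"
    by (intro has_bochner_integral_integral_eq has_bochner_integral_diff has_bochner_integral_add HB)
  also have "\<dots> = 0"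
  proof -
    have "K (- b - a) = K (- a - b)" "K (b - - a) = K (a - - b)"
      "K (- b - - a) = K (a - b)" "K (- a - - b) = K (b - a)"
      by (simp_all add: minus_diff_commute add.commute)
    then show ?thesis by linarith
  qed
  finally show ?thesis .
qed

text \<open>The null Lagrangian property for Lipschitz functions. The limit of the discrete identity
  is taken by dominated convergence, at the points where the four directional derivatives exist.\<close>
theorem integral_jacobian_eq_0:
  fixes p q :: "'a::euclidean_space \<Rightarrow> real"
  assumes p: "Lp-lipschitz_on UNIV p" and q: "Lq-lipschitz_on UNIV q"
    and supp: "\<And>x. R < norm x \<Longrightarrow> p x = 0"
  shows "integrable lborel (\<lambda>x. ddir a p x * ddir b q x - ddir b p x * ddir a q x)" (is "integrable _ ?J")
    and "(\<integral>x. ddir a p x * ddir b q x - ddir b p x * ddir a q x \<partial>lborel) = 0"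
proof -
  define h where "h n = inverse (real (Suc n))" for n
  have h: "0 < h n" "h n \<le> 1" for n by (auto simp: h_def field_simps)
  have lim_h: "filterlim h (at 0) sequentially"
    using LIMSEQ_inverse_real_of_nat h unfolding h_def by (auto simp: filterlim_at)
  define D where "D e \<phi> n x = (\<phi> (x + h n *\<^sub>R e) - \<phi> (x - h n *\<^sub>R e)) / (2 * h n)" for e and \<phi> :: "'a \<Rightarrow> real" and n x
  define s where "s n x = D a p n x * D b q n x - D b p n x * D a q n x" for n x
  have cp: "continuous_on UNIV p" and cq: "continuous_on UNIV q"
    using p q by (auto intro: lipschitz_on_continuous_on)
  have [measurable]: "p \<in> borel_measurable borel" "q \<in> borel_measurable borel"
    using cp cq by (auto intro: borel_measurable_continuous_onI)
  have [measurable]: "ddir e p \<in> borel_measurable borel" "ddir e q \<in> borel_measurable borel" for e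
    using borel_measurable_ddir[OF p] borel_measurable_ddir[OF q] by auto
  have D_le: "\<bar>D e \<phi> n x\<bar> \<le> L * norm e" if "L-lipschitz_on UNIV \<phi>" for L e \<phi> n x
    using lipschitz_along[OF that, of x "h n" e "- h n"] h[of n]
    by (simp add: D_def field_simps)
  have D_0: "D e p n x = 0" if "R + norm e < norm x" for e n x
  proof -
    have "norm (h n *\<^sub>R e) \<le> norm e" using h[of n] by (simp add: mult_left_le_one_le)
    then have "R < norm (x + h n *\<^sub>R e)" "R < norm (x - h n *\<^sub>R e)"
      using that norm_triangle_ineq4[of "x + h n *\<^sub>R e" "h n *\<^sub>R e"] norm_triangle_ineq[of "x - h n *\<^sub>R e" "h n *\<^sub>R e"]
      by auto
    then show ?thesis by (simp add: D_def supp)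
  qed
  define R' where "R' = R + norm a + norm b"
  define C where "C = (Lp * norm a) * (Lq * norm b) + (Lp * norm b) * (Lq * norm a)"
  have s_le: "norm (s n x) \<le> C * indicator (cball 0 R') x" for n x
  proof (cases "R' < norm x")
    case True
    have "R + norm a < norm x" "R + norm b < norm x"
      using True norm_ge_zero[of a] norm_ge_zero[of b] unfolding R'_def by linarith+
    then show ?thesis using True by (simp add: s_def D_0)
  next
    case False
    have "\<bar>s n x\<bar> \<le> \<bar>D a p n x\<bar> * \<bar>D b q n x\<bar> + \<bar>D b p n x\<bar> * \<bar>D a q n x\<bar>"
      unfolding s_def by (metis abs_mult abs_triangle_ineq4)
    also have "\<dots> \<le> C"
      unfolding C_def using lipschitz_on_nonneg[OF p] lipschitz_on_nonneg[OF q]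
      by (intro add_mono mult_mono D_le p q) auto
    finally show ?thesis using False by simp
  qed
  have s_int: "(\<integral>x. s n x \<partial>lborel) = 0" for n
  proof -
    have "s n x = ((p (x + h n *\<^sub>R a) - p (x - h n *\<^sub>R a)) * (q (x + h n *\<^sub>R b) - q (x - h n *\<^sub>R b)) -
     (p (x + h n *\<^sub>R b) - p (x - h n *\<^sub>R b)) * (q (x + h n *\<^sub>R a) - q (x - h n *\<^sub>R a))) / (2 * h n)\<^sup>2" for x
      unfolding s_def D_def power2_eq_square times_divide_times_eq diff_divide_distrib[symmetric] ..
    then show ?thesis
      using integral_jacobian_difference_quotient[OF cp cq supp] by simp
  qed
  have meas_s: "s n \<in> borel_measurable lborel" for n
    unfolding s_def D_def by measurable
  have meas_J: "?J \<in> borel_measurable lborel" by measurable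
  have bound: "integrable lborel (\<lambda>x. C * indicator (cball (0::'a) R') x)"
    using emeasure_lborel_cball_finite[of "0::'a" R'] by (intro integrable_mult_right integrable_real_indicator) auto
  have lim: "AE x in lborel. (\<lambda>n. s n x) \<longlonglongrightarrow> ?J x"
    using lipschitz_diff_along_AE[OF p, of a] lipschitz_diff_along_AE[OF p, of b]
      lipschitz_diff_along_AE[OF q, of a] lipschitz_diff_along_AE[OF q, of b]
  proof eventually_elim
    case (elim x)
    then show ?case
      unfolding s_def D_def by (intro tendsto_intros symmetric_slope_tendsto_ddir lim_h)
  qed
  have le: "\<And>n. AE x in lborel. norm (s n x) \<le> C * indicator (cball 0 R') x"
    using s_le by simp
  show "integrable lborel ?J"
    by (rule integrable_dominated_convergence[OF meas_J meas_s bound lim le])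
  have "(\<lambda>n. \<integral>x. s n x \<partial>lborel) \<longlonglongrightarrow> (\<integral>x. ?J x \<partial>lborel)"
    by (rule integral_dominated_convergence[OF meas_J meas_s bound lim le])
  then show "(\<integral>x. ?J x \<partial>lborel) = 0"
    by (simp add: s_int LIMSEQ_const_iff)
qed

definition e1 :: "real^2" where "e1 = axis 1 1"
definition e2 :: "real^2" where "e2 = axis 2 1"

lemma e_component [simp]: "e1 $ 1 = 1" "e1 $ 2 = 0" "e2 $ 1 = 0" "e2 $ 2 = 1"
  by (simp_all add: e1_def e2_def axis_def)

lemma norm_e [simp]: "norm e1 = 1" "norm e2 = 1"
  by (simp_all add: e1_def e2_def norm_axis_1)

text \<open>The determinant of the Jacobian matrix of the pair \<open>(\<phi>, \<psi>)\<close>.\<close>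
definition jac2 :: "(real^2 \<Rightarrow> real) \<Rightarrow> (real^2 \<Rightarrow> real) \<Rightarrow> real^2 \<Rightarrow> real" where
  "jac2 \<phi> \<psi> x = ddir e1 \<phi> x * ddir e2 \<psi> x - ddir e2 \<phi> x * ddir e1 \<psi> x"

lemma integral_jac2_eq_0:
  assumes "lip p" "lip q" "\<And>x. R < norm x \<Longrightarrow> p x = 0"
  shows "integrable lborel (jac2 p q)" "(\<integral>x. jac2 p q x \<partial>lborel) = 0"
  using assms integral_jacobian_eq_0[of _ p _ q R e1 e2] unfolding jac2_def[abs_def] by blast+

lemma jac2_swap: "jac2 \<phi> \<psi> x = - jac2 \<psi> \<phi> x"
  by (simp add: jac2_def)

lemma integral_jac2_eq_0':
  assumes "lip p" "lip q" "\<And>x. R < norm x \<Longrightarrow> q x = 0"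
  shows "integrable lborel (jac2 p q)" "(\<integral>x. jac2 p q x \<partial>lborel) = 0"
  using integral_jac2_eq_0[OF assms(2,1,3)] by (simp_all add: jac2_swap[of p q, abs_def])

lemma lip_measurable_jac2 [measurable_dest]:
  "lip \<phi> \<Longrightarrow> lip \<psi> \<Longrightarrow> jac2 \<phi> \<psi> \<in> borel_measurable borel"
  unfolding jac2_def[abs_def] using lip_measurable_ddir by (intro borel_measurable_diff borel_measurable_times) auto

text \<open>With \<open>p = w\<^sup>2 x\<^sub>1\<close>, the Jacobian of \<open>p\<close> and \<open>x\<^sub>2\<close> is \<open>w\<^sup>2\<close> wherever the first partial
  derivative of \<open>w\<close> vanishes; hence \<open>w\<^sup>2\<close> integrates to \<open>0\<close>.\<close>
lemma zero_of_ddir_zero_AE: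
  assumes w: "lip w" and supp: "\<And>x. R < norm x \<Longrightarrow> w x = 0" and zero: "AE x in lborel. ddir e1 w x = 0"
  shows "w x = 0"
proof -
  define p where "p x = w x * w x * x $ 1" for x
  have lip_ww: "lip (\<lambda>x. w x * w x)" by (rule lip_mult_bounded_support[OF w supp w])
  have ww_0: "w x * w x = 0" if "R < norm x" for x using supp[OF that] by simp
  have lip_p: "lip p" unfolding p_def by (rule lip_mult_bounded_support[OF lip_ww ww_0 lip_coord])
  have p0: "p x = 0" if "R < norm x" for x using supp[OF that] by (simp add: p_def)
  note int = integral_jac2_eq_0[OF lip_p lip_coord[of 2] p0]
  have eq: "AE x in lborel. jac2 p (\<lambda>x. x $ 2) x = w x * w x"
    using zero lip_diff_along_AE[OF w, of e1]
  proof eventually_elim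
    case (elim x)
    note d = ddir_mult[OF elim(2) elim(2)]
    have "ddir e1 p x = w x * w x"
      unfolding p_def using ddir_mult(2)[OF d(1) ddir_coord(2)[of 1]] by (simp add: d(2) elim(1) ddir_coord)
    then show ?case by (simp add: jac2_def ddir_coord)
  qed
  have meas: "(\<lambda>x. w x * w x) \<in> borel_measurable lborel" using lip_measurable[OF lip_ww] by simp
  have "integrable lborel (\<lambda>x. w x * w x)"
    using int(1) eq meas integrable_cong_AE[OF _ meas eq] by (simp add: borel_measurable_integrable)
  moreover have "(\<integral>x. w x * w x \<partial>lborel) = 0"
    using int(2) integral_cong_AE[OF borel_measurable_integrable[OF int(1)] meas eq] by simp
  ultimately have "AE x in lborel. w x * w x = 0"
    using integral_nonneg_eq_0_iff_AE[of lborel "\<lambda>x. w x * w x"] by simp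
  then have "w x * w x = 0"
    by (rule AE_zero_continuous[OF lip_continuous[OF lip_ww]])
  then show ?thesis by simp
qed

section \<open>Total differentiability in the plane\<close>

text \<open>Rademacher's theorem. The plane is covered, up to a null set, by countably many closed sets on
  which both partial difference quotients are uniformly close to fixed rationals. At a thick
  point \<open>x\<close> of such a set, walk from \<open>x\<close> along the first axis, jump to a nearby point \<open>k\<close> of the set, and
  walk from \<open>k\<close> along the second axis: both walks are controlled and the jump is cheap.\<close>
theorem rademacher_plane:
  fixes \<phi> :: "real^2 \<Rightarrow> real"
  assumes lip: "lip \<phi>"
  shows "AE x in lborel. \<forall>\<epsilon>>0. \<exists>r>0. \<forall>z. norm z < r \<longrightarrow>
    \<bar>\<phi> (x + z) - \<phi> x - (z $ 1 * ddir e1 \<phi> x + z $ 2 * ddir e2 \<phi> x)\<bar> \<le> \<epsilon> * norm z"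
proof -
  obtain L where L: "L-lipschitz_on UNIV \<phi>" using lip by blast
  have L0: "0 \<le> L" by (rule lipschitz_on_nonneg[OF L])
  have cont: "continuous_on UNIV \<phi>" by (rule lip_continuous[OF lip])
  define K where "K a m n = {x. \<forall>t. \<bar>t\<bar> \<le> inverse (real (Suc n)) \<longrightarrow>
      \<bar>\<phi> (x + t *\<^sub>R e1) - \<phi> x - t * of_rat (fst a)\<bar> \<le> inverse (real (Suc m)) * \<bar>t\<bar> \<and>
      \<bar>\<phi> (x + t *\<^sub>R e2) - \<phi> x - t * of_rat (snd a)\<bar> \<le> inverse (real (Suc m)) * \<bar>t\<bar>}"
    for a :: "rat \<times> rat" and m n :: nat
  have closed: "closed (K a m n)" for a m n
  proof -
    have "continuous_on UNIV (\<lambda>x. \<phi> (x + v))" for v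
      by (intro continuous_on_compose2[OF cont] continuous_intros) auto
    then show ?thesis
      unfolding K_def
      by (intro closed_Collect_all closed_Collect_imp closed_Collect_conj closed_Collect_le
          open_Collect_const continuous_intros cont) auto
  qed
  have thick: "AE x in lborel. \<forall>a m n. x \<in> K a m n \<longrightarrow>
    (\<forall>\<delta>>0. \<exists>r>0. \<forall>z. norm z < r \<longrightarrow> (\<exists>k\<in>K a m n. dist (x + z) k \<le> \<delta> * norm z))"
    unfolding AE_all_countable by (intro allI AE_closed_thick closed)
  show ?thesis
    using thick lip_diff_along_AE[OF lip, of e1] lip_diff_along_AE[OF lip, of e2]
  proof eventually_elim
    case (elim x)
    have approx: "\<exists>r>0. \<forall>t. \<bar>t\<bar> \<le> r \<longrightarrow> \<bar>\<phi> (x + t *\<^sub>R e) - \<phi> x - t * a\<bar> \<le> \<eta> * \<bar>t\<bar>"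
      if d: "diff_along \<phi> e x" and a: "\<bar>a - ddir e \<phi> x\<bar> < \<eta>" for e a \<eta>
    proof -
      have "eventually (\<lambda>t. dist (slope_along \<phi> e x t) (ddir e \<phi> x) < \<eta> - \<bar>a - ddir e \<phi> x\<bar>) (at 0)"
        using a by (intro tendstoD slope_tendsto_ddir d) simp
      then obtain r where r: "0 < r" and close: "\<And>t. t \<noteq> 0 \<Longrightarrow> \<bar>t\<bar> < r \<Longrightarrow>
          \<bar>slope_along \<phi> e x t - ddir e \<phi> x\<bar> < \<eta> - \<bar>a - ddir e \<phi> x\<bar>"
        unfolding eventually_at by (auto simp: dist_real_def)
      have "\<bar>\<phi> (x + t *\<^sub>R e) - \<phi> x - t * a\<bar> \<le> \<eta> * \<bar>t\<bar>" if t: "\<bar>t\<bar> \<le> r / 2" for t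
      proof (cases "t = 0")
        case False
        then have "\<bar>slope_along \<phi> e x t - a\<bar> \<le> \<eta>" using close[of t] t r by simp
        then have "\<bar>slope_along \<phi> e x t - a\<bar> * \<bar>t\<bar> \<le> \<eta> * \<bar>t\<bar>" by (rule mult_right_mono) simp
        also have "\<bar>slope_along \<phi> e x t - a\<bar> * \<bar>t\<bar> = \<bar>\<phi> (x + t *\<^sub>R e) - \<phi> x - t * a\<bar>"
        proof -
          have "(slope_along \<phi> e x t - a) * t = \<phi> (x + t *\<^sub>R e) - \<phi> x - t * a"
            using False by (simp add: field_simps)
          then show ?thesis by (metis abs_mult)
        qed
        finally show ?thesis .
      qed simp
      moreover have "0 < r / 2" using r by simp
      ultimately show ?thesis by blast
    qed
    show ?case
    proof (intro allI impI)
      fix \<epsilon> :: real assume \<epsilon>: "0 < \<epsilon>"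
      obtain m where m: "inverse (real (Suc m)) < \<epsilon> / 8"
        using reals_Archimedean[of "\<epsilon> / 8"] \<epsilon> by auto
      define \<eta> where "\<eta> = inverse (real (Suc m))"
      have \<eta>: "0 < \<eta>" "\<eta> < \<epsilon> / 8" using m by (auto simp: \<eta>_def)
      have rat: "\<exists>q. \<bar>of_rat q - c\<bar> < \<eta>" for c :: real
      proof -
        obtain q where "c < of_rat q" "of_rat q < c + \<eta>"
          using of_rat_dense[of c "c + \<eta>"] \<eta>(1) by auto
        then show ?thesis by (intro exI[of _ q]) linarith
      qed
      obtain q1 where q1: "\<bar>of_rat q1 - ddir e1 \<phi> x\<bar> < \<eta>" using rat by blast
      obtain q2 where q2: "\<bar>of_rat q2 - ddir e2 \<phi> x\<bar> < \<eta>" using rat by blast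
      obtain r1 where r1: "0 < r1" "\<And>t. \<bar>t\<bar> \<le> r1 \<Longrightarrow> \<bar>\<phi> (x + t *\<^sub>R e1) - \<phi> x - t * of_rat q1\<bar> \<le> \<eta> * \<bar>t\<bar>"
        using approx[OF elim(2) q1] by blast
      obtain r2 where r2: "0 < r2" "\<And>t. \<bar>t\<bar> \<le> r2 \<Longrightarrow> \<bar>\<phi> (x + t *\<^sub>R e2) - \<phi> x - t * of_rat q2\<bar> \<le> \<eta> * \<bar>t\<bar>"
        using approx[OF elim(3) q2] by blast
      obtain n where n: "inverse (real (Suc n)) < min r1 r2"
        using reals_Archimedean[of "min r1 r2"] r1 r2 by auto
      define S where "S = K (q1, q2) m n"
      have "x \<in> S"
        using r1(2) r2(2) n unfolding S_def K_def \<eta>_def[symmetric] by auto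
      define \<delta> where "\<delta> = \<epsilon> / (8 * (L + 1))"
      have \<delta>: "0 < \<delta>" "L * \<delta> \<le> \<epsilon> / 8" using \<epsilon> L0 by (auto simp: \<delta>_def field_simps)
      obtain r where r: "0 < r" and near: "\<And>z. norm z < r \<Longrightarrow> \<exists>k\<in>S. dist (x + z) k \<le> \<delta> * norm z"
        using elim(1) \<open>x \<in> S\<close> \<delta>(1) unfolding S_def by blast
      define R where "R = min r (inverse (real (Suc n)))"
      have "\<bar>\<phi> (x + z) - \<phi> x - (z $ 1 * ddir e1 \<phi> x + z $ 2 * ddir e2 \<phi> x)\<bar> \<le> \<epsilon> * norm z" if z: "norm z < R" for z
      proof -
        define s t where "s = z $ 1" and "t = z $ 2"
        have st: "\<bar>s\<bar> \<le> norm z" "\<bar>t\<bar> \<le> norm z"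
          unfolding s_def t_def by (rule component_le_norm_cart)+
        have z_eq: "z = s *\<^sub>R e1 + t *\<^sub>R e2"
          by (simp add: vec_eq_iff forall_2 s_def t_def)
        have "norm (s *\<^sub>R e1) < r" using st z by (simp add: R_def)
        then obtain k where k: "k \<in> S" "dist (x + s *\<^sub>R e1) k \<le> \<delta> * \<bar>s\<bar>"
          using near[of "s *\<^sub>R e1"] by auto
        have small: "\<bar>s\<bar> \<le> inverse (real (Suc n))" "\<bar>t\<bar> \<le> inverse (real (Suc n))"
          using st z by (auto simp: R_def)
        have 1: "\<bar>\<phi> (x + s *\<^sub>R e1) - \<phi> x - s * of_rat q1\<bar> \<le> \<eta> * \<bar>s\<bar>"
          using \<open>x \<in> S\<close> small by (auto simp: S_def K_def \<eta>_def)
        have 2: "\<bar>\<phi> (k + t *\<^sub>R e2) - \<phi> k - t * of_rat q2\<bar> \<le> \<eta> * \<bar>t\<bar>"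
          using k(1) small by (auto simp: S_def K_def \<eta>_def)
        have Lk: "L * dist (x + s *\<^sub>R e1) k \<le> \<epsilon> / 8 * \<bar>s\<bar>"
        proof -
          have "L * dist (x + s *\<^sub>R e1) k \<le> L * (\<delta> * \<bar>s\<bar>)" using k(2) L0 by (rule mult_left_mono)
          also have "\<dots> \<le> \<epsilon> / 8 * \<bar>s\<bar>" using mult_right_mono[OF \<delta>(2), of "\<bar>s\<bar>"] by (simp add: mult_ac)
          finally show ?thesis .
        qed
        have 3: "\<bar>\<phi> (x + z) - \<phi> (k + t *\<^sub>R e2)\<bar> \<le> \<epsilon> / 8 * \<bar>s\<bar>"
          using lipschitz_onD[OF L, of "x + z" "k + t *\<^sub>R e2"] Lk
          by (simp add: z_eq dist_norm algebra_simps)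
        have 4: "\<bar>\<phi> (x + s *\<^sub>R e1) - \<phi> k\<bar> \<le> \<epsilon> / 8 * \<bar>s\<bar>"
          using lipschitz_onD[OF L, of "x + s *\<^sub>R e1" k] Lk by (simp add: dist_real_def)
        have 5: "\<bar>s * of_rat q1 - s * ddir e1 \<phi> x\<bar> \<le> \<eta> * \<bar>s\<bar>"
          using mult_right_mono[OF less_imp_le[OF q1], of "\<bar>s\<bar>"] by (simp add: abs_mult[symmetric] algebra_simps)
        have 6: "\<bar>t * of_rat q2 - t * ddir e2 \<phi> x\<bar> \<le> \<eta> * \<bar>t\<bar>"
          using mult_right_mono[OF less_imp_le[OF q2], of "\<bar>t\<bar>"] by (simp add: abs_mult[symmetric] algebra_simps)
        have "\<eta> * \<bar>s\<bar> \<le> \<epsilon> / 8 * norm z" "\<eta> * \<bar>t\<bar> \<le> \<epsilon> / 8 * norm z" "\<epsilon> / 8 * \<bar>s\<bar> \<le> \<epsilon> / 8 * norm z"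
          using st \<eta> \<epsilon> by (intro mult_mono; simp)+
        moreover have "\<epsilon> * norm z = 8 * (\<epsilon> / 8 * norm z)" by simp
        moreover have "0 \<le> \<epsilon> / 8 * norm z" using \<epsilon> by simp
        ultimately show ?thesis
          using 1 2 3 4 5 6 unfolding s_def[symmetric] t_def[symmetric] by linarith
      qed
      moreover have "0 < R" using r by (simp add: R_def)
      ultimately show "\<exists>r>0. \<forall>z. norm z < r \<longrightarrow>
        \<bar>\<phi> (x + z) - \<phi> x - (z $ 1 * ddir e1 \<phi> x + z $ 2 * ddir e2 \<phi> x)\<bar> \<le> \<epsilon> * norm z"
        by blast
    qed
  qed
qed

section \<open>The mass of a pulled-back bump\<close>

text \<open>The linear change of variables, combined with a translation, is transferred from vector-valued
  Henstock-Kurzweil integrals to scalar Lebesgue integrals.\<close>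
lemma integral_affine_change:
  fixes F :: "real^2 \<Rightarrow> real" and A :: "real^2^2"
  assumes F: "continuous_on UNIV F" and supp: "\<And>z. \<rho> < norm z \<Longrightarrow> F z = 0" and det: "det A \<noteq> 0"
  shows "integrable lborel (\<lambda>x. F (c + A *v x) * \<bar>det A\<bar>)" (is ?int)
    and "(\<integral>x. F (c + A *v x) * \<bar>det A\<bar> \<partial>lborel) = (\<integral>z. F z \<partial>lborel)"
proof -
  have inv: "invertible A" using det by (simp add: invertible_det_nz)
  define G where "G z = F (c + z)" for z
  have G: "continuous_on UNIV G"
    unfolding G_def by (intro continuous_on_compose2[OF F] continuous_intros) auto
  have "G z = 0" if "\<rho> + norm c < norm z" for z
    using that norm_triangle_ineq4[of "c + z" c] by (simp add: G_def supp)
  then have intG: "integrable lborel G"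
    by (rule integrable_continuous_bounded_support[OF G])
  have contA: "continuous_on UNIV ((*v) A)"
    by (intro linear_continuous_on matrix_vector_mul_bounded_linear)
  obtain B where B: "0 < B" "\<And>x. B * norm x \<le> norm (A *v x)"
  proof -
    have "inj ((*v) A)" using inv inj_matrix_vector_mult by blast
    then show ?thesis
      using linear_inj_bounded_below_pos[of "(*v) A"] that by (auto simp: mult.commute)
  qed
  have intGA: "integrable lborel (\<lambda>x. G (A *v x))"
  proof (rule integrable_continuous_bounded_support)
    show "continuous_on UNIV (\<lambda>x. G (A *v x))"
      by (rule continuous_on_compose2[OF G contA]) auto
    fix x :: "real^2" assume "(\<rho> + norm c) / B < norm x"
    then have "\<rho> + norm c < norm (A *v x)"
      using B(1) B(2)[of x] by (simp add: pos_divide_less_eq mult.commute)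
    then show "G (A *v x) = 0"
      using norm_triangle_ineq4[of "c + A *v x" c] by (simp add: G_def supp)
  qed
  let ?v = "\<lambda>z. vec (G z) :: real^1"
  have absint: "?v absolutely_integrable_on UNIV"
  proof -
    have eq: "?v = (\<lambda>z. G z *\<^sub>R vec 1)" by (simp add: vec_eq_iff fun_eq_iff)
    have "integrable lebesgue G"
      using intG by (simp add: integrable_completion)
    then show ?thesis
      unfolding eq set_integrable_def by simp
  qed
  have surj: "range ((*v) A) = UNIV"
    using inv invertible_right_inverse matrix_right_invertible_surjective by blast
  have "integral (range ((*v) A)) ?v = \<bar>det (matrix ((*v) A))\<bar> *\<^sub>R integral UNIV (?v \<circ> (*v) A)"
    by (rule integral_change_of_variables_linear) (use absint surj in auto)
  then have "integral UNIV ?v $ 1 = \<bar>det A\<bar> * integral UNIV (?v \<circ> (*v) A) $ 1"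
    using det surj by simp
  moreover have comp: "integral UNIV (\<lambda>x. vec (g x) :: real^1) $ 1 = integral UNIV g" if "integrable lborel g" for g :: "real^2 \<Rightarrow> real"
  proof -
    have "(g has_integral integral UNIV g) UNIV"
      using that integrable_on_lborel integrable_integral by blast
    then have "((\<lambda>x. vec (g x) :: real^1) has_integral vec (integral UNIV g)) UNIV"
      by (subst has_integral_componentwise_iff) (auto simp: Basis_vec_def inner_axis)
    then show ?thesis by (simp add: integral_unique)
  qed
  ultimately have "integral UNIV G = \<bar>det A\<bar> * integral UNIV (\<lambda>x. G (A *v x))"
    using intG intGA by (simp add: o_def)
  then have "(\<integral>x. G x \<partial>lborel) = (\<integral>x. G (A *v x) * \<bar>det A\<bar> \<partial>lborel)"
    using intG intGA by (simp add: integral_lborel mult.commute)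
  moreover have "(\<integral>x. G x \<partial>lborel) = (\<integral>z. F z \<partial>lborel)"
    using integral_lborel_translate[OF borel_measurable_continuous_onI[OF F], of c] by (simp add: G_def add.commute)
  ultimately show "(\<integral>x. F (c + A *v x) * \<bar>det A\<bar> \<partial>lborel) = (\<integral>z. F z \<partial>lborel)"
    by (simp add: G_def)
  show ?int using intGA by (simp add: G_def)
qed

text \<open>Pulled back by \<open>(g1, g2)\<close>, the area form with density \<open>a(s) b(t)\<close> is itself a
  Jacobian, since \<open>b\<close> has the antiderivative \<open>B\<close>. The chain rule is needed for functions of one
  variable only, so the existence of directional derivatives suffices.\<close>
lemma jac2_pullback_AE:
  assumes g: "lip g1" "lip g2"
    and a: "\<And>t. (a has_real_derivative a' t) (at t)" and B: "\<And>t. (B has_real_derivative b t) (at t)"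
  shows "AE x in lborel. jac2 g1 (\<lambda>x. a (g1 x) * B (g2 x)) x = a (g1 x) * b (g2 x) * jac2 g1 g2 x"
  using lip_diff_along_AE[OF g(1), of e1] lip_diff_along_AE[OF g(1), of e2]
    lip_diff_along_AE[OF g(2), of e1] lip_diff_along_AE[OF g(2), of e2]
proof eventually_elim
  case (elim x)
  have "ddir e (\<lambda>x. a (g1 x) * B (g2 x)) x =
      a' (g1 x) * ddir e g1 x * B (g2 x) + b (g2 x) * ddir e g2 x * a (g1 x)"
    if "diff_along g1 e x" "diff_along g2 e x" for e
    using ddir_mult(2)[OF ddir_compose(1)[OF that(1) a] ddir_compose(1)[OF that(2) B]]
      ddir_compose(2)[OF that(1) a] ddir_compose(2)[OF that(2) B] by simp
  then show ?case
    using elim by (simp add: jac2_def algebra_simps)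
qed

text \<open>Homotopy invariance of the degree: the difference of the two pullbacks is a sum of two Jacobians,
  each with one entry of bounded support.\<close>
lemma integral_pullback_invariant:
  assumes g: "lip g1" "lip g2" and k: "lip k1" "lip k2"
    and agree: "\<And>x. R < norm x \<Longrightarrow> g1 x = k1 x" "\<And>x. R < norm x \<Longrightarrow> g2 x = k2 x"
    and a: "lip a" "\<And>t. (a has_real_derivative a' t) (at t)" "\<And>t. \<bar>a t\<bar> \<le> Ma"
    and B: "lip B" "\<And>t. (B has_real_derivative b t) (at t)" "\<And>t. \<bar>B t\<bar> \<le> Mb"
  shows "integrable lborel (\<lambda>x. a (g1 x) * b (g2 x) * jac2 g1 g2 x - a (k1 x) * b (k2 x) * jac2 k1 k2 x)"
      (is "integrable _ ?D")
    and "(\<integral>x. a (g1 x) * b (g2 x) * jac2 g1 g2 x - a (k1 x) * b (k2 x) * jac2 k1 k2 x \<partial>lborel) = 0"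
proof -
  define G K where "G x = a (g1 x) * B (g2 x)" and "K x = a (k1 x) * B (k2 x)" for x
  have G: "lip G"
    unfolding G_def by (rule lip_mult_bounded[OF lip_compose[OF a(1) g(1)] a(3) lip_compose[OF B(1) g(2)] B(3)])
  have K: "lip K"
    unfolding K_def by (rule lip_mult_bounded[OF lip_compose[OF a(1) k(1)] a(3) lip_compose[OF B(1) k(2)] B(3)])
  have I1: "integrable lborel (jac2 (\<lambda>x. g1 x - k1 x) G)" "(\<integral>x. jac2 (\<lambda>x. g1 x - k1 x) G x \<partial>lborel) = 0"
    using integral_jac2_eq_0[OF lip_diff[OF g(1) k(1)] G, of R] agree by simp_all
  have I2: "integrable lborel (jac2 k1 (\<lambda>x. G x - K x))" "(\<integral>x. jac2 k1 (\<lambda>x. G x - K x) x \<partial>lborel) = 0"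
    using integral_jac2_eq_0'[OF k(1) lip_diff[OF G K], of R] agree by (simp_all add: G_def K_def)
  have eq: "AE x in lborel. jac2 (\<lambda>x. g1 x - k1 x) G x + jac2 k1 (\<lambda>x. G x - K x) x = ?D x"
    using jac2_pullback_AE[OF g a(2) B(2)] jac2_pullback_AE[OF k a(2) B(2)]
      lip_diff_along_AE[OF g(1), of e1] lip_diff_along_AE[OF g(1), of e2]
      lip_diff_along_AE[OF k(1), of e1] lip_diff_along_AE[OF k(1), of e2]
      lip_diff_along_AE[OF G, of e1] lip_diff_along_AE[OF G, of e2]
      lip_diff_along_AE[OF K, of e1] lip_diff_along_AE[OF K, of e2]
  proof eventually_elim
    case (elim x)
    have "jac2 (\<lambda>x. g1 x - k1 x) G x + jac2 k1 (\<lambda>x. G x - K x) x = jac2 g1 G x - jac2 k1 K x"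
      using elim by (simp add: jac2_def ddir_diff algebra_simps)
    then show ?case using elim(1,2) by (simp add: G_def[abs_def] K_def[abs_def])
  qed
  have m: "?D \<in> borel_measurable lborel"
  proof -
    have b_meas: "b \<in> borel_measurable borel"
    proof (rule borel_measurable_LIMSEQ_real)
      let ?q = "\<lambda>n t. (B (t + inverse (real (Suc n))) - B t) / inverse (real (Suc n))"
      have [measurable]: "B \<in> borel_measurable borel" by (rule lip_measurable[OF B(1)])
      show "?q n \<in> borel_measurable borel" for n by measurable
      fix t
      have "filterlim (\<lambda>n. inverse (real (Suc n))) (at 0) sequentially"
        using LIMSEQ_inverse_real_of_nat by (auto simp: filterlim_at)
      from filterlim_compose[OF B(2)[of t, unfolded DERIV_def] this]
      show "(\<lambda>n. ?q n t) \<longlonglongrightarrow> b t" .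
    qed
    note [measurable] = b_meas lip_measurable[OF a(1)] lip_measurable[OF g(1)] lip_measurable[OF g(2)]
      lip_measurable[OF k(1)] lip_measurable[OF k(2)] lip_measurable_jac2[OF g] lip_measurable_jac2[OF k]
    show ?thesis by measurable
  qed
  have "has_bochner_integral lborel (\<lambda>x. jac2 (\<lambda>x. g1 x - k1 x) G x + jac2 k1 (\<lambda>x. G x - K x) x) (0 + 0)"
    using I1 I2 by (intro has_bochner_integral_add) (simp_all add: has_bochner_integral_iff)
  then have "has_bochner_integral lborel ?D 0"
    using has_bochner_integral_cong_AE[OF _ m eq] by (auto simp: has_bochner_integral_iff)
  then show "integrable lborel ?D" "(\<integral>x. ?D x \<partial>lborel) = 0"
    by (auto simp: has_bochner_integral_iff)
qed

lemma ddir_affine: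
  fixes A :: "real^2^2"
  shows "ddir e1 (\<lambda>x. (c + A *v x) $ i) x = A $ i $ 1" "ddir e2 (\<lambda>x. (c + A *v x) $ i) x = A $ i $ 2"
proof -
  have *: "((\<lambda>t. (c + A *v (x + t *\<^sub>R e)) $ i) has_real_derivative (A *v e) $ i) (at 0)" for e
  proof -
    have "(\<lambda>t. (c + A *v (x + t *\<^sub>R e)) $ i) = (\<lambda>t. (c + A *v x) $ i + t * (A *v e) $ i)"
      by (simp add: matrix_vector_right_distrib matrix_vector_mult_scaleR add.assoc)
    then show ?thesis by (auto intro!: derivative_eq_intros)
  qed
  have "(A *v e1) $ i = A $ i $ 1" "(A *v e2) $ i = A $ i $ 2"
    by (simp_all add: matrix_vector_mult_def sum_2)
  then show "ddir e1 (\<lambda>x. (c + A *v x) $ i) x = A $ i $ 1" "ddir e2 (\<lambda>x. (c + A *v x) $ i) x = A $ i $ 2"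
    using ddirI(2)[OF *[of e1]] ddirI(2)[OF *[of e2]] by simp_all
qed

lemma lip_affine: "lip (\<lambda>x :: real^2. (c + A *v x) $ i)" for A :: "real^2^2"
proof -
  have "(\<lambda>x. (c + A *v x) $ i) = (\<lambda>x. c $ i + (A $ i $ 1 * x $ 1 + A $ i $ 2 * x $ 2))"
    by (simp add: matrix_vector_mult_def sum_2)
  then show ?thesis by (simp only:) (intro lip_add lip_const lip_cmult lip_coord)
qed

text \<open>The degree formula: a pair that is affine near infinity covers each point as often as
  its affine part, namely once, with the orientation of \<open>A\<close>.\<close>
theorem integral_pullback_affine_outside:
  fixes A :: "real^2^2"
  assumes g: "lip g1" "lip g2"
    and agree: "\<And>x. R < norm x \<Longrightarrow> g1 x = (c + A *v x) $ 1" "\<And>x. R < norm x \<Longrightarrow> g2 x = (c + A *v x) $ 2"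
    and det: "det A \<noteq> 0"
    and a: "lip a" "\<And>t. (a has_real_derivative a' t) (at t)" "\<And>t. \<bar>a t\<bar> \<le> Ma"
    and B: "lip B" "\<And>t. (B has_real_derivative b t) (at t)" "\<And>t. \<bar>B t\<bar> \<le> Mb"
    and b: "continuous_on UNIV b"
    and supp: "\<And>s t. \<rho> < norm (vector [s, t] :: real^2) \<Longrightarrow> a s * b t = 0"
  shows "integrable lborel (\<lambda>x. a (g1 x) * b (g2 x) * jac2 g1 g2 x)"
    and "(\<integral>x. a (g1 x) * b (g2 x) * jac2 g1 g2 x \<partial>lborel) = sgn (det A) * (\<integral>z. a ((z::real^2) $ 1) * b (z $ 2) \<partial>lborel)"
proof -
  let ?F = "\<lambda>z::real^2. a (z $ 1) * b (z $ 2)"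
  let ?k = "\<lambda>i x. (c + A *v x) $ i"
  have F: "continuous_on UNIV ?F"
    by (intro continuous_intros continuous_on_compose2[OF lip_continuous[OF a(1)]] continuous_on_compose2[OF b]) auto
  have F0: "?F z = 0" if "\<rho> < norm z" for z
  proof -
    have "vector [z $ 1, z $ 2] = z" by (simp add: vec_eq_iff forall_2)
    then show ?thesis using supp[of "z $ 1" "z $ 2"] that by simp
  qed
  have J: "jac2 (?k 1) (?k 2) x = det A" for x
    unfolding jac2_def ddir_affine det_2 ..
  have D: "integrable lborel (\<lambda>x. a (g1 x) * b (g2 x) * jac2 g1 g2 x - ?F (c + A *v x) * det A)"
      "(\<integral>x. a (g1 x) * b (g2 x) * jac2 g1 g2 x - ?F (c + A *v x) * det A \<partial>lborel) = 0"
    using integral_pullback_invariant[OF g lip_affine[of c A 1] lip_affine[of c A 2] agree a B]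
    unfolding J by simp_all
  have E: "integrable lborel (\<lambda>x. ?F (c + A *v x) * det A)"
      "(\<integral>x. ?F (c + A *v x) * det A \<partial>lborel) = sgn (det A) * (\<integral>z. ?F z \<partial>lborel)"
  proof -
    have "has_bochner_integral lborel (\<lambda>x. sgn (det A) * (?F (c + A *v x) * \<bar>det A\<bar>)) (sgn (det A) * (\<integral>z. ?F z \<partial>lborel))"
    proof (rule has_bochner_integral_mult_right)
      show "has_bochner_integral lborel (\<lambda>x. ?F (c + A *v x) * \<bar>det A\<bar>) (\<integral>z. ?F z \<partial>lborel)"
        unfolding has_bochner_integral_iff
        by (intro conjI integral_affine_change[OF F F0 det])
    qed
    moreover have "(\<lambda>x. sgn (det A) * (?F (c + A *v x) * \<bar>det A\<bar>)) = (\<lambda>x. ?F (c + A *v x) * det A)"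
    proof
      fix x
      have "sgn (det A) * (?F (c + A *v x) * \<bar>det A\<bar>) = ?F (c + A *v x) * (sgn (det A) * \<bar>det A\<bar>)"
        by (rule mult.left_commute)
      also have "sgn (det A) * \<bar>det A\<bar> = det A" by (rule sgn_mult_abs)
      finally show "sgn (det A) * (?F (c + A *v x) * \<bar>det A\<bar>) = ?F (c + A *v x) * det A" .
    qed
    ultimately have "has_bochner_integral lborel (\<lambda>x. ?F (c + A *v x) * det A) (sgn (det A) * (\<integral>z. ?F z \<partial>lborel))"
      by (simp only:)
    then show "integrable lborel (\<lambda>x. ?F (c + A *v x) * det A)"
      "(\<integral>x. ?F (c + A *v x) * det A \<partial>lborel) = sgn (det A) * (\<integral>z. ?F z \<partial>lborel)"
      unfolding has_bochner_integral_iff by blast+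
  qed
  have "has_bochner_integral lborel (\<lambda>x. (a (g1 x) * b (g2 x) * jac2 g1 g2 x - ?F (c + A *v x) * det A)
      + ?F (c + A *v x) * det A) (0 + sgn (det A) * (\<integral>z. ?F z \<partial>lborel))"
    using D E by (intro has_bochner_integral_add) (simp_all only: has_bochner_integral_iff)
  then show "integrable lborel (\<lambda>x. a (g1 x) * b (g2 x) * jac2 g1 g2 x)"
    "(\<integral>x. a (g1 x) * b (g2 x) * jac2 g1 g2 x \<partial>lborel) = sgn (det A) * (\<integral>z. ?F z \<partial>lborel)"
    by (auto simp: has_bochner_integral_iff)
qed

lemma jac2_rescale_AE:
  assumes "lip \<phi>" "lip \<psi>" "\<delta> \<noteq> 0"
  shows "AE x in lborel. jac2 (\<lambda>x. (\<phi> x - p) / \<delta>) (\<lambda>x. (\<psi> x - q) / \<delta>) x = jac2 \<phi> \<psi> x / \<delta>\<^sup>2"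
  using lip_diff_along_AE[OF assms(1), of e1] lip_diff_along_AE[OF assms(1), of e2]
    lip_diff_along_AE[OF assms(2), of e1] lip_diff_along_AE[OF assms(2), of e2]
proof eventually_elim
  case (elim x)
  have "ddir e (\<lambda>x. (\<phi> x - p) / \<delta>) x = 1 / \<delta> * ddir e \<phi> x" if "diff_along \<phi> e x" for e p and \<phi> :: "real^2 \<Rightarrow> real"
    using that by (rule ddir_compose(2)) (use assms(3) in \<open>auto intro!: derivative_eq_intros\<close>)
  then have "ddir e1 (\<lambda>x. (\<phi> x - p) / \<delta>) x = 1 / \<delta> * ddir e1 \<phi> x" "ddir e2 (\<lambda>x. (\<phi> x - p) / \<delta>) x = 1 / \<delta> * ddir e2 \<phi> x"
    "ddir e1 (\<lambda>x. (\<psi> x - q) / \<delta>) x = 1 / \<delta> * ddir e1 \<psi> x" "ddir e2 (\<lambda>x. (\<psi> x - q) / \<delta>) x = 1 / \<delta> * ddir e2 \<psi> x"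
    using elim by blast+
  then show ?case
    unfolding jac2_def by (simp only:) (simp add: power2_eq_square diff_divide_distrib)
qed

lemma lip_rescale: "lip \<phi> \<Longrightarrow> lip (\<lambda>x. (\<phi> x - p) / \<delta>)"
  using lip_cmult[OF lip_diff[OF _ lip_const], of \<phi> "1 / \<delta>" p] by simp

lemma lip_of_bounded_deriv:
  fixes f :: "real \<Rightarrow> real"
  assumes d: "\<And>t. (f has_real_derivative f' t) (at t)" and b: "\<And>t. \<bar>f' t\<bar> \<le> C"
  shows "C-lipschitz_on UNIV f"
proof (rule lipschitz_onI)
  fix x y :: real
  show "dist (f x) (f y) \<le> C * dist x y"
    using field_differentiable_bound[of UNIV f f' C x y] d b
    by (simp add: dist_norm)
  show "0 \<le> C" using b[of 0] by linarith
qed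

text \<open>The bump is \<open>(1 - t\<^sup>2)\<^sub>+\<^sup>2\<close>: differentiable everywhere, and zero outside \<open>[-1, 1]\<close>.\<close>
lemma obtain_bump:
  obtains \<tau> \<tau>' T :: "real \<Rightarrow> real" and M :: real
  where "\<And>t. (\<tau> has_real_derivative \<tau>' t) (at t)" "\<And>t. (T has_real_derivative \<tau> t) (at t)"
    "lip \<tau>" "lip T" "\<And>t. 0 \<le> \<tau> t" "\<And>t. \<tau> t \<le> 1" "\<And>t. 1 \<le> \<bar>t\<bar> \<Longrightarrow> \<tau> t = 0" "\<tau> 0 = 1"
    "\<And>t. \<bar>T t\<bar> \<le> M" "\<And>t. 1 \<le> \<bar>t\<bar> \<Longrightarrow> T t = T (sgn t)"
proof -
  define m :: "real \<Rightarrow> real" where "m x = (max 0 x)\<^sup>2" for x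
  define \<tau> where "\<tau> t = m (1 - t\<^sup>2)" for t
  define \<tau>' where "\<tau>' t = 2 * max 0 (1 - t\<^sup>2) * (- 2 * t)" for t :: real
  have m: "(m has_real_derivative 2 * max 0 x) (at x)" for x
  proof -
    consider "0 < x" | "x < 0" | "x = 0" by linarith
    then show ?thesis
    proof cases
      case 1
      have "((\<lambda>x. x\<^sup>2) has_real_derivative 2 * max 0 x) (at x)"
        using 1 by (auto intro!: derivative_eq_intros)
      moreover have "eventually (\<lambda>y. y\<^sup>2 = m y) (nhds x)"
        using eventually_nhds_in_open[of "{0<..}" x] 1 by (auto elim!: eventually_mono simp: m_def)
      ultimately show ?thesis by (subst DERIV_cong_ev[OF refl _ refl]) (auto elim: eventually_mono)
    next
      case 2
      have "((\<lambda>x. 0) has_real_derivative 2 * max 0 x) (at x)"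
        using 2 by auto
      moreover have "eventually (\<lambda>y. 0 = m y) (nhds x)"
        using eventually_nhds_in_open[of "{..<0}" x] 2 by (auto elim!: eventually_mono simp: m_def)
      ultimately show ?thesis by (subst DERIV_cong_ev[OF refl _ refl]) (auto elim: eventually_mono)
    next
      case 3
      have "((\<lambda>h. m h / h) \<longlongrightarrow> 0) (at 0)"
      proof (rule tendsto_sandwich[of "\<lambda>h. - \<bar>h\<bar>" _ _ "\<lambda>h. \<bar>h\<bar>"])
        show "((\<lambda>h::real. \<bar>h\<bar>) \<longlongrightarrow> 0) (at 0)" "((\<lambda>h::real. - \<bar>h\<bar>) \<longlongrightarrow> 0) (at 0)"
          by (auto intro!: tendsto_eq_intros)
      qed (auto simp: m_def max_def power2_eq_square divide_simps intro!: always_eventually)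
      then show ?thesis using 3 by (simp add: DERIV_def m_def)
    qed
  qed
  have d\<tau>: "(\<tau> has_real_derivative \<tau>' t) (at t)" for t
    unfolding \<tau>_def \<tau>'_def by (rule DERIV_chain2[OF m]) (auto intro!: derivative_eq_intros)
  have out: "\<tau> t = 0" if "1 \<le> \<bar>t\<bar>" for t
  proof -
    have "1 \<le> t\<^sup>2" using that by (metis one_power2 power2_abs power_mono zero_le_one)
    then show ?thesis by (simp add: \<tau>_def m_def)
  qed
  have nn: "0 \<le> \<tau> t" and le1: "\<tau> t \<le> 1" for t
    by (auto simp: \<tau>_def m_def power_le_one)
  have \<tau>'_le: "\<bar>\<tau>' t\<bar> \<le> 4" for t
  proof (cases "1 \<le> \<bar>t\<bar>")
    case True
    then have "1 \<le> t\<^sup>2" by (metis one_power2 power2_abs power_mono zero_le_one)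
    then show ?thesis by (simp add: \<tau>'_def)
  next
    case False
    have "\<bar>\<tau>' t\<bar> = 4 * (max 0 (1 - t\<^sup>2) * \<bar>t\<bar>)" by (simp add: \<tau>'_def abs_mult)
    also have "\<dots> \<le> 4 * (1 * 1)" using False by (intro mult_left_mono mult_mono) auto
    finally show ?thesis by simp
  qed
  have lip\<tau>: "lip \<tau>" using lip_of_bounded_deriv[OF d\<tau> \<tau>'_le] by blast
  have "\<exists>F. \<forall>x::real. -\<infinity> < ereal x \<longrightarrow> ereal x < \<infinity> \<longrightarrow> (F has_vector_derivative \<tau> x) (at x)"
    by (rule einterval_antiderivative) (use DERIV_isCont[OF d\<tau>] in auto)
  then obtain T where dT: "(T has_real_derivative \<tau> t) (at t)" for t
    by (auto simp: has_real_derivative_iff_has_vector_derivative)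
  have lipT: "1-lipschitz_on UNIV T"
    by (rule lip_of_bounded_deriv[OF dT]) (use nn le1 in auto)
  have const: "T t = T (sgn t)" if t1: "1 \<le> \<bar>t\<bar>" for t
  proof -
    have D0: "(T has_real_derivative 0) (at x)" if "1 \<le> \<bar>x\<bar>" for x
      using dT[of x] out[OF that] by simp
    have contT: "continuous_on S T" for S
      by (rule continuous_on_subset[OF lipschitz_on_continuous_on[OF lipT]]) simp
    consider "t = 1" | "1 < t" | "t = - 1" | "t < - 1" using t1 by linarith
    then show ?thesis
    proof cases
      case 2
      then have "T t = T 1"
        by (intro DERIV_isconst2[of 1 t T t] contT D0) auto
      then show ?thesis using 2 by simp
    next
      case 4
      then have "T (- 1) = T t"
        by (intro DERIV_isconst2[of t "- 1" T "- 1"] contT D0) auto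
      then show ?thesis using 4 by simp
    qed auto
  qed
  have "\<bar>T t\<bar> \<le> \<bar>T 0\<bar> + 1" for t
  proof -
    have near: "\<bar>T t\<bar> \<le> \<bar>T 0\<bar> + 1" if "\<bar>t\<bar> \<le> 1" for t
      using lipschitz_onD[OF lipT, of t 0] that by (simp add: dist_real_def)
    show ?thesis
      using near[of t] near[of "sgn t"] const[of t] by (cases "1 \<le> \<bar>t\<bar>") (auto simp: abs_sgn_eq)
  qed
  then show ?thesis
    using that[OF d\<tau> dT lip\<tau> _ nn le1 out _ _ const] lipT by (auto simp: \<tau>_def m_def)
qed

text \<open>A differentiable bump \<open>\<tau>\<close> with its antiderivative \<open>T\<close>.\<close>
locale bump =
  fixes \<tau> \<tau>' T :: "real \<Rightarrow> real" and M :: real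
  assumes d_bump: "\<And>t. (\<tau> has_real_derivative \<tau>' t) (at t)"
    and d_T: "\<And>t. (T has_real_derivative \<tau> t) (at t)"
    and lip_bump: "lip \<tau>" and lip_T: "lip T"
    and bump_nonneg: "\<And>t. 0 \<le> \<tau> t" and bump_le_1: "\<And>t. \<tau> t \<le> 1"
    and bump_0_outside: "\<And>t. 1 \<le> \<bar>t\<bar> \<Longrightarrow> \<tau> t = 0" and bump_at_0: "\<tau> 0 = 1"
    and T_bounded: "\<And>t. \<bar>T t\<bar> \<le> M"
    and T_const_outside: "\<And>t. 1 \<le> \<bar>t\<bar> \<Longrightarrow> T t = T (sgn t)"
begin

lemma bump_bounded: "\<bar>\<tau> t\<bar> \<le> 1"
  using bump_nonneg[of t] bump_le_1[of t] by simp

lemma T_mono: "s \<le> t \<Longrightarrow> T s \<le> T t"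
  by (rule DERIV_nonneg_imp_nondecreasing[of s t T]) (use d_T bump_nonneg in auto)

text \<open>The mass of the planar bump, which every pullback by a map of degree one retains.\<close>
definition m0 :: real where "m0 = (\<integral>z. \<tau> ((z::real^2) $ 1) * \<tau> (z $ 2) \<partial>lborel)"

lemma large_coordinate:
  fixes z :: "real^2"
  assumes "2 * c \<le> norm z" shows "c \<le> \<bar>z $ 1\<bar> \<or> c \<le> \<bar>z $ 2\<bar>"
proof -
  have "norm z \<le> \<bar>z $ 1\<bar> + \<bar>z $ 2\<bar>" using norm_le_l1_cart[of z] by (simp add: sum_2)
  then show ?thesis using assms by linarith
qed

lemma m0_pos: "0 < m0"
proof -
  let ?F = "\<lambda>z::real^2. \<tau> (z $ 1) * \<tau> (z $ 2)"
  have cont: "continuous_on UNIV ?F"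
    by (intro continuous_intros continuous_on_compose2[OF lip_continuous[OF lip_bump]]) auto
  have int: "integrable lborel ?F"
  proof (rule integrable_continuous_bounded_support[OF cont])
    show "?F z = 0" if "2 < norm z" for z
      using large_coordinate[of 1 z] that bump_0_outside[of "z $ 1"] bump_0_outside[of "z $ 2"] by auto
  qed
  have "m0 \<noteq> 0"
  proof
    assume "m0 = 0"
    then have "AE z in lborel. ?F z = 0"
      using integral_nonneg_eq_0_iff_AE[OF int] bump_nonneg by (simp add: m0_def)
    then have "?F 0 = 0" by (rule AE_zero_continuous[OF cont])
    then show False by (simp add: bump_at_0)
  qed
  moreover have "0 \<le> m0" unfolding m0_def by (intro integral_nonneg_AE) (simp add: bump_nonneg)
  ultimately show ?thesis by simp
qed

text \<open>The integrand bridges the gap between two bumps at horizontal distance \<open>s\<close>: its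
  derivative in the first variable is the difference of the two.\<close>
lemma integral_strip_le:
  assumes s: "0 \<le> s"
  shows "(\<integral>z. (T ((z::real^2) $ 1) - T (z $ 1 - s)) * \<tau> (z $ 2) \<partial>lborel) \<le> 4 * M * (s + 2)" (is "?I \<le> _")
proof -
  let ?F = "\<lambda>z::real^2. (T (z $ 1) - T (z $ 1 - s)) * \<tau> (z $ 2)"
  let ?B = "cbox (vector [-1, -1]) (vector [1 + s, 1]) :: (real^2) set"
  have M: "0 \<le> M" using T_bounded[of 0] by linarith
  have le: "?F z \<le> 2 * M * indicator ?B z" for z
  proof (cases "z \<in> ?B")
    case True
    have "?F z \<le> (2 * M) * 1"
      using T_bounded[of "z $ 1"] T_bounded[of "z $ 1 - s"] bump_le_1 bump_nonneg M
      by (intro mult_mono) (auto simp: abs_le_iff)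
    then show ?thesis using True by simp
  next
    case False
    then consider "z $ 1 < -1" | "1 + s < z $ 1" | "1 \<le> \<bar>z $ 2\<bar>"
      by (auto simp: mem_box_cart forall_2 not_le)
    then have "?F z = 0"
    proof cases
      case 1
      then show ?thesis using s T_const_outside[of "z $ 1"] T_const_outside[of "z $ 1 - s"] by simp
    next
      case 2
      then show ?thesis using s T_const_outside[of "z $ 1"] T_const_outside[of "z $ 1 - s"] by simp
    qed (simp add: bump_0_outside)
    moreover have "0 \<le> 2 * M * indicator ?B z" using M by simp
    ultimately show ?thesis by (simp only:)
  qed
  have int: "integrable lborel (\<lambda>z. 2 * M * indicator ?B z)"
    by (intro integrable_mult_right integrable_real_indicator) (auto simp: emeasure_lborel_cbox_eq)
  have "?I \<le> (\<integral>z. 2 * M * indicator ?B z \<partial>lborel)"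
  proof (cases "integrable lborel ?F")
    case True
    then show ?thesis using int le by (intro integral_mono) auto
  next
    case False
    then have "?I = 0" by (rule not_integrable_integral_eq)
    also have "0 \<le> (\<integral>z. 2 * M * indicator ?B z \<partial>lborel)"
      using M by (intro integral_nonneg_AE) simp
    finally show ?thesis .
  qed
  also have "\<dots> = 2 * M * measure lborel ?B" by simp
  also have "measure lborel ?B = 2 * (s + 2)"
    using s by (subst content_cbox_cart) (auto simp: interval_ne_empty_cart forall_2 UNIV_2)
  finally show ?thesis by (simp add: algebra_simps)
qed

end

section \<open>Passing a lower Lipschitz bound from a set with dense image to the whole space\<close>

text \<open>The inverse of \<open>f\<close> on \<open>f ` S\<close> extends to a Lipschitz map \<open>G\<close> of the whole space, which is the
  identity near infinity like \<open>f\<close> and therefore onto by Brouwer's theorem. As \<open>G\<close> is onto, the set \<open>S\<close>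
  itself is dense, and \<open>G (f x) = x\<close> extends from \<open>S\<close> to all \<open>x\<close>.\<close>
lemma lower_lipschitz_of_dense:
  fixes f :: "'a::euclidean_space \<Rightarrow> 'a"
  assumes f: "continuous_on UNIV f" "\<And>x. R < norm x \<Longrightarrow> f x = x"
    and low: "\<And>x x'. x \<in> S \<Longrightarrow> x' \<in> S \<Longrightarrow> dist x x' \<le> C * dist (f x) (f x')"
    and dense: "\<And>y \<epsilon>. 0 < \<epsilon> \<Longrightarrow> \<exists>x\<in>S. dist (f x) y < \<epsilon>"
    and C: "0 \<le> C"
  shows "dist x x' \<le> C * dist (f x) (f x')"
proof -
  define h where "h = inv_into S f"
  have inj: "inj_on f S"
    using low by (fastforce intro!: inj_onI)
  have hf: "h (f x) = x" if "x \<in> S" for x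
    using inj that by (simp add: h_def)
  have "C-lipschitz_on (f ` S) h"
    using low C by (auto intro!: lipschitz_onI simp: hf)
  then obtain G where G: "C-lipschitz_on (closure (f ` S)) G" "\<And>y. y \<in> f ` S \<Longrightarrow> G y = h y"
    using lipschitz_extend_closure by blast
  have clos: "closure (f ` S) = UNIV"
  proof -
    have "y \<in> closure (f ` S)" for y
      unfolding closure_approachable using dense by blast
    then show ?thesis by blast
  qed
  have Glip: "C-lipschitz_on UNIV G" using G(1) by (simp add: clos)
  have Gcont: "continuous_on UNIV G" by (rule lipschitz_on_continuous_on[OF Glip])
  have Gf: "G (f x) = x" if "x \<in> S" for x using G(2) hf that by auto
  have seq: "\<exists>X. (\<forall>n. X n \<in> S) \<and> (\<lambda>n. f (X n)) \<longlonglongrightarrow> y" for y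
  proof -
    have "\<forall>n. \<exists>x\<in>S. dist (f x) y < inverse (real (Suc n))" using dense by simp
    then obtain X where X: "\<And>n. X n \<in> S" "\<And>n. dist (f (X n)) y < inverse (real (Suc n))" by metis
    have "(\<lambda>n. dist (f (X n)) y) \<longlonglongrightarrow> 0"
      by (rule tendsto_sandwich[OF _ _ tendsto_const LIMSEQ_inverse_real_of_nat])
        (use X(2) in \<open>auto intro!: always_eventually less_imp_le\<close>)
    then show ?thesis using X(1) by (auto simp: tendsto_dist_iff[of _ y])
  qed
  have Glim: "X \<longlonglongrightarrow> G y" if "\<And>n. X n \<in> S" "(\<lambda>n. f (X n)) \<longlonglongrightarrow> y" for X y
  proof -
    have "(\<lambda>n. G (f (X n))) \<longlonglongrightarrow> G y"
      using continuous_on_tendsto_compose[OF Gcont that(2)] by simp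
    then show ?thesis by (simp add: Gf that(1))
  qed
  \<comment> \<open>Values of norm above \<open>N\<close> are attained only where \<open>f\<close> is the identity.\<close>
  obtain N where N: "\<And>x. norm x \<le> R \<Longrightarrow> norm (f x) \<le> N"
  proof -
    have "compact (f ` cball 0 R)"
      by (intro compact_continuous_image continuous_on_subset[OF f(1)]) auto
    then obtain N where "\<forall>z\<in>f ` cball 0 R. norm z \<le> N"
      using compact_imp_bounded bounded_iff by blast
    then show thesis by (intro that[of N]) auto
  qed
  have G_far: "G y = y" if "N < norm y" for y
  proof -
    obtain X where X: "\<And>n. X n \<in> S" "(\<lambda>n. f (X n)) \<longlonglongrightarrow> y" using seq[of y] by blast
    have "eventually (\<lambda>n. N < norm (f (X n))) sequentially"
      using tendsto_norm[OF X(2)] \<open>N < norm y\<close> by (rule order_tendstoD)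
    then have "eventually (\<lambda>n. f (X n) = X n) sequentially"
      by (rule eventually_mono) (use N f(2) in \<open>force simp: not_le[symmetric]\<close>)
    then have "X \<longlonglongrightarrow> y" using Lim_transform_eventually[OF X(2)] by simp
    from LIMSEQ_unique[OF Glim[OF X] this] show ?thesis .
  qed
  have surj: "\<exists>y. G y = x" for x
  proof -
    obtain K where K: "\<And>y. norm (y - G y) \<le> K"
    proof -
      have "compact ((\<lambda>y. y - G y) ` cball 0 N)"
        by (intro compact_continuous_image continuous_intros continuous_on_subset[OF Gcont]) auto
      then obtain K where K: "\<forall>z\<in>(\<lambda>y. y - G y) ` cball 0 N. norm z \<le> K"
        using compact_imp_bounded bounded_iff by blast
      have "norm (y - G y) \<le> \<bar>K\<bar>" for y
      proof (cases "N < norm y")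
        case False
        then have "norm (y - G y) \<le> K" using K by auto
        then show ?thesis by linarith
      qed (simp add: G_far)
      then show thesis by (rule that)
    qed
    have "0 \<le> K" using K[of 0] norm_ge_zero order_trans by blast
    have "\<exists>y\<in>cball 0 (norm x + K). G y = x"
    proof (rule brouwer_surjective[of _ _ "{x}"])
      show "continuous_on (cball 0 (norm x + K)) G" by (rule continuous_on_subset[OF Gcont]) simp
      show "x' + (y - G y) \<in> cball 0 (norm x + K)" if "x' \<in> {x}" for x' y
        using that K[of y] norm_triangle_ineq[of x "y - G y"] by simp
      show "cball 0 (norm x + K) \<noteq> {}"
        using add_nonneg_nonneg[OF norm_ge_zero[of x] \<open>0 \<le> K\<close>] by simp
    qed auto
    then show ?thesis by blast
  qed
  have S_dense: "\<exists>X. (\<forall>n. X n \<in> S) \<and> X \<longlonglongrightarrow> x" for x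
    using surj[of x] seq Glim by metis
  have "G (f x) = x" for x
  proof -
    obtain X where X: "\<And>n. X n \<in> S" "X \<longlonglongrightarrow> x" using S_dense by blast
    have "(\<lambda>n. f (X n)) \<longlonglongrightarrow> f x"
      using continuous_on_tendsto_compose[OF f(1) X(2)] by simp
    from LIMSEQ_unique[OF Glim[OF X(1) this] X(2)] show ?thesis .
  qed
  then show ?thesis using lipschitz_onD[OF Glip, of "f x" "f x'"] by simp
qed

section \<open>A Lipschitz map that is critical or has large Jacobian is never critical\<close>

text \<open>A Lipschitz map of the plane that is the identity near infinity, and almost everywhere either
  critical or of Jacobian at least \<open>\<kappa>\<close>. The aim is to show that the first case does not occur
  on a set of positive measure.\<close>
locale lipschitz_dichotomy = bump +
  fixes f :: "real^2 \<Rightarrow> real^2" and L R \<kappa> :: real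
  assumes f_lip: "L-lipschitz_on UNIV f"
    and f_far: "\<And>x. R < norm x \<Longrightarrow> f x = x"
    and \<kappa>_pos: "0 < \<kappa>"
    and dichotomy: "AE x in lborel. (\<forall>i. ddir e1 (\<lambda>x. f x $ i) x = 0 \<and> ddir e2 (\<lambda>x. f x $ i) x = 0)
        \<or> \<kappa> \<le> jac2 (\<lambda>x. f x $ 1) (\<lambda>x. f x $ 2) x"
begin

abbreviation J :: "real^2 \<Rightarrow> real" where "J \<equiv> jac2 (\<lambda>x. f x $ 1) (\<lambda>x. f x $ 2)"

lemma lip_comp: "lip (\<lambda>x. f x $ i)"
  using lipschitz_component[OF f_lip] by blast

lemma J_nonneg_AE: "AE x in lborel. 0 \<le> J x"
  using dichotomy by eventually_elim (use \<kappa>_pos in \<open>auto simp: jac2_def\<close>)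

text \<open>The sign of the permutation that brings the coordinate \<open>k\<close> to the first place; it allows the two
  coordinate directions of the target to be treated together.\<close>
definition sg :: "2 \<Rightarrow> real" where "sg k = (if k = 1 then 1 else - 1)"

lemma jac2_pair: "k \<noteq> l \<Longrightarrow> jac2 (\<lambda>x. f x $ k) (\<lambda>x. f x $ l) x = sg k * J x"
  using exhaust_2[of k] exhaust_2[of l] jac2_swap[of "\<lambda>x. f x $ 2" "\<lambda>x. f x $ 1" x]
  by (auto simp: sg_def)

text \<open>The degree formula for \<open>(f - y) / \<delta>\<close> with its components taken in the order \<open>k\<close>, \<open>l\<close>: the
  sign of the order occurs twice, in the Jacobian and in the degree, and cancels.\<close>
lemma integral_pair:
  fixes k l :: 2
  assumes kl: "k \<noteq> l" and \<delta>: "0 < \<delta>"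
    and a: "lip a" "\<And>t. (a has_real_derivative a' t) (at t)" "\<And>t. \<bar>a t\<bar> \<le> Ma"
    and supp: "\<And>t. c \<le> \<bar>t\<bar> \<Longrightarrow> a t = 0" and c: "1 \<le> c"
  shows "integrable lborel (\<lambda>x. a ((f x $ k - y $ k) / \<delta>) * \<tau> ((f x $ l - y $ l) / \<delta>) * (J x / \<delta>\<^sup>2))" (is "integrable _ ?D")
    and "(\<integral>x. a ((f x $ k - y $ k) / \<delta>) * \<tau> ((f x $ l - y $ l) / \<delta>) * (J x / \<delta>\<^sup>2) \<partial>lborel)
      = (\<integral>z. a ((z::real^2) $ 1) * \<tau> (z $ 2) \<partial>lborel)" (is "_ = ?I")
proof -
  let ?g = "\<lambda>i x. (f x $ i - y $ i) / \<delta>"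
  define A :: "real^2^2" where "A = (\<chi> i j. if i = 1 then (if j = k then 1 / \<delta> else 0) else (if j = l then 1 / \<delta> else 0))"
  define d :: "real^2" where "d = vector [- y $ k / \<delta>, - y $ l / \<delta>]"
  have det: "det A = sg k / \<delta>\<^sup>2"
    using kl exhaust_2[of k] exhaust_2[of l]
    by (auto simp: det_2 A_def sg_def power2_eq_square)
  have sgn_det: "sgn (det A) = sg k" using \<delta> by (auto simp: det sg_def)
  have aff: "(d + A *v x) $ 1 = (x $ k - y $ k) / \<delta>" "(d + A *v x) $ 2 = (x $ l - y $ l) / \<delta>" for x
    using kl exhaust_2[of k] exhaust_2[of l]
    by (auto simp: d_def A_def matrix_vector_mult_def sum_2 diff_divide_distrib)
  have P: "integrable lborel (\<lambda>x. a (?g k x) * \<tau> (?g l x) * jac2 (?g k) (?g l) x)"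
     "(\<integral>x. a (?g k x) * \<tau> (?g l x) * jac2 (?g k) (?g l) x \<partial>lborel) = sgn (det A) * ?I"
  proof -
    have agree: "?g k x = (d + A *v x) $ 1" "?g l x = (d + A *v x) $ 2" if "R < norm x" for x
      using that by (simp_all only: aff f_far)
    have det0: "det A \<noteq> 0" using \<delta> by (simp add: det sg_def)
    have supp2: "a s * \<tau> t = 0" if "2 * c < norm (vector [s, t] :: real^2)" for s t
      using large_coordinate[of c "vector [s, t]"] that supp[of s] bump_0_outside[of t] c by auto
    have G: "lip (?g k)" "lip (?g l)" by (rule lip_rescale[OF lip_comp])+
    note Q = integral_pullback_affine_outside[OF G agree det0
        a lip_T d_T T_bounded lip_continuous[OF lip_bump] supp2]
    show "integrable lborel (\<lambda>x. a (?g k x) * \<tau> (?g l x) * jac2 (?g k) (?g l) x)"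
      by (rule Q(1))
    show "(\<integral>x. a (?g k x) * \<tau> (?g l x) * jac2 (?g k) (?g l) x \<partial>lborel) = sgn (det A) * ?I"
      by (rule Q(2))
  qed
  have eq: "AE x in lborel. sg k * (a (?g k x) * \<tau> (?g l x) * jac2 (?g k) (?g l) x) = ?D x"
    using jac2_rescale_AE[OF lip_comp lip_comp, of \<delta> k "y $ k" l "y $ l"] \<delta>
    by (auto elim!: eventually_mono simp: jac2_pair[OF kl] sg_def)
  have "has_bochner_integral lborel (\<lambda>x. sg k * (a (?g k x) * \<tau> (?g l x) * jac2 (?g k) (?g l) x)) (sg k * (sgn (det A) * ?I))"
    by (rule has_bochner_integral_mult_right) (simp only: P has_bochner_integral_iff simp_thms)
  then have "has_bochner_integral lborel ?D (sg k * (sgn (det A) * ?I))"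
  proof (rule has_bochner_integral_cong_AE[THEN iffD1, rotated 3])
    note [measurable] = lip_measurable[OF a(1)] lip_measurable[OF lip_bump] lip_measurable[OF lip_comp]
      lip_measurable_jac2[OF lip_comp lip_comp] lip_measurable_jac2[OF lip_rescale[OF lip_comp] lip_rescale[OF lip_comp]]
    show "(\<lambda>x. sg k * (a (?g k x) * \<tau> (?g l x) * jac2 (?g k) (?g l) x)) \<in> borel_measurable lborel"
      "?D \<in> borel_measurable lborel" by measurable
  qed (rule eq)
  moreover have "sg k * (sgn (det A) * ?I) = ?I" by (simp add: sgn_det sg_def)
  ultimately have "has_bochner_integral lborel ?D ?I" by (simp only:)
  then show "integrable lborel ?D" "(\<integral>x. ?D x \<partial>lborel) = ?I"
    unfolding has_bochner_integral_iff by blast+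
qed

text \<open>The pullback by \<open>f\<close> of the area form weighted with the bump of size \<open>\<delta>\<close> around \<open>y\<close>. As \<open>\<delta>\<close> tends
  to \<open>0\<close>, its mass \<open>m0\<close> concentrates on the fibre of \<open>f\<close> over \<open>y\<close>.\<close>
definition dens :: "real^2 \<Rightarrow> real \<Rightarrow> real^2 \<Rightarrow> real" where
  "dens y \<delta> x = \<tau> ((f x $ 1 - y $ 1) / \<delta>) * \<tau> ((f x $ 2 - y $ 2) / \<delta>) * (J x / \<delta>\<^sup>2)"

lemma integral_dens:
  assumes "0 < \<delta>"
  shows "integrable lborel (dens y \<delta>)" "(\<integral>x. dens y \<delta> x \<partial>lborel) = m0"
proof -
  have 12: "(1::2) \<noteq> 2" and 11: "(1::real) \<le> 1" by simp_all
  show "integrable lborel (dens y \<delta>)"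
    unfolding dens_def[abs_def]
    by (rule integral_pair(1)[OF 12 assms lip_bump d_bump bump_bounded bump_0_outside 11])
  show "(\<integral>x. dens y \<delta> x \<partial>lborel) = m0"
    unfolding dens_def[abs_def] m0_def
    by (rule integral_pair(2)[OF 12 assms lip_bump d_bump bump_bounded bump_0_outside 11])
qed

lemma dens_nonneg_AE: "AE x in lborel. 0 \<le> dens y \<delta> x"
  using J_nonneg_AE by eventually_elim (simp add: dens_def bump_nonneg)

lemma dens_eq_0:
  assumes "0 < \<delta>" "2 * \<delta> \<le> dist (f x) y"
  shows "dens y \<delta> x = 0"
proof -
  have "\<delta> \<le> \<bar>f x $ 1 - y $ 1\<bar> \<or> \<delta> \<le> \<bar>f x $ 2 - y $ 2\<bar>"
    using large_coordinate[of \<delta> "f x - y"] assms(2) by (simp add: dist_norm)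
  then have "1 \<le> \<bar>(f x $ 1 - y $ 1) / \<delta>\<bar> \<or> 1 \<le> \<bar>(f x $ 2 - y $ 2) / \<delta>\<bar>"
    using assms(1) by (simp add: abs_divide)
  then show ?thesis using bump_0_outside by (auto simp: dens_def)
qed

text \<open>The second condition is total differentiability, stated for the components of \<open>f\<close>.\<close>
definition regular :: "real^2 \<Rightarrow> bool" where
  "regular x \<longleftrightarrow> \<kappa> \<le> J x \<and> (\<forall>i. \<forall>\<epsilon>>0. \<exists>r>0. \<forall>z. norm z < r \<longrightarrow>
    \<bar>f (x + z) $ i - f x $ i - (z $ 1 * ddir e1 (\<lambda>x. f x $ i) x + z $ 2 * ddir e2 (\<lambda>x. f x $ i) x)\<bar> \<le> \<epsilon> * norm z)"

lemma regular_or_critical_AE: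
  "AE x in lborel. regular x \<or> (\<forall>i. ddir e1 (\<lambda>x. f x $ i) x = 0 \<and> ddir e2 (\<lambda>x. f x $ i) x = 0)"
  using dichotomy rademacher_plane[OF lip_comp[of 1]] rademacher_plane[OF lip_comp[of 2]]
  by eventually_elim (auto simp: regular_def forall_2)

text \<open>The density around \<open>y\<close> has positive mass, but critical points carry none of it.\<close>
lemma regular_image_dense:
  assumes \<epsilon>: "0 < \<epsilon>"
  shows "\<exists>x\<in>{x. regular x}. dist (f x) y < \<epsilon>"
proof (rule ccontr)
  assume no: "\<not> ?thesis"
  have "AE x in lborel. dens y (\<epsilon> / 2) x = 0"
    using regular_or_critical_AE
  proof eventually_elim
    case (elim x)
    then show ?case
    proof
      assume "regular x"
      then have "2 * (\<epsilon> / 2) \<le> dist (f x) y" using no by force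
      then show ?thesis using \<epsilon> by (intro dens_eq_0) auto
    qed (simp add: dens_def jac2_def)
  qed
  then have "(\<integral>x. dens y (\<epsilon> / 2) x \<partial>lborel) = 0" by (rule integral_eq_zero_AE)
  then show False using integral_dens(2)[of "\<epsilon> / 2" y] \<epsilon> m0_pos by simp
qed

text \<open>Near a regular point \<open>x0\<close> the map may be deformed to its affine approximation outside a small ball
  without meeting a neighbourhood of \<open>f x0\<close>. The deformed map \<open>ft\<close> has degree one, so the small ball
  carries the entire mass \<open>m0\<close>; the density being nonnegative, none is left elsewhere.\<close>
lemma dens_eq_0_AE_away:
  assumes reg: "regular x0" and \<rho>: "0 < \<rho>"
  shows "\<exists>\<delta>0>0. \<forall>\<delta>. 0 < \<delta> \<longrightarrow> \<delta> < \<delta>0 \<longrightarrow> (AE x in lborel. \<rho> \<le> dist x x0 \<longrightarrow> dens (f x0) \<delta> x = 0)"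
proof -
  define y where "y = f x0"
  \<comment> \<open>The derivative of \<open>f\<close> at \<open>x0\<close>, whose determinant is the Jacobian.\<close>
  define A :: "real^2^2" where "A = (\<chi> i j. if j = 1 then ddir e1 (\<lambda>x. f x $ i) x0 else ddir e2 (\<lambda>x. f x $ i) x0)"
  have A_nth: "(A *v z) $ i = z $ 1 * ddir e1 (\<lambda>x. f x $ i) x0 + z $ 2 * ddir e2 (\<lambda>x. f x $ i) x0" for z i
    by (simp add: A_def matrix_vector_mult_def sum_2 mult.commute)
  have "det A = J x0" by (simp add: det_2 A_def jac2_def)
  then have det: "0 < det A" using reg \<kappa>_pos by (simp add: regular_def)
  obtain m where m: "0 < m" "\<And>z. m * norm z \<le> norm (A *v z)"
  proof -
    have "inj ((*v) A)"
      using det invertible_det_nz[of A] inj_matrix_vector_mult[of A] by force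
    then show thesis
      using linear_inj_bounded_below_pos[of "(*v) A"] that by (auto simp: mult.commute)
  qed
  obtain r where r: "0 < r" "\<And>z. norm z < r \<Longrightarrow> norm (f (x0 + z) - y - A *v z) \<le> m / 2 * norm z"
  proof -
    have "\<exists>r>0. \<forall>z. norm z < r \<longrightarrow> \<bar>f (x0 + z) $ i - y $ i - (A *v z) $ i\<bar> \<le> m / 4 * norm z" for i
    proof -
      have "0 < m / 4" using m(1) by simp
      then show ?thesis using reg unfolding regular_def A_nth y_def by blast
    qed
    then obtain r where r: "\<And>i. 0 < r i"
      "\<And>i z. norm z < r i \<Longrightarrow> \<bar>f (x0 + z) $ i - y $ i - (A *v z) $ i\<bar> \<le> m / 4 * norm z"
      by metis
    have "norm (f (x0 + z) - y - A *v z) \<le> m / 2 * norm z" if "norm z < min (r 1) (r 2)" for z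
      using norm_le_l1_cart[of "f (x0 + z) - y - A *v z"] r(2)[of z 1] r(2)[of z 2] that
      by (simp add: sum_2)
    then show thesis using r(1)[of 1] r(1)[of 2] that[of "min (r 1) (r 2)"] by simp
  qed
  define \<rho>' where "\<rho>' = min \<rho> (r / 2)"
  have \<rho>': "0 < \<rho>'" "\<rho>' \<le> \<rho>" "2 * \<rho>' \<le> r" using \<rho> r(1) by (auto simp: \<rho>'_def)
  \<comment> \<open>A cut-off that equals \<open>1\<close> up to distance \<open>\<rho>'\<close> from \<open>x0\<close> and vanishes from distance \<open>2 * \<rho>' \<le> r\<close> on.\<close>
  define cut where "cut x = max 0 (min 1 (2 - dist x x0 / \<rho>'))" for x
  have cut01: "0 \<le> cut x" "cut x \<le> 1" for x by (auto simp: cut_def)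
  have cut1: "cut x = 1" if "dist x x0 \<le> \<rho>'" for x
    using that \<rho>'(1) by (simp add: cut_def divide_le_eq)
  have cut0: "cut x = 0" if "2 * \<rho>' \<le> dist x x0" for x
    using that \<rho>'(1) by (simp add: cut_def le_divide_eq)
  have lip_cut: "lip cut"
  proof
    show "(1 / \<rho>')-lipschitz_on UNIV cut"
    proof (rule lipschitz_onI)
      fix x x' :: "real^2"
      have *: "\<bar>max 0 (min 1 a) - max 0 (min 1 b)\<bar> \<le> \<bar>a - b\<bar>" for a b :: real
        by (auto simp: max_def min_def)
      have "dist (cut x) (cut x') \<le> \<bar>(2 - dist x x0 / \<rho>') - (2 - dist x' x0 / \<rho>')\<bar>"
        unfolding cut_def dist_real_def by (rule *)
      also have "\<dots> = \<bar>dist x x0 - dist x' x0\<bar> / \<rho>'"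
        using \<rho>'(1) by (simp add: diff_divide_distrib[symmetric] abs_divide abs_minus_commute)
      also have "\<dots> \<le> dist x x' / \<rho>'"
        using \<rho>'(1) abs_dist_diff_le[of x x0 x'] by (intro divide_right_mono) (auto simp: dist_commute)
      finally show "dist (cut x) (cut x') \<le> 1 / \<rho>' * dist x x'" by simp
    qed (use \<rho>' in simp)
  qed
  define c where "c = y - A *v x0"
  define ft where "ft i x = (c + A *v x) $ i + cut x * (f x $ i - (c + A *v x) $ i)" for i x
  have far: "cut x = 0" if "norm x0 + 2 * \<rho>' < norm x" for x
    using that norm_triangle_ineq2[of x x0] by (intro cut0) (simp add: dist_norm)
  have lip_ft: "lip (ft i)" for i
    unfolding ft_def by (intro lip_add lip_affine lip_mult_bounded_support[OF lip_cut far] lip_diff lip_comp)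
  have ft_near: "ft i x = f x $ i" if "x \<in> ball x0 \<rho>'" for i x
    using that by (simp add: ft_def cut1 dist_commute)
  have ft_away: "m / 2 * \<rho>' \<le> norm (vector [ft 1 x, ft 2 x] - y)" if x: "\<rho>' \<le> dist x x0" for x
  proof -
    define z where "z = x - x0"
    have nz: "\<rho>' \<le> norm z" using x by (simp add: z_def dist_norm)
    have aff: "c + A *v x = y + A *v z" by (simp add: c_def z_def matrix_vector_mult_diff_distrib)
    have eq: "vector [ft 1 x, ft 2 x] - y = A *v z + cut x *\<^sub>R (f x - y - A *v z)"
      unfolding ft_def aff by (simp add: vec_eq_iff forall_2 algebra_simps)
    have small: "norm (cut x *\<^sub>R (f x - y - A *v z)) \<le> m / 2 * norm z"
    proof (cases "norm z < r")
      case True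
      have "norm (cut x *\<^sub>R (f x - y - A *v z)) = cut x * norm (f x - y - A *v z)"
        using cut01(1)[of x] by simp
      also have "\<dots> \<le> 1 * norm (f x - y - A *v z)"
        by (rule mult_right_mono[OF cut01(2)]) simp
      also have "\<dots> \<le> m / 2 * norm z" using r(2)[OF True] by (simp add: z_def)
      finally show ?thesis .
    next
      case False
      then have "cut x = 0" using \<rho>'(3) by (intro cut0) (simp add: z_def dist_norm)
      then show ?thesis using m by simp
    qed
    have "m / 2 * \<rho>' \<le> m / 2 * norm z" using nz m by simp
    also have "\<dots> \<le> norm (A *v z) - norm (cut x *\<^sub>R (f x - y - A *v z))"
      using m(2)[of z] small by simp
    also have "\<dots> \<le> norm (A *v z + cut x *\<^sub>R (f x - y - A *v z))"
      by (rule norm_diff_ineq)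
    finally show ?thesis by (simp add: eq)
  qed
  \<comment> \<open>For \<open>\<delta> < \<delta>0\<close> the square of half-width \<open>\<delta>\<close> around \<open>y\<close> contains no value that \<open>ft\<close> takes
    outside the ball.\<close>
  define \<delta>0 where "\<delta>0 = m * \<rho>' / 4"
  have "AE x in lborel. \<rho> \<le> dist x x0 \<longrightarrow> dens y \<delta> x = 0" if \<delta>: "0 < \<delta>" "\<delta> < \<delta>0" for \<delta>
  proof -
    let ?g = "\<lambda>i x. (ft i x - y $ i) / \<delta>"
    let ?E = "\<lambda>x. \<tau> (?g 1 x) * \<tau> (?g 2 x) * jac2 (?g 1) (?g 2) x"
    let ?D = "\<lambda>x. dens y \<delta> x * indicator (ball x0 \<rho>') x"
    define A' where "A' = (1 / \<delta>) *\<^sub>R A"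
    define d where "d = (1 / \<delta>) *\<^sub>R (c - y)"
    have "det A' = det A / \<delta>\<^sup>2" by (simp add: A'_def det_2 power2_eq_square diff_divide_distrib)
    then have det': "det A' \<noteq> 0" "sgn (det A') = 1" using det \<delta> by auto
    have A'_eq: "A' *v x = (1 / \<delta>) *\<^sub>R (A *v x)" for x
      by (simp add: A'_def vec_eq_iff matrix_vector_mult_def sum_distrib_left mult.assoc)
    have agree: "?g i x = (d + A' *v x) $ i" if "norm x0 + 2 * \<rho>' < norm x" for i x
      using far[OF that] by (simp add: ft_def A'_eq d_def diff_divide_distrib add_divide_distrib)
    have lipg: "lip (?g i)" for i by (rule lip_rescale[OF lip_ft])
    have supp: "\<tau> s * \<tau> t = 0" if "2 < norm (vector [s, t] :: real^2)" for s t
      using large_coordinate[of 1 "vector [s, t]"] that bump_0_outside[of s] bump_0_outside[of t] by auto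
    have intE: "(\<integral>x. ?E x \<partial>lborel) = m0"
      using integral_pullback_affine_outside(2)[OF lipg lipg agree agree det'(1) lip_bump d_bump bump_bounded
          lip_T d_T T_bounded lip_continuous[OF lip_bump] supp] det'(2)
      by (simp add: m0_def)
    have \<delta>_ne: "\<delta> \<noteq> 0" using \<delta>(1) by simp
    have eq: "AE x in lborel. ?E x = ?D x"
      using jac2_rescale_AE[OF lip_ft lip_ft \<delta>_ne, of 1 "y $ 1" 2 "y $ 2"]
    proof eventually_elim
      case (elim x)
      show ?case
      proof (cases "x \<in> ball x0 \<rho>'")
        case True
        have "ddir e (ft i) x = ddir e (\<lambda>x. f x $ i) x" for e i
          by (rule ddir_cong(1)[OF open_ball True]) (rule ft_near)
        then have "jac2 (ft 1) (ft 2) x = J x" by (simp add: jac2_def)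
        then show ?thesis using True elim \<delta>(1) by (simp add: ft_near dens_def)
      next
        case False
        then have "\<rho>' \<le> dist x x0" by (simp add: dist_commute)
        from ft_away[OF this] have "2 * \<delta> \<le> norm (vector [ft 1 x, ft 2 x] - y)"
          using \<delta>(2) by (simp add: \<delta>0_def)
        from large_coordinate[OF this] have "\<delta> \<le> \<bar>ft 1 x - y $ 1\<bar> \<or> \<delta> \<le> \<bar>ft 2 x - y $ 2\<bar>" by simp
        then have "1 \<le> \<bar>?g 1 x\<bar> \<or> 1 \<le> \<bar>?g 2 x\<bar>" using \<delta>(1) by (simp add: abs_divide)
        then have "\<tau> (?g 1 x) * \<tau> (?g 2 x) = 0" using bump_0_outside by auto
        then show ?thesis using False by simp
      qed
    qed
    have intD: "integrable lborel (dens y \<delta>)" "(\<integral>x. dens y \<delta> x \<partial>lborel) = m0"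
      using integral_dens[OF \<delta>(1)] by auto
    have intDb: "integrable lborel ?D"
      using integrable_real_mult_indicator[OF _ intD(1), of "ball x0 \<rho>'"] by (simp add: mult.commute)
    have "(\<integral>x. ?D x \<partial>lborel) = m0"
    proof -
      have "?E \<in> borel_measurable lborel"
      proof -
        note [measurable] = lip_measurable[OF lip_bump] lip_measurable[OF lip_ft] lip_measurable_jac2[OF lipg lipg]
        show ?thesis by measurable
      qed
      then show ?thesis
        using integral_cong_AE[OF _ _ eq] intDb intE by (simp add: borel_measurable_integrable)
    qed
    then have "(\<integral>x. dens y \<delta> x - ?D x \<partial>lborel) = 0"
      using intD intDb by simp
    moreover have "AE x in lborel. 0 \<le> dens y \<delta> x - ?D x"
      using dens_nonneg_AE[of y \<delta>] by eventually_elim (simp add: indicator_def)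
    moreover have "integrable lborel (\<lambda>x. dens y \<delta> x - ?D x)"
      using intD intDb by simp
    ultimately have "AE x in lborel. dens y \<delta> x - ?D x = 0"
      by (subst (asm) integral_nonneg_eq_0_iff_AE)
    then show ?thesis
      by eventually_elim (use \<rho>'(2) in \<open>auto simp: indicator_def dist_commute\<close>)
  qed
  moreover have "0 < \<delta>0" using m \<rho>' by (simp add: \<delta>0_def)
  ultimately show ?thesis unfolding y_def by blast
qed

lemma integrable_mult_dens:
  assumes \<psi>: "lip \<psi>" and \<delta>: "0 < \<delta>"
  shows "integrable lborel (\<lambda>x. \<psi> x * dens y \<delta> x)"
proof -
  \<comment> \<open>Outside the ball of radius \<open>R'\<close> the map is the identity and its values miss the bump around \<open>y\<close>.\<close>
  define R' where "R' = \<bar>R\<bar> + norm y + 2 * \<delta>"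
  have 0: "dens y \<delta> x = 0" if "R' < norm x" for x
  proof (rule dens_eq_0[OF \<delta>])
    have "R < norm x" using that \<delta> unfolding R'_def by (smt (verit) norm_ge_zero)
    then have "dist (f x) y = norm (x - y)" by (simp add: f_far dist_norm)
    then show "2 * \<delta> \<le> dist (f x) y"
      using that norm_triangle_ineq2[of x y] by (simp add: R'_def)
  qed
  have "compact (\<psi> ` cball 0 R')"
    by (intro compact_continuous_image continuous_on_subset[OF lip_continuous[OF \<psi>]]) auto
  then obtain C where C: "\<forall>z\<in>\<psi> ` cball 0 R'. norm z \<le> C"
    using compact_imp_bounded bounded_iff by blast
  have "integrable lborel (\<lambda>x. C * dens y \<delta> x)"
    using integral_dens(1)[OF \<delta>] by simp
  then show ?thesis
  proof (rule Bochner_Integration.integrable_bound)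
    show "(\<lambda>x. \<psi> x * dens y \<delta> x) \<in> borel_measurable lborel"
      using lip_measurable[OF \<psi>] borel_measurable_integrable[OF integral_dens(1)[OF \<delta>]] by simp
    have "norm (\<psi> x * dens y \<delta> x) \<le> norm (C * dens y \<delta> x)" for x
    proof (cases "R' < norm x")
      case False
      then have "\<psi> x \<in> \<psi> ` cball 0 R'" by (intro imageI) simp
      then have "norm (\<psi> x) \<le> C" using C by blast
      then have "\<bar>\<psi> x\<bar> \<le> \<bar>C\<bar>" by simp
      then show ?thesis by (simp add: abs_mult mult_right_mono)
    qed (simp add: 0)
    then show "AE x in lborel. norm (\<psi> x * dens y \<delta> x) \<le> norm (C * dens y \<delta> x)" by simp
  qed
qed

text \<open>Up to the factor \<open>m0\<close>, the \<open>j\<close>-th coordinate of an approximate preimage of \<open>y\<close>.\<close>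
definition mean :: "2 \<Rightarrow> real^2 \<Rightarrow> real \<Rightarrow> real" where
  "mean j y \<delta> = (\<integral>x. x $ j * dens y \<delta> x \<partial>lborel)"

lemma mean_at_regular:
  assumes reg: "regular x0" and \<rho>: "0 < \<rho>"
  shows "\<exists>\<delta>0>0. \<forall>\<delta>. 0 < \<delta> \<longrightarrow> \<delta> < \<delta>0 \<longrightarrow> \<bar>mean j (f x0) \<delta> - x0 $ j * m0\<bar> \<le> \<rho> * m0"
proof -
  obtain \<delta>0 where \<delta>0: "0 < \<delta>0"
    "\<And>\<delta>. 0 < \<delta> \<Longrightarrow> \<delta> < \<delta>0 \<Longrightarrow> AE x in lborel. \<rho> \<le> dist x x0 \<longrightarrow> dens (f x0) \<delta> x = 0"
    using dens_eq_0_AE_away[OF reg \<rho>] by blast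
  have "\<bar>mean j (f x0) \<delta> - x0 $ j * m0\<bar> \<le> \<rho> * m0" if \<delta>: "0 < \<delta>" "\<delta> < \<delta>0" for \<delta>
  proof -
    let ?d = "dens (f x0) \<delta>"
    have int: "integrable lborel ?d" "(\<integral>x. ?d x \<partial>lborel) = m0" using integral_dens[OF \<delta>(1)] by auto
    have intj: "integrable lborel (\<lambda>x. x $ j * ?d x)" by (rule integrable_mult_dens[OF lip_coord \<delta>(1)])
    have i2: "integrable lborel (\<lambda>x. x $ j * ?d x - x0 $ j * ?d x)" using intj int(1) by simp
    have "mean j (f x0) \<delta> - x0 $ j * m0 = (\<integral>x. x $ j * ?d x - x0 $ j * ?d x \<partial>lborel)"
      using intj int by (simp add: mean_def)
    then have "\<bar>mean j (f x0) \<delta> - x0 $ j * m0\<bar> = norm (\<integral>x. x $ j * ?d x - x0 $ j * ?d x \<partial>lborel)" by simp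
    also have "\<dots> \<le> (\<integral>x. norm (x $ j * ?d x - x0 $ j * ?d x) \<partial>lborel)"
      by (rule integral_norm_bound)
    also have "\<dots> \<le> (\<integral>x. \<rho> * ?d x \<partial>lborel)"
    proof (rule integral_mono_AE)
      show "integrable lborel (\<lambda>x. norm (x $ j * ?d x - x0 $ j * ?d x))" by (rule integrable_norm[OF i2])
      show "integrable lborel (\<lambda>x. \<rho> * ?d x)" using int(1) by simp
      show "AE x in lborel. norm (x $ j * ?d x - x0 $ j * ?d x) \<le> \<rho> * ?d x"
        using \<delta>0(2)[OF \<delta>] dens_nonneg_AE[of "f x0" \<delta>]
      proof eventually_elim
        case (elim x)
        have "norm (x $ j * ?d x - x0 $ j * ?d x) = \<bar>(x - x0) $ j\<bar> * ?d x"
          using elim(2) by (simp add: left_diff_distrib[symmetric] abs_mult)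
        also have "\<dots> \<le> \<rho> * ?d x"
        proof (cases "\<rho> \<le> dist x x0")
          case False
          then have "\<bar>(x - x0) $ j\<bar> \<le> \<rho>"
            using component_le_norm_cart[of "x - x0" j] by (simp add: dist_norm)
          then show ?thesis using elim(2) by (rule mult_right_mono)
        qed (use elim(1) in simp)
        finally show ?case .
      qed
    qed
    also have "\<dots> = \<rho> * m0" using int by simp
    finally show ?thesis .
  qed
  then show ?thesis using \<delta>0(1) by blast
qed

definition shift_const :: real where "shift_const = 4 * M * L / \<kappa>"

lemma shift_const_nonneg: "0 \<le> shift_const"
  using T_bounded[of 0] \<kappa>_pos lipschitz_on_nonneg[OF f_lip] by (simp add: shift_const_def)

text \<open>Up to sign, the difference of the densities at \<open>y\<close> and at its translate is the Jacobian of
  \<open>\<Theta>\<close> and the other rescaled component of \<open>f\<close>. Integrating by parts moves the derivative from \<open>\<Theta>\<close> to the coordinate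
  \<open>x\<^sub>j\<close>, which leaves a single first derivative of \<open>f\<close> against \<open>\<Theta>\<close>. By the dichotomy
  this derivative is at most \<open>L / \<kappa>\<close> times the Jacobian, and the integral of \<open>\<Theta>\<close> against the
  Jacobian is given by the degree formula.\<close>
lemma mean_shift_le:
  fixes k l j :: 2
  assumes kl: "k \<noteq> l" and \<delta>: "0 < \<delta>" and s: "0 \<le> s"
  shows "\<bar>mean j (y + s *\<^sub>R axis k 1) \<delta> - mean j y \<delta>\<bar> \<le> shift_const * (s + 2 * \<delta>)"
proof -
  define \<sigma> where "\<sigma> = s / \<delta>"
  have \<sigma>: "0 \<le> \<sigma>" using s \<delta> by (simp add: \<sigma>_def)
  define y' where "y' = y + s *\<^sub>R axis k 1"
  define a where "a t = T t - T (t - \<sigma>)" for t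
  define a' where "a' t = \<tau> t - \<tau> (t - \<sigma>)" for t
  have lipshift: "lip (\<lambda>t. t - \<sigma>)" by (intro lip_diff lip_const) (use lipschitz_on_id in blast)
  have lip_a: "lip a" unfolding a_def by (intro lip_diff lip_T lip_compose[OF lip_T lipshift])
  have d_a: "(a has_real_derivative a' t) (at t)" for t
    unfolding a_def a'_def by (auto intro!: derivative_eq_intros DERIV_chain2[OF d_T])
  have a_bdd: "\<bar>a t\<bar> \<le> 2 * M" for t
    using T_bounded[of t] T_bounded[of "t - \<sigma>"] unfolding a_def by linarith
  have a_nonneg: "0 \<le> a t" for t using T_mono[of "t - \<sigma>" t] \<sigma> by (simp add: a_def)
  have a_supp: "a t = 0" if "1 + \<sigma> \<le> \<bar>t\<bar>" for t
    using that \<sigma> T_const_outside[of t] T_const_outside[of "t - \<sigma>"]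
    by (cases "0 \<le> t") (auto simp: a_def sgn_if)
  let ?g1 = "\<lambda>x. (f x $ k - y $ k) / \<delta>" and ?g2 = "\<lambda>x. (f x $ l - y $ l) / \<delta>"
  let ?w = "\<lambda>x. J x / \<delta>\<^sup>2"
  have lipg: "lip ?g1" "lip ?g2" by (rule lip_rescale[OF lip_comp])+
  define \<Theta> where "\<Theta> x = a (?g1 x) * \<tau> (?g2 x)" for x
  have lip_\<Theta>: "lip \<Theta>"
    unfolding \<Theta>_def by (rule lip_mult_bounded[OF lip_compose[OF lip_a lipg(1)] a_bdd lip_compose[OF lip_bump lipg(2)] bump_bounded])
  have \<Theta>_nonneg: "0 \<le> \<Theta> x" for x by (simp add: \<Theta>_def a_nonneg bump_nonneg)
  \<comment> \<open>In the rescaled target, \<open>\<Theta>\<close> lives on values with both coordinates at most \<open>1 + \<sigma>\<close> in modulus.\<close>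
  define R' where "R' = \<bar>R\<bar> + norm y + 2 * ((1 + \<sigma>) * \<delta>)"
  have \<Theta>_0: "\<Theta> x = 0" if "R' < norm x" for x
  proof -
    have "0 \<le> (1 + \<sigma>) * \<delta>" using \<sigma> \<delta> by simp
    then have "R < norm x" using that norm_ge_zero[of y] unfolding R'_def by linarith
    then have fx: "f x = x" by (rule f_far)
    have "2 * ((1 + \<sigma>) * \<delta>) \<le> norm (x - y)"
      using that norm_triangle_ineq2[of x y] unfolding R'_def by linarith
    from large_coordinate[OF this] have "(1 + \<sigma>) * \<delta> \<le> \<bar>x $ k - y $ k\<bar> \<or> (1 + \<sigma>) * \<delta> \<le> \<bar>x $ l - y $ l\<bar>"
      using kl exhaust_2[of k] exhaust_2[of l] by auto
    then have "1 + \<sigma> \<le> \<bar>?g1 x\<bar> \<or> 1 + \<sigma> \<le> \<bar>?g2 x\<bar>"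
      using \<delta> by (simp add: fx abs_divide pos_le_divide_eq)
    then show ?thesis using a_supp bump_0_outside[of "?g2 x"] \<sigma> by (auto simp: \<Theta>_def)
  qed
  define P where "P x = \<Theta> x * x $ j" for x
  have lip_P: "lip P" unfolding P_def by (rule lip_mult_bounded_support[OF lip_\<Theta> \<Theta>_0 lip_coord])
  have P_0: "P x = 0" if "R' < norm x" for x using \<Theta>_0[OF that] by (simp add: P_def)
  note intP = integral_jac2_eq_0[OF lip_P lipg(2) P_0]
  have rescale: "AE x in lborel. jac2 ?g1 ?g2 x = sg k * ?w x"
    using jac2_rescale_AE[OF lip_comp lip_comp, of \<delta> k "y $ k" l "y $ l"] \<delta>
    by (auto elim!: eventually_mono simp: jac2_pair[OF kl])
  have dens_y: "dens y \<delta> x = \<tau> (?g1 x) * \<tau> (?g2 x) * ?w x" for x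
    using kl exhaust_2[of k] exhaust_2[of l] by (auto simp: dens_def)
  have dens_y': "dens y' \<delta> x = \<tau> (?g1 x - \<sigma>) * \<tau> (?g2 x) * ?w x" for x
  proof -
    have "(f x $ k - y' $ k) / \<delta> = ?g1 x - \<sigma>" "(f x $ l - y' $ l) / \<delta> = ?g2 x"
      using kl by (simp_all add: y'_def \<sigma>_def axis_def diff_divide_distrib add_divide_distrib)
    moreover have "dens y' \<delta> x = \<tau> ((f x $ k - y' $ k) / \<delta>) * \<tau> ((f x $ l - y' $ l) / \<delta>) * ?w x"
      using kl exhaust_2[of k] exhaust_2[of l] by (auto simp: dens_def)
    ultimately show ?thesis by (simp only:)
  qed
  let ?Q = "\<lambda>x. \<Theta> x * jac2 (\<lambda>x. x $ j) ?g2 x"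
  have split: "AE x in lborel. jac2 P ?g2 x = sg k * (x $ j * dens y \<delta> x - x $ j * dens y' \<delta> x) + ?Q x"
    using rescale lip_diff_along_AE[OF lipg(1), of e1] lip_diff_along_AE[OF lipg(1), of e2]
      lip_diff_along_AE[OF lipg(2), of e1] lip_diff_along_AE[OF lipg(2), of e2]
  proof eventually_elim
    case (elim x)
    have dP: "ddir e P x = (a' (?g1 x) * ddir e ?g1 x * \<tau> (?g2 x) + \<tau>' (?g2 x) * ddir e ?g2 x * a (?g1 x)) * x $ j
        + ddir e (\<lambda>x. x $ j) x * \<Theta> x"
      if d: "diff_along ?g1 e x" "diff_along ?g2 e x" for e
    proof -
      note d1 = ddir_compose[OF d(1) d_a] and d2 = ddir_compose[OF d(2) d_bump]
      note d3 = ddir_mult[OF d1(1) d2(1)]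
      show ?thesis
        unfolding P_def \<Theta>_def using ddir_mult(2)[OF d3(1) ddir_coord(2)] by (simp only: d3(2) d1(2) d2(2))
    qed
    have "jac2 P ?g2 x = x $ j * (a' (?g1 x) * \<tau> (?g2 x) * jac2 ?g1 ?g2 x) + ?Q x"
      unfolding jac2_def dP[OF elim(2,4)] dP[OF elim(3,5)] by (simp add: algebra_simps)
    also have "x $ j * (a' (?g1 x) * \<tau> (?g2 x) * jac2 ?g1 ?g2 x) = sg k * (x $ j * dens y \<delta> x - x $ j * dens y' \<delta> x)"
      unfolding elim(1) dens_y dens_y' a'_def by (simp add: algebra_simps)
    finally show ?case .
  qed
  have Q_le: "AE x in lborel. \<bar>?Q x\<bar> \<le> (L / \<kappa> * \<delta>) * (\<Theta> x * ?w x)"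
    using dichotomy J_nonneg_AE lip_diff_along_AE[OF lip_comp, of l e1] lip_diff_along_AE[OF lip_comp, of l e2]
  proof eventually_elim
    case (elim x)
    have g2: "ddir e ?g2 x = ddir e (\<lambda>x. f x $ l) x / \<delta>" if "diff_along (\<lambda>x. f x $ l) e x" for e
    proof -
      have "((\<lambda>t. (t - y $ l) / \<delta>) has_real_derivative 1 / \<delta>) (at s)" for s
        using \<delta> by (auto intro!: derivative_eq_intros)
      from ddir_compose(2)[OF that this] show ?thesis by simp
    qed
    have "\<bar>jac2 (\<lambda>x. x $ j) ?g2 x\<bar> \<le> L / \<kappa> * \<delta> * ?w x"
      using elim(1)
    proof
      assume "\<forall>i. ddir e1 (\<lambda>x. f x $ i) x = 0 \<and> ddir e2 (\<lambda>x. f x $ i) x = 0"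
      then have "jac2 (\<lambda>x. x $ j) ?g2 x = 0" using elim(3,4) by (simp add: jac2_def g2)
      then show ?thesis
        using elim(2) \<kappa>_pos \<delta> lipschitz_on_nonneg[OF f_lip] by simp
    next
      assume J: "\<kappa> \<le> J x"
      have D: "\<bar>ddir e1 (\<lambda>x. f x $ l) x\<bar> \<le> L" "\<bar>ddir e2 (\<lambda>x. f x $ l) x\<bar> \<le> L"
        using abs_ddir_le[OF lipschitz_component[OF f_lip], of e1 l x] abs_ddir_le[OF lipschitz_component[OF f_lip], of e2 l x] by simp_all
      have "\<bar>jac2 (\<lambda>x. x $ j) ?g2 x\<bar> \<le> L / \<delta>"
        using exhaust_2[of j] D elim(3,4) \<delta>
        by (auto simp: jac2_def ddir_coord g2 abs_divide divide_right_mono)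
      also have "\<dots> = L / \<kappa> * \<delta> * (\<kappa> / \<delta>\<^sup>2)"
        using \<delta> \<kappa>_pos by (simp add: power2_eq_square)
      also have "\<dots> \<le> L / \<kappa> * \<delta> * ?w x"
        using J \<delta> \<kappa>_pos lipschitz_on_nonneg[OF f_lip] by (intro mult_left_mono divide_right_mono) auto
      finally show ?thesis .
    qed
    then have "\<Theta> x * \<bar>jac2 (\<lambda>x. x $ j) ?g2 x\<bar> \<le> \<Theta> x * (L / \<kappa> * \<delta> * ?w x)"
      by (rule mult_left_mono) (rule \<Theta>_nonneg)
    then show ?case using \<Theta>_nonneg[of x] by (simp add: abs_mult mult_ac)
  qed
  have int_y: "integrable lborel (\<lambda>x. x $ j * dens y \<delta> x)" "integrable lborel (\<lambda>x. x $ j * dens y' \<delta> x)"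
    by (rule integrable_mult_dens[OF lip_coord \<delta>])+
  have Q_meas: "?Q \<in> borel_measurable lborel"
    using lip_measurable[OF lip_\<Theta>] lip_measurable_jac2[OF lip_coord[of j] lipg(2)] by simp
  have int_Q': "has_bochner_integral lborel (\<lambda>x. jac2 P ?g2 x - sg k * (x $ j * dens y \<delta> x - x $ j * dens y' \<delta> x))
      (0 - sg k * (mean j y \<delta> - mean j y' \<delta>))"
    using intP int_y
    by (intro has_bochner_integral_diff has_bochner_integral_mult_right)
       (auto simp: has_bochner_integral_iff mean_def)
  have "has_bochner_integral lborel ?Q (0 - sg k * (mean j y \<delta> - mean j y' \<delta>))"
  proof (rule has_bochner_integral_cong_AE[THEN iffD1, OF _ Q_meas _ int_Q'])
    show "(\<lambda>x. jac2 P ?g2 x - sg k * (x $ j * dens y \<delta> x - x $ j * dens y' \<delta> x)) \<in> borel_measurable lborel"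
      using int_Q' by (simp only: has_bochner_integral_iff borel_measurable_integrable)
    show "AE x in lborel. jac2 P ?g2 x - sg k * (x $ j * dens y \<delta> x - x $ j * dens y' \<delta> x) = ?Q x"
      using split by eventually_elim simp
  qed
  then have intQ: "integrable lborel ?Q" "(\<integral>x. ?Q x \<partial>lborel) = - (sg k * (mean j y \<delta> - mean j y' \<delta>))"
    by (simp_all add: has_bochner_integral_iff)
  have c1: "1 \<le> 1 + \<sigma>" using \<sigma> by simp
  note strip = integral_pair[OF kl \<delta> lip_a d_a a_bdd a_supp c1, of y]
  have "\<bar>mean j y' \<delta> - mean j y \<delta>\<bar> = \<bar>\<integral>x. ?Q x \<partial>lborel\<bar>"
    by (simp add: intQ(2) sg_def abs_minus_commute)
  also have "\<dots> \<le> (\<integral>x. \<bar>?Q x\<bar> \<partial>lborel)"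
    using integral_norm_bound[of lborel ?Q] by simp
  also have "\<dots> \<le> (\<integral>x. (L / \<kappa> * \<delta>) * (\<Theta> x * ?w x) \<partial>lborel)"
    by (intro integral_mono_AE[OF integrable_abs[OF intQ(1)] _ Q_le] integrable_mult_right strip(1)[folded \<Theta>_def])
  also have "\<dots> = (L / \<kappa> * \<delta>) * (\<integral>z. a ((z::real^2) $ 1) * \<tau> (z $ 2) \<partial>lborel)"
  proof -
    have "(\<integral>x. \<Theta> x * ?w x \<partial>lborel) = (\<integral>z. a ((z::real^2) $ 1) * \<tau> (z $ 2) \<partial>lborel)"
      unfolding \<Theta>_def by (rule strip(2))
    then show ?thesis by (simp only: integral_mult_right_zero)
  qed
  also have "\<dots> \<le> (L / \<kappa> * \<delta>) * (4 * M * (\<sigma> + 2))"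
    using integral_strip_le[OF \<sigma>] \<kappa>_pos \<delta> lipschitz_on_nonneg[OF f_lip]
    by (intro mult_left_mono) (simp_all add: a_def)
  also have "\<dots> = shift_const * (s + 2 * \<delta>)"
    using \<delta> \<kappa>_pos by (simp add: shift_const_def \<sigma>_def field_simps)
  finally show ?thesis by (simp add: y'_def)
qed

lemma mean_lipschitz:
  assumes \<delta>: "0 < \<delta>"
  shows "\<bar>mean j y' \<delta> - mean j y \<delta>\<bar> \<le> shift_const * (2 * dist y y' + 4 * \<delta>)"
proof -
  have abs_shift: "\<bar>mean j (z + s *\<^sub>R axis k 1) \<delta> - mean j z \<delta>\<bar> \<le> shift_const * (\<bar>s\<bar> + 2 * \<delta>)" for z s k
  proof -
    obtain l :: 2 where kl: "k \<noteq> l" by (metis exhaust_2 zero_neq_one one_neq_zero num1_eq_iff)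
    show ?thesis
    proof (cases "0 \<le> s")
      case True
      then show ?thesis using mean_shift_le[OF kl \<delta> True, of j z] by simp
    next
      case False
      then show ?thesis
        using mean_shift_le[OF kl \<delta>, of "- s" j "z + s *\<^sub>R axis k 1"] by (simp add: abs_minus_commute)
    qed
  qed
  define s t where "s = y' $ 1 - y $ 1" and "t = y' $ 2 - y $ 2"
  have "\<bar>s\<bar> \<le> dist y y'" "\<bar>t\<bar> \<le> dist y y'"
    using component_le_norm_cart[of "y' - y" 1] component_le_norm_cart[of "y' - y" 2]
    by (simp_all add: s_def t_def dist_norm norm_minus_commute)
  then have "shift_const * (\<bar>s\<bar> + 2 * \<delta>) + shift_const * (\<bar>t\<bar> + 2 * \<delta>) \<le> shift_const * (2 * dist y y' + 4 * \<delta>)"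
    unfolding distrib_left[symmetric] using shift_const_nonneg by (intro mult_left_mono) auto
  moreover have "y' = (y + s *\<^sub>R axis 1 1) + t *\<^sub>R axis 2 1"
    by (simp add: vec_eq_iff forall_2 s_def t_def axis_def)
  ultimately show ?thesis
    using abs_shift[of y s 1] abs_shift[of "y + s *\<^sub>R axis 1 1" t 2] by simp
qed

lemma lower_lipschitz_on_regular:
  assumes x: "regular x" and x': "regular x'"
  shows "dist x x' \<le> 4 * shift_const / m0 * dist (f x) (f x')"
proof -
  let ?d = "dist (f x) (f x')"
  have comp: "\<bar>x $ j - x' $ j\<bar> \<le> 2 * shift_const / m0 * ?d" for j
  proof -
    have "\<bar>x $ j - x' $ j\<bar> * m0 \<le> 2 * shift_const * ?d"
    proof (rule field_le_epsilon)
      fix e :: real assume e: "0 < e"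
      define \<rho> where "\<rho> = e / (4 * m0)"
      have \<rho>: "0 < \<rho>" using e m0_pos by (simp add: \<rho>_def)
      obtain a where a: "0 < a" "\<And>\<delta>. 0 < \<delta> \<Longrightarrow> \<delta> < a \<Longrightarrow> \<bar>mean j (f x) \<delta> - x $ j * m0\<bar> \<le> \<rho> * m0"
        using mean_at_regular[OF x \<rho>] by blast
      obtain b where b: "0 < b" "\<And>\<delta>. 0 < \<delta> \<Longrightarrow> \<delta> < b \<Longrightarrow> \<bar>mean j (f x') \<delta> - x' $ j * m0\<bar> \<le> \<rho> * m0"
        using mean_at_regular[OF x' \<rho>] by blast
      define \<delta> where "\<delta> = min (min a b / 2) (e / (8 * (shift_const + 1)))"
      have \<delta>: "0 < \<delta>" "\<delta> < a" "\<delta> < b" using a b e shift_const_nonneg by (auto simp: \<delta>_def)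
      have "shift_const * \<delta> \<le> shift_const * (e / (8 * (shift_const + 1)))"
        using shift_const_nonneg by (intro mult_left_mono) (auto simp: \<delta>_def)
      also have "\<dots> \<le> e / 8" using shift_const_nonneg e by (simp add: field_simps)
      finally have small: "shift_const * \<delta> \<le> e / 8" .
      have "x $ j * m0 - x' $ j * m0 = (x $ j - x' $ j) * m0" by (simp add: algebra_simps)
      then have "\<bar>x $ j - x' $ j\<bar> * m0 = \<bar>x $ j * m0 - x' $ j * m0\<bar>"
        using m0_pos by (simp add: abs_mult)
      also have "\<dots> \<le> 2 * (\<rho> * m0) + shift_const * (2 * ?d + 4 * \<delta>)"
        using a(2)[OF \<delta>(1,2)] b(2)[OF \<delta>(1,3)] mean_lipschitz[OF \<delta>(1), of j "f x'" "f x"] by linarith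
      also have "\<dots> = e / 2 + 2 * shift_const * ?d + 4 * (shift_const * \<delta>)"
        using m0_pos by (simp add: \<rho>_def algebra_simps)
      also have "\<dots> \<le> 2 * shift_const * ?d + e" using small by simp
      finally show "\<bar>x $ j - x' $ j\<bar> * m0 \<le> 2 * shift_const * ?d + e" .
    qed
    then show ?thesis using m0_pos by (simp add: field_simps)
  qed
  have "dist x x' \<le> \<bar>x $ 1 - x' $ 1\<bar> + \<bar>x $ 2 - x' $ 2\<bar>"
    using norm_le_l1_cart[of "x - x'"] by (simp add: dist_norm sum_2)
  also have "\<dots> \<le> 2 * (2 * shift_const / m0 * ?d)" using comp[of 1] comp[of 2] by simp
  finally show ?thesis by simp
qed

text \<open>A critical point would violate the lower Lipschitz bound along the first axis.\<close>
theorem jacobian_ge_AE: "AE x in lborel. \<kappa> \<le> J x"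
proof -
  define C where "C = 4 * shift_const / m0"
  have C: "0 \<le> C" using shift_const_nonneg m0_pos by (simp add: C_def)
  have low: "dist x x' \<le> C * dist (f x) (f x')" for x x'
  proof (rule lower_lipschitz_of_dense[of f R "{x. regular x}" C])
    show "continuous_on UNIV f" by (rule lipschitz_on_continuous_on[OF f_lip])
  qed (use f_far C regular_image_dense lower_lipschitz_on_regular in \<open>auto simp: C_def\<close>)
  show ?thesis
    using dichotomy lip_diff_along_AE[OF lip_comp, of 1 e1] lip_diff_along_AE[OF lip_comp, of 2 e1]
  proof eventually_elim
    case (elim x)
    have "\<not> (\<forall>i. ddir e1 (\<lambda>x. f x $ i) x = 0 \<and> ddir e2 (\<lambda>x. f x $ i) x = 0)"
    proof
      assume crit: "\<forall>i. ddir e1 (\<lambda>x. f x $ i) x = 0 \<and> ddir e2 (\<lambda>x. f x $ i) x = 0"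
      define q where "q i = slope_along (\<lambda>x. f x $ i) e1 x" for i
      have "(q 1 \<longlongrightarrow> 0) (at 0)" "(q 2 \<longlongrightarrow> 0) (at 0)"
        using slope_tendsto_ddir[OF elim(2)] slope_tendsto_ddir[OF elim(3)] crit by (simp_all add: q_def)
      then have "((\<lambda>t. C * (\<bar>q 1 t\<bar> + \<bar>q 2 t\<bar>)) \<longlongrightarrow> C * (\<bar>0\<bar> + \<bar>0\<bar>)) (at 0)"
        by (intro tendsto_intros)
      then have "eventually (\<lambda>t. C * (\<bar>q 1 t\<bar> + \<bar>q 2 t\<bar>) < 1) (at 0)"
        by (rule order_tendstoD) simp
      then obtain r where r: "0 < r" "\<And>t. t \<noteq> 0 \<Longrightarrow> \<bar>t\<bar> < r \<Longrightarrow> C * (\<bar>q 1 t\<bar> + \<bar>q 2 t\<bar>) < 1"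
        unfolding eventually_at by (auto simp: dist_real_def)
      define t where "t = r / 2"
      have t: "0 < t" "C * (\<bar>q 1 t\<bar> + \<bar>q 2 t\<bar>) < 1" using r(1) r(2)[of t] by (auto simp: t_def)
      let ?x = "x + t *\<^sub>R e1"
      have "t = dist ?x x" using t(1) by (simp add: dist_norm)
      also have "\<dots> \<le> C * dist (f ?x) (f x)" by (rule low)
      also have "\<dots> \<le> C * (\<bar>f ?x $ 1 - f x $ 1\<bar> + \<bar>f ?x $ 2 - f x $ 2\<bar>)"
        using norm_le_l1_cart[of "f ?x - f x"] C by (intro mult_left_mono) (simp_all add: dist_norm sum_2)
      also have "\<dots> = C * (\<bar>q 1 t\<bar> + \<bar>q 2 t\<bar>) * t"
        using t(1) by (simp add: q_def abs_divide field_simps)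
      also have "\<dots> < 1 * t" using t by (intro mult_strict_right_mono)
      finally show False by simp
    qed
    then show ?case using elim(1) by blast
  qed
qed

end

theorem lipschitz_map_no_critical_set:
  fixes f :: "real^2 \<Rightarrow> real^2"
  assumes "L-lipschitz_on UNIV f" "\<And>x. R < norm x \<Longrightarrow> f x = x" "0 < \<kappa>"
    and "AE x in lborel. (\<forall>i. ddir e1 (\<lambda>x. f x $ i) x = 0 \<and> ddir e2 (\<lambda>x. f x $ i) x = 0)
        \<or> \<kappa> \<le> jac2 (\<lambda>x. f x $ 1) (\<lambda>x. f x $ 2) x"
  shows "AE x in lborel. \<kappa> \<le> jac2 (\<lambda>x. f x $ 1) (\<lambda>x. f x $ 2) x"
proof -
  obtain \<tau> \<tau>' T :: "real \<Rightarrow> real" and M :: real where "bump \<tau> \<tau>' T M"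
    by (rule obtain_bump) (rule that, unfold_locales)
  then interpret lipschitz_dichotomy \<tau> \<tau>' T M f L R \<kappa>
    by (intro lipschitz_dichotomy.intro lipschitz_dichotomy_axioms.intro assms)
  show ?thesis by (rule jacobian_ge_AE)
qed

section \<open>The overdetermined system\<close>

text \<open>A segment that leaves \<open>\<Omega>\<close> meets the frontier, where both branches agree.\<close>
lemma lipschitz_extend_by_id:
  fixes w :: "'a::euclidean_space \<Rightarrow> 'a"
  assumes w: "L-lipschitz_on (closure \<Omega>) w" and bd: "\<And>x. x \<in> frontier \<Omega> \<Longrightarrow> w x = x"
  shows "(max L 1)-lipschitz_on UNIV (\<lambda>x. if x \<in> \<Omega> then w x else x)" (is "_-lipschitz_on _ ?W")
proof (rule lipschitz_onI)
  have mixed: "dist (w x) y \<le> max L 1 * dist x y" if x: "x \<in> \<Omega>" and y: "y \<notin> \<Omega>" for x y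
  proof -
    have "closed_segment x y \<inter> frontier \<Omega> \<noteq> {}"
      using x y by (intro connected_Int_frontier) auto
    then obtain z where z: "z \<in> closed_segment x y" "z \<in> frontier \<Omega>" by blast
    have d: "dist x y = dist x z + dist z y"
      using z(1) by (metis between between_mem_segment)
    have "dist (w x) y \<le> dist (w x) (w z) + dist z y"
      using dist_triangle[of "w x" y "w z"] bd[OF z(2)] by simp
    also have "dist (w x) (w z) \<le> L * dist x z"
      using x z(2) closure_subset by (intro lipschitz_onD[OF w]) (auto simp: frontier_def)
    also have "L * dist x z + dist z y \<le> max L 1 * dist x z + max L 1 * dist z y"
      using mult_right_mono[of 1 "max L 1" "dist z y"] by (intro add_mono mult_right_mono) auto
    finally show ?thesis by (simp add: d distrib_left)
  qed
  fix x y :: 'a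
  consider "x \<in> \<Omega>" "y \<in> \<Omega>" | "x \<in> \<Omega>" "y \<notin> \<Omega>" | "x \<notin> \<Omega>" "y \<in> \<Omega>" | "x \<notin> \<Omega>" "y \<notin> \<Omega>" by blast
  then show "dist (?W x) (?W y) \<le> max L 1 * dist x y"
  proof cases
    case 1
    then have "dist (w x) (w y) \<le> L * dist x y"
      using closure_subset by (intro lipschitz_onD[OF w]) auto
    also have "\<dots> \<le> max L 1 * dist x y" by (intro mult_right_mono) auto
    finally show ?thesis using 1 by simp
  next
    case 2
    then show ?thesis using mixed[of x y] by simp
  next
    case 3
    then show ?thesis using mixed[of y x] by (simp add: dist_commute)
  next
    case 4
    then show ?thesis using mult_right_mono[of 1 "max L 1" "dist x y"] by simp
  qed
qed simp

text \<open>The derivatives of a map given on an open set may be computed from any extension.\<close>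
lemma jac_eq_ddir:
  fixes u :: "real^2 \<Rightarrow> real^2"
  assumes "open \<Omega>" "x \<in> \<Omega>" "\<And>y. y \<in> \<Omega> \<Longrightarrow> u y $ i = \<phi> y" "diff_along \<phi> (axis j 1) x"
  shows "jac u x $ i $ j = ddir (axis j 1) \<phi> x"
proof -
  have "ddir (axis j 1) (\<lambda>x. u x $ i) x = ddir (axis j 1) \<phi> x" "diff_along (\<lambda>x. u x $ i) (axis j 1) x"
    using ddir_cong[OF assms(1-3), where e="axis j 1"] assms(4) by simp_all
  then show ?thesis by (simp add: jac_def ddir_def)
qed

theorem theorem4p3:
  fixes \<Omega> :: "(real ^ 2) set"
    and h :: "real \<Rightarrow> real"
    and \<mu> :: real
    and u v :: "real ^ 2 \<Rightarrow> real ^ 2"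
  assumes "open \<Omega>" and "connected \<Omega>" and "\<Omega> \<noteq> {}" and "bounded \<Omega>"
    and "continuous_on UNIV h" and "strict_mono h" and "h 0 = 0" and "h 1 = 1"
    and "\<mu> > 0"
    and "\<exists>L. L-lipschitz_on (closure \<Omega>) u"
    and "\<exists>L. L-lipschitz_on (closure \<Omega>) v"
    and "AE x in lebesgue_on \<Omega>. h (det (jac u x)) *\<^sub>R jac u x = jac v x"
    and "\<And>x. x \<in> frontier \<Omega> \<Longrightarrow> u x = x"
    and "\<And>x. x \<in> frontier \<Omega> \<Longrightarrow> v x = \<mu> *\<^sub>R x"
    and "AE x in lebesgue_on \<Omega>. det (jac u x) \<ge> 0"
  shows "(AE x in lebesgue_on \<Omega>. det (jac u x) = 1) \<and> \<mu> = 1 \<and>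
    (\<forall>x \<in> closure \<Omega>. u x = v x)"
proof -
  have \<mu>: "0 < \<mu>" by fact
  have \<Omega>_sets: "\<Omega> \<in> sets lebesgue" using \<open>open \<Omega>\<close> by auto
  have AE_on: "(AE x in lebesgue_on \<Omega>. Q x) \<longleftrightarrow> (AE x in lborel. x \<in> \<Omega> \<longrightarrow> Q x)" for Q
    using \<Omega>_sets by (simp add: AE_restrict_space_iff AE_completion_iff)
  define U where "U x = (if x \<in> \<Omega> then u x else x)" for x
  define F where "F x = (if x \<in> \<Omega> then (1 / \<mu>) *\<^sub>R v x else x)" for x
  obtain LU where LU: "LU-lipschitz_on UNIV U"
    using lipschitz_extend_by_id assms(10,13) unfolding U_def[abs_def] by blast
  obtain LF where LF: "LF-lipschitz_on UNIV F"
  proof -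
    obtain L where "L-lipschitz_on (closure \<Omega>) v" using assms(11) by blast
    then have "(\<bar>1 / \<mu>\<bar> * L)-lipschitz_on (closure \<Omega>) (\<lambda>x. (1 / \<mu>) *\<^sub>R v x)"
      by (rule lipschitz_on_cmult)
    then have "(max (\<bar>1 / \<mu>\<bar> * L) 1)-lipschitz_on UNIV F"
      unfolding F_def[abs_def] by (rule lipschitz_extend_by_id) (use assms(14) \<mu> in auto)
    then show thesis by (rule that)
  qed
  obtain R where R: "\<And>x. x \<in> \<Omega> \<Longrightarrow> norm x \<le> R"
    using \<open>bounded \<Omega>\<close> by (auto simp: bounded_iff)
  have far: "U x = x" "F x = x" if "R < norm x" for x
    using that R[of x] by (auto simp: U_def F_def)
  have lipU: "lip (\<lambda>x. U x $ i)" and lipF: "lip (\<lambda>x. F x $ i)" for i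
    using lipschitz_component[OF LU] lipschitz_component[OF LF] by blast+
  define JU JF where "JU = jac2 (\<lambda>x. U x $ 1) (\<lambda>x. U x $ 2)" and "JF = jac2 (\<lambda>x. F x $ 1) (\<lambda>x. F x $ 2)"

  have diff: "AE x in lborel. \<forall>i. diff_along (\<lambda>x. U x $ i) e1 x \<and> diff_along (\<lambda>x. U x $ i) e2 x \<and>
      diff_along (\<lambda>x. F x $ i) e1 x \<and> diff_along (\<lambda>x. F x $ i) e2 x"
    unfolding forall_2
    by (intro AE_conjI lip_diff_along_AE lipU lipF)

  have jac_U: "jac u x $ i $ 1 = ddir e1 (\<lambda>x. U x $ i) x" "jac u x $ i $ 2 = ddir e2 (\<lambda>x. U x $ i) x"
    if "x \<in> \<Omega>" "\<forall>i. diff_along (\<lambda>x. U x $ i) e1 x \<and> diff_along (\<lambda>x. U x $ i) e2 x" for x i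
    using that unfolding e1_def e2_def by (auto intro!: jac_eq_ddir[OF \<open>open \<Omega>\<close>] simp: U_def)
  have det_U: "det (jac u x) = JU x"
    if "x \<in> \<Omega>" "\<forall>i. diff_along (\<lambda>x. U x $ i) e1 x \<and> diff_along (\<lambda>x. U x $ i) e2 x" for x
    by (simp add: det_2 jac_U[OF that] JU_def jac2_def)
  have jac_F: "jac v x $ i $ 1 = \<mu> * ddir e1 (\<lambda>x. F x $ i) x" "jac v x $ i $ 2 = \<mu> * ddir e2 (\<lambda>x. F x $ i) x"
    if x: "x \<in> \<Omega>" and d: "\<forall>i. diff_along (\<lambda>x. F x $ i) e1 x \<and> diff_along (\<lambda>x. F x $ i) e2 x" for x i
  proof -
    have v: "v y $ i = \<mu> * F y $ i" if "y \<in> \<Omega>" for y using that \<mu> by (simp add: F_def)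
    have *: "diff_along (\<lambda>x. \<mu> * F x $ i) e x" "ddir e (\<lambda>x. \<mu> * F x $ i) x = \<mu> * ddir e (\<lambda>x. F x $ i) x"
      if "diff_along (\<lambda>x. F x $ i) e x" for e
      using ddirI(1)[OF DERIV_cmult[OF has_derivative_ddir[OF that]]] ddir_cmult[OF that] by auto
    show "jac v x $ i $ 1 = \<mu> * ddir e1 (\<lambda>x. F x $ i) x"
      using jac_eq_ddir[where \<phi>="\<lambda>x. \<mu> * F x $ i", OF \<open>open \<Omega>\<close> x v] *[of e1] d unfolding e1_def by simp
    show "jac v x $ i $ 2 = \<mu> * ddir e2 (\<lambda>x. F x $ i) x"
      using jac_eq_ddir[where \<phi>="\<lambda>x. \<mu> * F x $ i", OF \<open>open \<Omega>\<close> x v] *[of e2] d unfolding e2_def by simp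
  qed
  have inside: "AE x in lborel. x \<in> \<Omega> \<longrightarrow> 0 \<le> JU x \<and>
      (\<forall>i. ddir e1 (\<lambda>x. F x $ i) x = h (JU x) / \<mu> * ddir e1 (\<lambda>x. U x $ i) x \<and>
           ddir e2 (\<lambda>x. F x $ i) x = h (JU x) / \<mu> * ddir e2 (\<lambda>x. U x $ i) x)"
    using assms(12)[unfolded AE_on] assms(15)[unfolded AE_on] diff
  proof eventually_elim
    case (elim x)
    show ?case
    proof (intro impI conjI allI)
      assume x: "x \<in> \<Omega>"
      have d: "det (jac u x) = JU x" using elim(3) by (intro det_U x) blast
      then show "0 \<le> JU x" using elim(2) x by simp
      have eq: "h (JU x) * jac u x $ i $ j = jac v x $ i $ j" for i j
        using elim(1) x d by (metis vector_scaleR_component real_scaleR_def)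
      fix i
      show "ddir e1 (\<lambda>x. F x $ i) x = h (JU x) / \<mu> * ddir e1 (\<lambda>x. U x $ i) x"
        using eq[of i 1] jac_U(1)[OF x, of i] jac_F(1)[OF x, of i] elim(3) \<mu> by (simp add: field_simps)
      show "ddir e2 (\<lambda>x. F x $ i) x = h (JU x) / \<mu> * ddir e2 (\<lambda>x. U x $ i) x"
        using eq[of i 2] jac_U(2)[OF x, of i] jac_F(2)[OF x, of i] elim(3) \<mu> by (simp add: field_simps)
    qed
  qed

  \<comment> \<open>The frontier may have positive measure without having interior points; what determines the derivatives
    there is that the map minus the identity vanishes on the complement of \<open>\<Omega>\<close>.\<close>
  have outside: "AE x in lborel. x \<notin> \<Omega> \<longrightarrow> (\<forall>i. ddir e1 (\<lambda>x. U x $ i) x = e1 $ i \<and> ddir e2 (\<lambda>x. U x $ i) x = e2 $ i \<and>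
      ddir e1 (\<lambda>x. F x $ i) x = e1 $ i \<and> ddir e2 (\<lambda>x. F x $ i) x = e2 $ i)"
  proof -
    have *: "AE x in lborel. x \<notin> \<Omega> \<longrightarrow> ddir e (\<lambda>x. W x $ i) x = e $ i"
      if W: "lip (\<lambda>x. W x $ i)" "\<And>x. x \<notin> \<Omega> \<Longrightarrow> W x = x" for W :: "real^2 \<Rightarrow> real^2" and e i
    proof -
      obtain L where "L-lipschitz_on UNIV (\<lambda>x. W x $ i - x $ i)" using lip_diff[OF W(1) lip_coord] by blast
      from ddir_eq_0_on_zero_set_AE[OF this, of e] lip_diff_along_AE[OF W(1), of e]
      show ?thesis
      proof eventually_elim
        case (elim x)
        show ?case
          using elim W(2)[of x] ddir_diff[OF elim(2) ddir_coord(2)[of i]] by (auto simp: ddir_coord)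
      qed
    qed
    have "AE x in lborel. \<forall>i. (x \<notin> \<Omega> \<longrightarrow> ddir e1 (\<lambda>x. U x $ i) x = e1 $ i) \<and> (x \<notin> \<Omega> \<longrightarrow> ddir e2 (\<lambda>x. U x $ i) x = e2 $ i) \<and>
      (x \<notin> \<Omega> \<longrightarrow> ddir e1 (\<lambda>x. F x $ i) x = e1 $ i) \<and> (x \<notin> \<Omega> \<longrightarrow> ddir e2 (\<lambda>x. F x $ i) x = e2 $ i)"
      unfolding forall_2 by (intro AE_conjI * lipU lipF) (simp_all add: U_def F_def)
    then show ?thesis by eventually_elim blast
  qed

  define w where "w i x = F x $ i - U x $ i" for i x
  have lip_w: "lip (w i)" for i unfolding w_def by (rule lip_diff[OF lipF lipU])
  have w_far: "w i x = 0" if "R < norm x" for i x using far[OF that] by (simp add: w_def)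
  have ddir_w: "AE x in lborel. \<forall>i. ddir e1 (w i) x = ddir e1 (\<lambda>x. F x $ i) x - ddir e1 (\<lambda>x. U x $ i) x \<and>
      ddir e2 (w i) x = ddir e2 (\<lambda>x. F x $ i) x - ddir e2 (\<lambda>x. U x $ i) x"
    using diff by eventually_elim (simp add: w_def[abs_def] ddir_diff)
  have jac_w: "AE x in lborel. (x \<in> \<Omega> \<longrightarrow> jac2 (w 1) (w 2) x = (h (JU x) / \<mu> - 1)\<^sup>2 * JU x) \<and> (x \<notin> \<Omega> \<longrightarrow> jac2 (w 1) (w 2) x = 0)"
    using inside outside ddir_w
  proof eventually_elim
    case (elim x)
    have "jac2 (w 1) (w 2) x = (h (JU x) / \<mu> - 1)\<^sup>2 * JU x" if x: "x \<in> \<Omega>"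
    proof -
      define q where "q = h (JU x) / \<mu>"
      have "ddir e1 (w i) x = (q - 1) * ddir e1 (\<lambda>x. U x $ i) x" "ddir e2 (w i) x = (q - 1) * ddir e2 (\<lambda>x. U x $ i) x" for i
        using elim(1,3) x by (simp_all add: q_def[symmetric] left_diff_distrib)
      then have "jac2 (w 1) (w 2) x = (q - 1)\<^sup>2 * JU x"
        unfolding jac2_def JU_def power2_eq_square by (simp only:) (simp add: algebra_simps)
      then show ?thesis by (simp only: q_def)
    qed
    then show ?case using elim(2,3) by (auto simp: jac2_def)
  qed
  note int_w = integral_jac2_eq_0[OF lip_w[of 1] lip_w[of 2] w_far[where i=1]]
  have nonneg: "AE x in lborel. 0 \<le> jac2 (w 1) (w 2) x"
    using jac_w inside
  proof eventually_elim
    case (elim x)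
    then show ?case by (cases "x \<in> \<Omega>") auto
  qed
  have "AE x in lborel. jac2 (w 1) (w 2) x = 0"
    using int_w(2) integral_nonneg_eq_0_iff_AE[OF int_w(1) nonneg] by simp
  then have alternative: "AE x in lborel. x \<in> \<Omega> \<longrightarrow> JU x = 0 \<or> h (JU x) = \<mu>"
    using jac_w by eventually_elim (use \<mu> in auto)

  \<comment> \<open>If \<open>h\<close> does not take the value \<open>\<mu>\<close> on the half-line, the second alternative is void, and any
    positive number serves as \<open>c\<close>.\<close>
  obtain c where c: "0 < c" "\<And>d. 0 \<le> d \<Longrightarrow> h d = \<mu> \<Longrightarrow> d = c"
  proof (cases "\<exists>d\<ge>0. h d = \<mu>")
    case True
    then obtain d where d: "0 \<le> d" "h d = \<mu>" by blast
    have "d \<noteq> 0" using d(2) \<open>h 0 = 0\<close> \<mu> by auto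
    then have "0 < d" using d(1) by simp
    moreover have "d' = d" if "h d' = \<mu>" for d'
      using that d(2) strict_mono_eq[OF \<open>strict_mono h\<close>, of d' d] by simp
    ultimately show thesis by (rule that)
  next
    case False
    then show thesis using that[of 1] by force
  qed

  \<comment> \<open>The Jacobian of \<open>F\<close> is \<open>c\<close> at the noncritical points of \<open>\<Omega>\<close> and \<open>1\<close> outside \<open>\<Omega>\<close>.\<close>
  have "AE x in lborel. min c 1 \<le> JF x"
    unfolding JF_def
  proof (rule lipschitz_map_no_critical_set[OF LF far(2)])
    show "0 < min c 1" using c(1) by simp
    show "AE x in lborel. (\<forall>i. ddir e1 (\<lambda>x. F x $ i) x = 0 \<and> ddir e2 (\<lambda>x. F x $ i) x = 0)
        \<or> min c 1 \<le> jac2 (\<lambda>x. F x $ 1) (\<lambda>x. F x $ 2) x"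
      using inside outside alternative
    proof eventually_elim
      case (elim x)
      consider "x \<notin> \<Omega>" | "x \<in> \<Omega>" "JU x = 0" | "x \<in> \<Omega>" "h (JU x) = \<mu>" using elim(3) by blast
      then show ?case
      proof cases
        case 1
        then show ?thesis using elim(2) by (simp add: jac2_def)
      next
        case 2
        then show ?thesis using elim(1) \<open>h 0 = 0\<close> by simp
      next
        case 3
        then have "JU x = c" using elim(1) c(2) by blast
        then show ?thesis using 3 elim(1) \<mu> by (simp add: jac2_def JU_def)
      qed
    qed
  qed
  then have J_const: "AE x in lborel. x \<in> \<Omega> \<longrightarrow> JU x = c \<and> h (JU x) = \<mu>"
    using inside alternative
  proof eventually_elim
    case (elim x)
    show ?case
    proof
      assume x: "x \<in> \<Omega>"
      have "JU x \<noteq> 0"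
      proof
        assume "JU x = 0"
        then have "JF x = 0" using elim(2) x \<open>h 0 = 0\<close> by (simp add: JF_def jac2_def)
        then show False using elim(1) c(1) by simp
      qed
      then have "h (JU x) = \<mu>" using elim(3) x by blast
      then show "JU x = c \<and> h (JU x) = \<mu>" using c(2) elim(2) x by blast
    qed
  qed

  have ddir_w_0: "AE x in lborel. ddir e1 (w i) x = 0" for i
    using ddir_w inside outside J_const
  proof eventually_elim
    case (elim x)
    then show ?case using \<mu> by (cases "x \<in> \<Omega>") auto
  qed
  have "w i x = 0" for i x
    by (rule zero_of_ddir_zero_AE[OF lip_w[of i] w_far[where i=i] ddir_w_0])
  then have FU: "F x = U x" for x
    by (simp add: vec_eq_iff w_def)

  have "c = 1"
  proof -
    define p where "p i x = U x $ i - x $ i" for i x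
    have lip_p: "lip (p i)" for i unfolding p_def by (rule lip_diff[OF lipU lip_coord])
    have p_far: "p i x = 0" if "R < norm x" for i x using far(1)[OF that] by (simp add: p_def)
    note I1 = integral_jac2_eq_0[OF lip_p[of 1] lipU[of 2] p_far[where i=1]]
    note I2 = integral_jac2_eq_0'[OF lip_coord[of 1] lip_p[of 2] p_far[where i=2]]
    \<comment> \<open>The Jacobian is bilinear, so \<open>det Du - 1\<close> splits into two Jacobians with an entry of bounded
      support.\<close>
    have eq: "AE x in lborel. jac2 (p 1) (\<lambda>x. U x $ 2) x + jac2 (\<lambda>x. x $ 1) (p 2) x = (c - 1) * indicator \<Omega> x"
      using diff J_const outside
    proof eventually_elim
      case (elim x)
      have dp: "ddir e1 (p i) x = ddir e1 (\<lambda>x. U x $ i) x - e1 $ i" "ddir e2 (p i) x = ddir e2 (\<lambda>x. U x $ i) x - e2 $ i" for i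
        using elim(1) by (simp_all add: p_def[abs_def] ddir_diff ddir_coord)
      have "jac2 (p 1) (\<lambda>x. U x $ 2) x + jac2 (\<lambda>x. x $ 1) (p 2) x = JU x - 1"
        by (simp add: jac2_def JU_def dp ddir_coord algebra_simps)
      also have "\<dots> = (c - 1) * indicator \<Omega> x"
        using elim(2,3) by (cases "x \<in> \<Omega>") (auto simp: JU_def jac2_def)
      finally show ?case .
    qed
    have fin: "emeasure lborel \<Omega> < \<infinity>" using \<open>bounded \<Omega>\<close> by (rule emeasure_bounded_finite)
    have "(c - 1) * measure lborel \<Omega> = (\<integral>x. (c - 1) * indicator \<Omega> x \<partial>lborel)" by simp
    also have "\<dots> = (\<integral>x. jac2 (p 1) (\<lambda>x. U x $ 2) x + jac2 (\<lambda>x. x $ 1) (p 2) x \<partial>lborel)"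
    proof (rule integral_cong_AE)
      show "(\<lambda>x. (c - 1) * indicator \<Omega> x) \<in> borel_measurable lborel" using \<open>open \<Omega>\<close> by simp
      show "(\<lambda>x. jac2 (p 1) (\<lambda>x. U x $ 2) x + jac2 (\<lambda>x. x $ 1) (p 2) x) \<in> borel_measurable lborel"
        using I1(1) I2(1) by (intro borel_measurable_add) auto
    qed (use eq in eventually_elim, simp)
    also have "\<dots> = 0" using I1 I2 by simp
    finally have "c = 1 \<or> measure lborel \<Omega> = 0" by simp
    moreover have "measure lborel \<Omega> \<noteq> 0"
    proof
      assume "measure lborel \<Omega> = 0"
      then have "emeasure lborel \<Omega> = 0"
        using fin by (auto simp: measure_def enn2real_eq_0_iff)
      then have "\<Omega> \<in> null_sets lborel" using \<open>open \<Omega>\<close> by auto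
      then show False using AE_not_in not_AE_not_in_open[OF \<open>open \<Omega>\<close> \<open>\<Omega> \<noteq> {}\<close>] by blast
    qed
    ultimately show ?thesis by blast
  qed
  have "\<mu> = 1"
  proof (rule ccontr)
    assume "\<mu> \<noteq> 1"
    have "AE x in lborel. x \<notin> \<Omega>"
      using J_const by eventually_elim (use \<open>\<mu> \<noteq> 1\<close> \<open>c = 1\<close> \<open>h 1 = 1\<close> in auto)
    then show False using not_AE_not_in_open[OF \<open>open \<Omega>\<close> \<open>\<Omega> \<noteq> {}\<close>] by blast
  qed
  moreover have "AE x in lebesgue_on \<Omega>. det (jac u x) = 1"
    unfolding AE_on using J_const diff
  proof eventually_elim
    case (elim x)
    then show ?case using det_U[of x] \<open>c = 1\<close> by auto
  qed
  moreover have "u x = v x" if "x \<in> closure \<Omega>" for x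
  proof (cases "x \<in> \<Omega>")
    case True
    then show ?thesis using FU[of x] \<open>\<mu> = 1\<close> by (simp add: F_def U_def)
  next
    case False
    then have "x \<in> frontier \<Omega>" using that \<open>open \<Omega>\<close> by (simp add: frontier_def interior_open)
    then show ?thesis using assms(13,14) \<open>\<mu> = 1\<close> by simp
  qed
  ultimately show ?thesis by blast
qed

end
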